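(* Let $j$ be an even integer, let $a,b$ be integers with $b>1$, $0\le a<b$, and let $\alpha(n)$ denote either $\overline{p}_j(2n)$ or $\overline{p}_j(a,b;2n)$. Then there exist sequences of positive real numbers $\{A(n)\}$ and $\{\delta(n)\}$ with $\delta(n)\to0$ such that for every $d\ge1$, $$\lim_{n\to\infty}\widehat{J}^{d,n}_{\alpha}(X)=H_d(X)$$ uniformly for $X$ in compact subsets of $\mathbb{R}$, where $\widehat{J}^{d,n}_{\alpha}(X):=\frac{\delta(n)^{-d}}{\alpha(n)}J^{d,n}_{\alpha}\!\left(\frac{\delta(n)X-1}{\exp(A(n))}\right)$. Consequently, for each $d$ the Jensen polynomials $J^{d,n}_\alpha$ are hyperbolic for all but finitely many $n$, i.e. the sequence $\alpha(n)$ asymptotically satisfies all higher-order Turán inequalities.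
   Context: For a partition $\lambda=(\lambda_1,\dots,\lambda_\nu)$ (parts non-increasing, $\nu$ the number of parts), its BG-rank is $\sum_{i=1}^{\nu}(-1)^{i+1}\operatorname{par}(\lambda_i)$, where $\operatorname{par}(x)\in\{0,1\}$ is $x\bmod 2$. Via Littlewood's bijection, $\lambda$ corresponds to its $2$-core together with its $2$-quotient $(\hat\lambda_0,\hat\lambda_1)$; the $2$-quotient rank of $\lambda$ is $\nu(\hat\lambda_0)-\nu(\hat\lambda_1)$. Equivalently, if $\overline{p}_j(m,n)$ counts partitions of $n$ with BG-rank $j$ and $2$-quotient rank $m$, then $\sum_{n,m}\overline{p}_j(m,n)\zeta^mq^n=\frac{q^{(2j-1)j}}{(\zeta q^2;q^2)_\infty(\zeta^{-1}q^2;q^2)_\infty}$ with $(x;q)_\infty=\prod_{k\ge0}(1-xq^k)$. $\overline{p}_j(n)$ is the number of partitions of $n$ with BG-rank $j$; $\overline{p}_j(a,b;n)$ is the number with BG-rank $j$ and $2$-quotient rank $\equiv a \pmod b$. The Jensen polynomial of degree $d$ and shift $n$ of a sequence $\alpha$ is $J^{d,n}_\alpha(X)=\sum_{k=0}^{d}\binom{d}{k}\alpha(n+k)X^k$; it is hyperbolic if all its roots are real. $H_d(X)$ are the Hermite polynomials, defined by $\sum_{d\ge0}H_d(X)\frac{t^d}{d!}=e^{-t^2+Xt}$. The sequences $A(n),\delta(n)$ are those for which, for each $d$, $\log\frac{\alpha(n+k)}{\alpha(n)}=A(n)k-\delta(n)^2k^2+\sum_{i=3}^d g_i(n)k^i+o(\delta(n)^d)$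 with $g_i(n)=o(\delta(n)^i)$. *)

theory Defs
  imports "HOL-Analysis.Analysis"
begin

definition is_partition :: "nat list \<Rightarrow> bool" where
  "is_partition l \<longleftrightarrow> sorted_wrt (\<ge>) l \<and> (\<forall>x\<in>set l. 0 < x)"

definition partitions :: "nat \<Rightarrow> nat list set" where
  "partitions n = {l. is_partition l \<and> sum_list l = n}"

text \<open>BG-rank: sum over i = 1..nu of (-1)^(i+1) par(lambda_i) (0-indexed here).\<close>

definition bg_rank :: "nat list \<Rightarrow> int" where
  "bg_rank l = (\<Sum>i<length l. (-1) ^ i * int (l ! i mod 2))"

text \<open>Littlewood's 2-quotient via beta-numbers: with t = the number of parts rounded
  up to an even number, beta_i = lambda_i + t - i (i = 1..t, lambda_i = 0 for i > nu).
  The beta-numbers congruent to r mod 2, halved (floor), form a beta-set of the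
  r-th quotient partition.\<close>

definition beta_set :: "nat list \<Rightarrow> nat \<Rightarrow> nat set" where
  "beta_set l t = {(if i < length l then l ! i else 0) + t - 1 - i | i. i < t}"

definition partition_of_beta :: "nat set \<Rightarrow> nat list" where
  "partition_of_beta K =
     (let ks = rev (sorted_list_of_set K); s = length ks
      in filter (\<lambda>x. 0 < x) (map (\<lambda>i. ks ! i - (s - 1 - i)) [0..<s]))"

definition two_quotient :: "nat list \<Rightarrow> nat list \<times> nat list" where
  "two_quotient l =
     (let t = 2 * ((length l + 1) div 2); B = beta_set l t
      in (partition_of_beta {k. 2 * k \<in> B}, partition_of_beta {k. 2 * k + 1 \<in> B}))"

definition quot_rank :: "nat list \<Rightarrow> int" where
  "quot_rank l = int (length (fst (two_quotient l))) - int (length (snd (two_quotient l)))"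

definition pbar :: "int \<Rightarrow> nat \<Rightarrow> nat" where
  "pbar j n = card {l \<in> partitions n. bg_rank l = j}"

definition pbar_mod :: "int \<Rightarrow> int \<Rightarrow> int \<Rightarrow> nat \<Rightarrow> nat" where
  "pbar_mod j a b n = card {l \<in> partitions n. bg_rank l = j \<and> quot_rank l mod b = a}"

definition jensen :: "nat \<Rightarrow> nat \<Rightarrow> (nat \<Rightarrow> real) \<Rightarrow> 'a::real_normed_field \<Rightarrow> 'a" where
  "jensen d n \<alpha> X = (\<Sum>k\<le>d. of_nat (d choose k) * of_real (\<alpha> (n + k)) * X ^ k)"

definition hyperbolic_jensen :: "nat \<Rightarrow> nat \<Rightarrow> (nat \<Rightarrow> real) \<Rightarrow> bool" where
  "hyperbolic_jensen d n \<alpha> \<longleftrightarrow> (\<forall>z::complex. jensen d n \<alpha> z = 0 \<longrightarrow> z \<in> \<real>)"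

text \<open>Hermite polynomials via the generating function exp(-t^2 + X t):
  H_d(X) is d! times the t^d Taylor coefficient, i.e. the d-th t-derivative at 0.\<close>

definition hermite :: "nat \<Rightarrow> real \<Rightarrow> real" where
  "hermite d X = (deriv ^^ d) (\<lambda>t::real. exp (- (t ^ 2) + X * t)) 0"

definition jensen_hat :: "nat \<Rightarrow> nat \<Rightarrow> (nat \<Rightarrow> real) \<Rightarrow> (nat \<Rightarrow> real) \<Rightarrow> (nat \<Rightarrow> real) \<Rightarrow> real \<Rightarrow> real" where
  "jensen_hat d n \<alpha> A \<delta> X =
     inverse (\<delta> n ^ d) / \<alpha> n * jensen d n \<alpha> ((\<delta> n * X - 1) / exp (A n))"

end

theory Submission
  imports Defs "HOL-Probability.Characteristic_Functions" "HOL-Probability.Sinc_Integral"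
begin

text \<open>
  By Littlewood's bijection \<open>\<alpha>(n)\<close> counts, up to a shift of \<open>n\<close>, the pairs of partitions of total
  size \<open>N\<close> whose numbers of parts differ by \<open>a\<close> modulo \<open>b\<close>. Write \<open>\<alpha>\<close> as a Fourier
  integral over the circle of radius \<open>exp (- A)\<close>, where \<open>A\<close> is the saddle point. With
  \<open>X = (\<delta> x - 1) / exp A\<close> the binomial sum defining the Jensen polynomial can be carried out under
  the integral sign: it replaces the integrand by its product with
  \<open>(x cis (- \<theta>) + (1 - cis (- \<theta>)) / \<delta>) ^ d\<close>. On the scale \<open>u = \<theta> / (\<delta> sqrt 2)\<close> this factor tends to
  \<open>(x + i sqrt 2 u) ^ d\<close> and the integrand to \<open>exp (- u\<^sup>2 / 2)\<close>, and the Gaussian mean of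
  \<open>(x + i sqrt 2 u) ^ d\<close> is \<open>H\<^sub>d(x)\<close>. So dominated convergence suffices, and the
  asymptotic expansion of \<open>\<alpha>\<close> to all orders is not needed. Hyperbolicity follows because \<open>H\<^sub>d\<close>
  changes sign \<open>d\<close> times.
\<close>

section \<open>Littlewood's 2-quotient bijection\<close>

text \<open>The values \<open>\<alpha>(N + k)\<close> with \<open>k \<le> d\<close> are all read off
  one circle, whose radius is adapted to \<open>N\<close>, so their ratios need no asymptotics of
  their own. Three choices keep the analysis elementary. The products are cut at parts of size
  \<open>2 * N\<close>, which leaves only finite products. No transformation formula of the eta
  function enters: it is enough that the variance lies between constant multiples of A^(-3), and
  termwise bounds give this. The condition modulo \<open>b\<close> is resolved by
  \<open>b\<close>-th roots of unity; every nontrivial root yields a factor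
  \<open>exp (- c / A)\<close> uniformly on the whole circle, so the residue class leaves no trace
  in the limit, and the unrestricted count is the case \<open>b = 1\<close>. The scale is
  \<open>\<delta> = 1 / (sqrt 2 * \<sigma>)\<close> with \<open>\<sigma>\<close> the standard
  deviation, because a Gaussian profile makes \<open>\<alpha>(N + k) / \<alpha>(N)\<close> about
  \<open>exp (A * k - k\<^sup>2 / (2 * \<sigma>\<^sup>2))\<close>, whose quadratic coefficient is to
  be \<open>- \<delta>\<^sup>2\<close>.\<close>

lemma finite_partitions: "finite (partitions n)"
proof -
  have "partitions n \<subseteq> {l. set l \<subseteq> {..n} \<and> length l \<le> n}"
  proof
    fix l assume l: "l \<in> partitions n"
    then have pos: "\<forall>x\<in>set l. 0 < x" and s: "sum_list l = n"
      by (auto simp: partitions_def is_partition_def)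
    have "set l \<subseteq> {..n}"
      using s member_le_sum_list by fastforce
    moreover have "length l \<le> sum_list l" using pos
      by (induction l) auto
    ultimately show "l \<in> {l. set l \<subseteq> {..n} \<and> length l \<le> n}" using s by simp
  qed
  then show ?thesis
    using finite_lists_length_le[of "{..n}" n] finite_subset by blast
qed

lemma length_le_sum_partition: "is_partition l \<Longrightarrow> length l \<le> sum_list l"
  unfolding is_partition_def by (induction l) auto

section \<open>Beta-sets as encodings of partitions\<close>

definition pad :: "nat list \<Rightarrow> nat \<Rightarrow> nat" where
  "pad l i = (if i < length l then l ! i else 0)"

lemma pad_antimono:
  assumes "is_partition l" "i \<le> k" shows "pad l k \<le> pad l i"
  using assms unfolding pad_def is_partition_def
  by (cases "i = k") (auto simp: sorted_wrt_iff_nth_less)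

lemma beta_set_eq_image: "beta_set l t = (\<lambda>i. pad l i + t - 1 - i) ` {..<t}"
  unfolding beta_set_def pad_def by (simp only: setcompr_eq_image lessThan_def)

lemma beta_strict:
  assumes "is_partition l" "i < k" "k < t"
  shows "pad l k + t - 1 - k < pad l i + t - 1 - i"
  using pad_antimono[OF assms(1), of i k] assms by linarith

lemma inj_on_beta: "is_partition l \<Longrightarrow> inj_on (\<lambda>i. pad l i + t - 1 - i) {..<t}"
  by (rule linorder_inj_onI') (use beta_strict in fastforce)

lemma card_beta_set: "is_partition l \<Longrightarrow> card (beta_set l t) = t"
  unfolding beta_set_eq_image by (subst card_image[OF inj_on_beta]) auto

lemma finite_beta_set: "finite (beta_set l t)"
  by (simp add: beta_set_eq_image)

lemma sum_pad: "length l \<le> t \<Longrightarrow> (\<Sum>i<t. pad l i) = sum_list l"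
proof -
  assume "length l \<le> t"
  then have "(\<Sum>i<t. pad l i) = (\<Sum>i<length l. pad l i)"
    by (intro sum.mono_neutral_right) (auto simp: pad_def)
  also have "\<dots> = (\<Sum>i<length l. l ! i)" by (simp add: pad_def)
  also have "\<dots> = sum_list l" by (simp add: sum_list_sum_nth atLeast0LessThan)
  finally show ?thesis .
qed

text \<open>The staircase \<open>0, ..., t - 1\<close> added to the parts contributes t (t - 1) / 2.
  Doubling and moving \<open>t\<close> to the left avoid division and truncated subtraction.\<close>

lemma sum_beta_set:
  assumes "is_partition l" "length l \<le> t"
  shows "2 * \<Sum>(beta_set l t) + t = 2 * sum_list l + t * t"
proof -
  have "\<Sum>(beta_set l t) = (\<Sum>i<t. pad l i + t - 1 - i)"
    unfolding beta_set_eq_image by (subst sum.reindex[OF inj_on_beta[OF assms(1)]]) simp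
  also have "\<dots> = (\<Sum>i<t. pad l i + (t - 1 - i))" by (rule sum.cong) auto
  also have "\<dots> = sum_list l + (\<Sum>i<t. t - 1 - i)"
    by (simp only: sum.distrib sum_pad assms)
  also have "(\<Sum>i<t. t - 1 - i) = (\<Sum>i<t. i)"
    using sum.nat_diff_reindex[of "\<lambda>i. i" t] by simp
  finally have "\<Sum>(beta_set l t) = sum_list l + (\<Sum>i<t. i)" .
  moreover have "2 * (\<Sum>i<t. i) + t = t * t"
    by (induction t) auto
  ultimately show ?thesis by simp
qed

text \<open>A further zero part raises every old beta-number by one and contributes the new
  beta-number \<open>0\<close>.\<close>

lemma beta_set_Suc:
  assumes "length l \<le> t"
  shows "beta_set l (Suc t) = insert 0 (Suc ` beta_set l t)"
proof -
  have "{..<Suc t} = insert t {..<t}" by auto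
  moreover have "pad l t = 0" using assms by (simp add: pad_def)
  moreover have "pad l i + Suc t - 1 - i = Suc (pad l i + t - 1 - i)" if "i < t" for i
    using that by simp
  ultimately show ?thesis
    by (auto simp: beta_set_eq_image image_image)
qed

lemma rev_sorted_list_of_beta_set:
  assumes "is_partition l"
  shows "rev (sorted_list_of_set (beta_set l t)) = map (\<lambda>i. pad l i + t - 1 - i) [0..<t]"
proof -
  let ?xs = "rev (map (\<lambda>i. pad l i + t - 1 - i) [0..<t])"
  have "sorted_wrt (<) ?xs"
    unfolding sorted_wrt_rev sorted_wrt_map
    using beta_strict[OF assms] by (auto simp: sorted_wrt_iff_nth_less)
  moreover have "set ?xs = beta_set l t" by (auto simp: beta_set_eq_image)
  ultimately have "sorted_list_of_set (beta_set l t) = ?xs"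
    by (metis strict_sorted_equal finite_beta_set sorted_list_of_set.strict_sorted_key_list_of_set
        sorted_list_of_set.set_sorted_key_list_of_set)
  then show ?thesis by simp
qed

lemma filter_pad:
  assumes "is_partition l" "length l \<le> t"
  shows "filter (\<lambda>x. 0 < x) (map (pad l) [0..<t]) = l"
proof -
  have e: "[0..<t] = [0..<length l] @ [length l..<t]"
    using assms(2) by (metis le_add_diff_inverse upt_add_eq_append zero_le)
  have "map (pad l) [0..<length l] = l"
    by (rule nth_equalityI) (auto simp: pad_def)
  moreover have "filter (\<lambda>x. 0 < x) (map (pad l) [length l..<t]) = []"
    by (auto simp: filter_empty_conv pad_def)
  moreover have "filter (\<lambda>x. 0 < x) l = l"
    using assms(1) by (auto simp: is_partition_def filter_id_conv)
  ultimately show ?thesis by (simp add: e)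
qed

text \<open>Decreasing order recovers the index of each beta-number, subtracting the staircase
  recovers the parts, and the filter drops the padding.\<close>

lemma partition_of_beta_set:
  assumes "is_partition l" "length l \<le> t"
  shows "partition_of_beta (beta_set l t) = l"
proof -
  have "partition_of_beta (beta_set l t)
      = filter (\<lambda>x. 0 < x) (map (\<lambda>i. pad l i + t - 1 - i - (t - 1 - i)) [0..<t])"
    unfolding partition_of_beta_def Let_def rev_sorted_list_of_beta_set[OF assms(1)]
    by (intro arg_cong[where f = "filter _"]) (auto simp: map_eq_conv)
  also have "map (\<lambda>i. pad l i + t - 1 - i - (t - 1 - i)) [0..<t] = map (pad l) [0..<t]"
    by (auto simp: map_eq_conv)
  finally show ?thesis using filter_pad[OF assms] by simp
qed

text \<open>A strictly decreasing list of naturals dominates the staircase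
  \<open>s - 1, ..., 0\<close> entrywise, and the difference is weakly decreasing; its positive
  entries form the partition.\<close>

lemma beta_set_surj:
  assumes "finite K"
  obtains l where "is_partition l" "length l \<le> card K" "beta_set l (card K) = K"
proof -
  define ks where "ks = rev (sorted_list_of_set K)"
  define s where "s = card K"
  define g where "g i = ks ! i - (s - 1 - i)" for i
  have len: "length ks = s" by (simp add: ks_def s_def)
  have dec: "sorted_wrt (>) ks"
    unfolding ks_def sorted_wrt_rev using sorted_list_of_set.strict_sorted_key_list_of_set by simp
  have step: "ks ! i \<ge> ks ! k + (k - i)" if "i \<le> k" "k < s" for i k
    using that
  proof (induction k)
    case (Suc k)
    show ?case
    proof (cases "i = Suc k")
      case False
      then have "ks ! i \<ge> ks ! k + (k - i)" using Suc by simp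
      moreover have "ks ! k > ks ! Suc k" using dec Suc.prems len
        by (simp add: sorted_wrt_iff_nth_less)
      ultimately show ?thesis using False Suc.prems by linarith
    qed simp
  qed simp
  have big: "ks ! i \<ge> s - 1 - i" if "i < s" for i
    using step[of i "s - 1"] that by linarith
  have gmono: "g k \<le> g i" if "i \<le> k" "k < s" for i k
    using step[OF that] big[OF that(2)] that unfolding g_def by linarith
  define l where "l = filter (\<lambda>x. 0 < x) (map g [0..<s])"
  have srt: "sorted_wrt (\<ge>) (map g [0..<s])"
    by (auto simp: sorted_wrt_iff_nth_less gmono)
  have part: "is_partition l"
    unfolding is_partition_def l_def using srt sorted_wrt_filter by auto
  have ll: "length l \<le> s" unfolding l_def by (metis length_filter_le length_map length_upt minus_nat.diff_0)
  \<comment> \<open>In a weakly decreasing list the positive entries form a prefix, so filtering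
    keeps their positions.\<close>
  have ltw: "filter (\<lambda>x. 0 < x) xs = takeWhile (\<lambda>x. 0 < x) xs" if "sorted_wrt (\<ge>) xs" for xs :: "nat list"
    using that by (induction xs) (auto simp: filter_empty_conv)
  have padg: "pad l i = g i" if "i < s" for i
  proof (cases "i < length l")
    case True
    then show ?thesis using that unfolding l_def ltw[OF srt] pad_def
      by (simp add: takeWhile_nth)
  next
    case False
    have "map g [0..<s] ! i = 0"
    proof (rule ccontr)
      assume a: "map g [0..<s] ! i \<noteq> 0"
      have "Suc i \<le> length (takeWhile (\<lambda>x. 0 < x) (map g [0..<s]))"
      proof -
        have "\<And>k. k < Suc i \<Longrightarrow> k < length (map g [0..<s]) \<Longrightarrow> 0 < map g [0..<s] ! k"
        proof -
          fix k assume "k < Suc i" "k < length (map g [0..<s])"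
          then have "g k \<ge> g i" using gmono that by auto
          then show "0 < map g [0..<s] ! k" using a that \<open>k < length (map g [0..<s])\<close> by simp
        qed
        then show ?thesis
          using length_takeWhile_less_P_nth[of "Suc i" "\<lambda>x. 0 < x" "map g [0..<s]"] that by auto
      qed
      then show False using False unfolding l_def ltw[OF srt] by simp
    qed
    then show ?thesis using False that by (simp add: pad_def)
  qed
  have "beta_set l s = (\<lambda>i. ks ! i) ` {..<s}"
    unfolding beta_set_eq_image
  proof (rule image_cong)
    fix i assume "i \<in> {..<s}"
    then show "pad l i + s - 1 - i = ks ! i" using padg[of i] big[of i] by (simp add: g_def)
  qed simp
  also have "\<dots> = set ks" using len by (auto simp: set_conv_nth)
  also have "\<dots> = K" using assms by (simp add: ks_def)
  finally show ?thesis using that part ll s_def by metis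
qed

lemma partition_of_beta:
  assumes "finite K"
  shows is_partition_partition_of_beta: "is_partition (partition_of_beta K)"
    and length_partition_of_beta: "length (partition_of_beta K) \<le> card K"
    and beta_set_partition_of_beta: "beta_set (partition_of_beta K) (card K) = K"
proof -
  obtain l where l: "is_partition l" "length l \<le> card K" "beta_set l (card K) = K"
    using beta_set_surj[OF assms] .
  then have "partition_of_beta K = l" using partition_of_beta_set by metis
  with l show "is_partition (partition_of_beta K)" "length (partition_of_beta K) \<le> card K"
    "beta_set (partition_of_beta K) (card K) = K" by simp_all
qed

lemma partition_of_beta_shift:
  assumes "finite K" shows "partition_of_beta (insert 0 (Suc ` K)) = partition_of_beta K"
proof -
  let ?l = "partition_of_beta K"
  have "insert 0 (Suc ` K) = beta_set ?l (Suc (card K))"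
    using beta_set_Suc[OF length_partition_of_beta[OF assms]] beta_set_partition_of_beta[OF assms]
    by simp
  then show ?thesis
    using partition_of_beta_set[OF is_partition_partition_of_beta[OF assms], of "Suc (card K)"]
      length_partition_of_beta[OF assms] by simp
qed

section \<open>The 2-quotient with a free number of beta-numbers\<close>

definition quot :: "nat \<Rightarrow> nat list \<Rightarrow> nat list \<times> nat list" where
  "quot t l = (partition_of_beta {k. 2 * k \<in> beta_set l t},
               partition_of_beta {k. 2 * k + 1 \<in> beta_set l t})"

lemma finite_halves:
  assumes "finite B" shows "finite {k. 2 * k \<in> B}" "finite {k::nat. 2 * k + 1 \<in> B}"
proof -
  show "finite {k. 2 * k \<in> B}"
    using finite_vimageI[OF assms, of "\<lambda>k. 2 * k"] by (auto simp: vimage_def inj_on_def)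
  show "finite {k. 2 * k + 1 \<in> B}"
    using finite_vimageI[OF assms, of "\<lambda>k. 2 * k + 1"] by (auto simp: vimage_def inj_on_def)
qed

text \<open>Two more beta-numbers shift the beta-set by 2 and add \<open>0\<close> and
  \<open>1\<close>. Each half is thereby shifted by one and gains \<open>0\<close>, which leaves its
  partition unchanged. A single further beta-number would exchange the two components, hence the
  even \<open>t\<close> throughout.\<close>

lemma quot_add2:
  assumes "length l \<le> t" shows "quot (Suc (Suc t)) l = quot t l"
proof -
  let ?B = "beta_set l t"
  have B: "beta_set l (Suc (Suc t)) = insert 0 (insert 1 ((\<lambda>x. x + 2) ` ?B))"
    using assms by (auto simp: beta_set_Suc image_image)
  have "{k. 2 * k \<in> beta_set l (Suc (Suc t))} = insert 0 (Suc ` {k. 2 * k \<in> ?B})"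
    unfolding B
  proof (intro set_eqI)
    fix x show "x \<in> {k. 2 * k \<in> insert 0 (insert 1 ((\<lambda>x. x + 2) ` ?B))} \<longleftrightarrow>
        x \<in> insert 0 (Suc ` {k. 2 * k \<in> ?B})"
      by (cases x) (auto simp: image_iff)
  qed
  moreover have "{k. 2 * k + 1 \<in> beta_set l (Suc (Suc t))} = insert 0 (Suc ` {k. 2 * k + 1 \<in> ?B})"
    unfolding B
  proof (intro set_eqI)
    fix x show "x \<in> {k. 2 * k + 1 \<in> insert 0 (insert 1 ((\<lambda>x. x + 2) ` ?B))} \<longleftrightarrow>
        x \<in> insert 0 (Suc ` {k. 2 * k + 1 \<in> ?B})"
      by (cases x) (auto simp: image_iff)
  qed
  ultimately show ?thesis
    unfolding quot_def
    by (simp only: partition_of_beta_shift finite_halves[OF finite_beta_set])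
qed

lemma two_quotient_eq_quot:
  assumes "length l \<le> t" "even t" shows "two_quotient l = quot t l"
proof -
  define t0 where "t0 = 2 * ((length l + 1) div 2)"
  have t0: "length l \<le> t0" "t0 \<le> t" using assms unfolding t0_def by (auto elim!: evenE)
  have "quot (t0 + 2 * m) l = quot t0 l" for m
    by (induction m) (use t0 quot_add2 in auto)
  moreover have "t = t0 + 2 * ((t - t0) div 2)"
    using t0 assms(2) by (simp add: t0_def)
  ultimately have "quot t l = quot t0 l" by metis
  then show ?thesis by (simp add: two_quotient_def quot_def t0_def Let_def)
qed

text \<open>With \<open>t\<close> even, the beta-number of index \<open>i\<close> is congruent to
  \<open>pad l i + i + 1\<close> modulo 2. Counting the odd ones gives \<open>t div 2\<close> minus
  the alternating sum of the parities, so the sizes of the two halves record exactly the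
  BG-rank.\<close>

lemma quot_cards:
  assumes l: "is_partition l" "length l \<le> t" and t: "even t"
  shows "int (card {k. 2 * k \<in> beta_set l t}) = int (t div 2) + bg_rank l"
    and "int (card {k. 2 * k + 1 \<in> beta_set l t}) = int (t div 2) - bg_rank l"
    and "\<Sum>(beta_set l t) = 2 * \<Sum>{k. 2 * k \<in> beta_set l t}
         + 2 * \<Sum>{k. 2 * k + 1 \<in> beta_set l t} + card {k. 2 * k + 1 \<in> beta_set l t}"
proof -
  let ?B = "beta_set l t"
  let ?K0 = "{k. 2 * k \<in> ?B}" let ?K1 = "{k. 2 * k + 1 \<in> ?B}"
  note fin = finite_halves[OF finite_beta_set, of l t]
  have split: "?B = (\<lambda>k. 2 * k) ` ?K0 \<union> (\<lambda>k. 2 * k + 1) ` ?K1"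
  proof (intro set_eqI iffI)
    fix x assume x: "x \<in> ?B"
    show "x \<in> (\<lambda>k. 2 * k) ` ?K0 \<union> (\<lambda>k. 2 * k + 1) ` ?K1"
    proof (cases "even x")
      case True then show ?thesis using x by (elim evenE) blast
    next
      case False then show ?thesis using x by (elim oddE) blast
    qed
  qed blast
  have disj: "(\<lambda>k. 2 * k) ` ?K0 \<inter> (\<lambda>k. 2 * k + 1) ` ?K1 = {}"
    by (auto simp del: add_Suc_right Suc_eq_plus1[symmetric]) presburger
  have inj: "inj_on (\<lambda>k::nat. 2 * k) A" "inj_on (\<lambda>k::nat. 2 * k + 1) A" for A
    by (auto simp: inj_on_def)
  have sumB: "sum f ?B = (\<Sum>k\<in>?K0. f (2 * k)) + (\<Sum>k\<in>?K1. f (2 * k + 1))" for f :: "nat \<Rightarrow> nat"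
  proof -
    have "sum f ?B = sum f ((\<lambda>k. 2 * k) ` ?K0 \<union> (\<lambda>k. 2 * k + 1) ` ?K1)"
      using split by simp
    also have "\<dots> = sum f ((\<lambda>k. 2 * k) ` ?K0) + sum f ((\<lambda>k. 2 * k + 1) ` ?K1)"
      using fin disj by (intro sum.union_disjoint) auto
    finally show ?thesis by (simp only: sum.reindex[OF inj(1)] sum.reindex[OF inj(2)] o_def)
  qed
  show sums: "\<Sum>?B = 2 * \<Sum>?K0 + 2 * \<Sum>?K1 + card ?K1"
    using sumB[of "\<lambda>x. x"] by (simp only: sum.distrib sum_distrib_left[symmetric]) simp
  have c: "card ?K0 + card ?K1 = t"
    using sumB[of "\<lambda>x. 1"] card_beta_set[OF l(1), of t] by simp
  have "card ?K1 = (\<Sum>x\<in>?B. x mod 2)"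
    using sumB[of "\<lambda>x. x mod 2"] by simp
  also have "\<dots> = (\<Sum>i<t. (pad l i + t - 1 - i) mod 2)"
    unfolding beta_set_eq_image by (subst sum.reindex[OF inj_on_beta[OF l(1)]]) simp
  finally have "int (card ?K1) = (\<Sum>i<t. int ((pad l i + t - 1 - i) mod 2))" by simp
  \<comment> \<open>An even part leaves the parity of \<open>i + 1\<close>; an odd part flips it,
    from 1 to 0 for even \<open>i\<close> and from 0 to 1 for odd \<open>i\<close>.\<close>
  also have "\<dots> = (\<Sum>i<t. int ((i + 1) mod 2) - (-1) ^ i * int (pad l i mod 2))"
  proof (rule sum.cong)
    fix i assume "i \<in> {..<t}"
    then have i: "i < t" by simp
    obtain m where m: "t = 2 * m" using t by (elim evenE)
    have "int (pad l i + t - 1 - i) = int (pad l i) + 2 * int m - 1 - int i"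
      using i m by simp
    then have "int ((pad l i + t - 1 - i) mod 2) = (int (pad l i) + 2 * int m - 1 - int i) mod 2"
      by (simp only: of_nat_mod) simp
    also have "\<dots> = int ((i + 1) mod 2) - (-1) ^ i * int (pad l i mod 2)"
    proof (cases "even i")
      case True
      then obtain r where r: "i = 2 * r" by (elim evenE)
      show ?thesis using True unfolding r by (simp add: of_nat_mod) presburger
    next
      case False
      then obtain r where r: "i = 2 * r + 1" by (elim oddE)
      show ?thesis using False unfolding r by (simp add: of_nat_mod) presburger
    qed
    finally show "int ((pad l i + t - 1 - i) mod 2) = int ((i + 1) mod 2) - (-1) ^ i * int (pad l i mod 2)" .
  qed simp
  also have "\<dots> = (\<Sum>i<t. int ((i + 1) mod 2)) - (\<Sum>i<t. (-1) ^ i * int (pad l i mod 2))"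
    by (simp add: sum_subtractf)
  also have "(\<Sum>i<t. int ((i + 1) mod 2)) = int (t div 2)"
  proof -
    have "(\<Sum>i<2 * m. int ((i + 1) mod 2)) = int m" for m
      by (induction m) (simp_all add: mod_Suc)
    then show ?thesis using t by (elim evenE) simp
  qed
  also have "(\<Sum>i<t. (-1) ^ i * int (pad l i mod 2)) = (\<Sum>i<length l. (-1) ^ i * int (pad l i mod 2))"
    using l(2) by (intro sum.mono_neutral_right) (auto simp: pad_def)
  also have "\<dots> = bg_rank l" unfolding bg_rank_def by (rule sum.cong) (auto simp: pad_def)
  finally show c1: "int (card ?K1) = int (t div 2) - bg_rank l" .
  have "int (card ?K0) + int (card ?K1) = 2 * int (t div 2)"
    using c t by (metis dvd_mult_div_cancel of_nat_add of_nat_mult of_nat_numeral)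
  then show "int (card ?K0) = int (t div 2) + bg_rank l" using c1 by linarith
qed

lemma quot_partitions:
  "is_partition (fst (quot t l))" "is_partition (snd (quot t l))"
  unfolding quot_def
  by (simp_all only: fst_conv snd_conv is_partition_partition_of_beta finite_halves[OF finite_beta_set])

lemma sum_partition_of_beta:
  assumes "finite K"
  shows "2 * \<Sum>K + card K = 2 * sum_list (partition_of_beta K) + card K * card K"
  using sum_beta_set[OF is_partition_partition_of_beta[OF assms] length_partition_of_beta[OF assms]]
  by (simp add: beta_set_partition_of_beta[OF assms])

text \<open>The halves have \<open>t div 2 + j\<close> and \<open>t div 2 - j\<close> elements,
  where \<open>j = bg_rank l\<close>, and obey the size formula for beta-sets. On adding up, all
  terms in \<open>t\<close> cancel and \<open>(2 * j - 1) * j\<close> remains, the size of the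
  2-core.\<close>

lemma sum_list_quot:
  assumes l: "is_partition l" "length l \<le> t" and t: "even t"
  shows "int (sum_list l) = 2 * (int (sum_list (fst (quot t l))) + int (sum_list (snd (quot t l))))
           + (2 * bg_rank l - 1) * bg_rank l"
proof -
  define K0 where "K0 = {k. 2 * k \<in> beta_set l t}"
  define K1 where "K1 = {k. 2 * k + 1 \<in> beta_set l t}"
  define h where "h = int (t div 2)"
  have th: "int t = 2 * h" using t by (auto simp: h_def elim!: evenE)
  note c = quot_cards[OF assms, folded K0_def K1_def h_def]
  have fin: "finite K0" "finite K1" unfolding K0_def K1_def
    by (rule finite_halves[OF finite_beta_set])+
  have q: "quot t l = (partition_of_beta K0, partition_of_beta K1)"
    by (simp only: quot_def K0_def K1_def)
  have e0: "2 * int (\<Sum>K0) + int (card K0)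
      = 2 * int (sum_list (partition_of_beta K0)) + int (card K0) * int (card K0)"
    using arg_cong[OF sum_partition_of_beta[OF fin(1)], of int]
    by (simp only: of_nat_add of_nat_mult of_nat_numeral)
  have e1: "2 * int (\<Sum>K1) + int (card K1)
      = 2 * int (sum_list (partition_of_beta K1)) + int (card K1) * int (card K1)"
    using arg_cong[OF sum_partition_of_beta[OF fin(2)], of int]
    by (simp only: of_nat_add of_nat_mult of_nat_numeral)
  have eB: "2 * int (\<Sum>(beta_set l t)) + int t = 2 * int (sum_list l) + int t * int t"
    using arg_cong[OF sum_beta_set[OF l], of int]
    by (simp only: of_nat_add of_nat_mult of_nat_numeral)
  have eS: "int (\<Sum>(beta_set l t)) = 2 * int (\<Sum>K0) + 2 * int (\<Sum>K1) + int (card K1)"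
    using arg_cong[OF c(3), of int] by (simp only: of_nat_add of_nat_mult of_nat_numeral)
  define x y z where "x = int (\<Sum>K0)" and "y = int (\<Sum>K1)" and "z = int (\<Sum>(beta_set l t))"
  show ?thesis
    using e0 e1 eB eS unfolding q fst_conv snd_conv c(1,2) th x_def[symmetric] y_def[symmetric] z_def[symmetric]
    by (simp add: algebra_simps)
qed

section \<open>The bijection with pairs of partitions\<close>

definition bipartitions :: "nat \<Rightarrow> (nat list \<times> nat list) set" where
  "bipartitions n = {(l, m). is_partition l \<and> is_partition m \<and> sum_list l + sum_list m = n}"

text \<open>The size of the triangular partition that is the 2-core of every partition of BG-rank
  \<open>j\<close>.\<close>

definition core_size :: "int \<Rightarrow> nat" where
  "core_size j = nat ((2 * j - 1) * j)"

lemma core_size: "int (core_size j) = (2 * j - 1) * j"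
proof -
  have "(2 * j - 1) * j \<ge> 0"
    by (cases "j \<ge> 1") (auto intro: mult_nonneg_nonneg mult_nonpos_nonpos)
  then show ?thesis by (simp add: core_size_def)
qed

text \<open>\<open>two_quotient l\<close> uses a number of beta-numbers that depends on \<open>l\<close>; here one even number \<open>t\<close>,
  large enough for every partition that occurs, serves for all \<open>l\<close>.\<close>

lemma bij_betw_quot:
  fixes j :: int and n :: nat
  defines "t \<equiv> 2 * n + 2 * nat \<bar>j\<bar>"
  shows "bij_betw (quot t) {l \<in> partitions n. bg_rank l = j}
           {p. \<exists>k. p \<in> bipartitions k \<and> 2 * k + core_size j = n}"
proof -
  have t: "even t" by (simp add: t_def)
  have arith: "int m = 2 * (int x + int y) + int c \<longleftrightarrow> 2 * (x + y) + c = m" for m x y c :: nat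
    by presburger
  have len: "length l \<le> t" if "l \<in> partitions n" for l
    using that length_le_sum_partition[of l] by (auto simp: partitions_def t_def)
  \<comment> \<open>The BG-rank forces these sizes of the even and the odd half. The summand
    \<open>2 * nat \<bar>j\<bar>\<close> in \<open>t\<close> makes both at least \<open>n\<close>,
    which leaves room for every pair that can occur.\<close>
  define s0 where "s0 = nat (int (t div 2) + j)"
  define s1 where "s1 = nat (int (t div 2) - j)"
  have s: "int s0 = int (t div 2) + j" "int s1 = int (t div 2) - j" "s0 \<ge> n" "s1 \<ge> n"
    by (auto simp: s0_def s1_def t_def)
  show ?thesis
  proof (rule bij_betw_imageI)
    show "inj_on (quot t) {l \<in> partitions n. bg_rank l = j}"
    proof (rule inj_onI)
      fix l l' assume l: "l \<in> {l \<in> partitions n. bg_rank l = j}"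
        and l': "l' \<in> {l \<in> partitions n. bg_rank l = j}" and eq: "quot t l = quot t l'"
      \<comment> \<open>As the sizes are known, each half is recovered from its quotient partition;
        the halves together determine the beta-set.\<close>
      have *: "{k. 2 * k \<in> beta_set x t} = beta_set (fst (quot t x)) s0 \<and>
            {k. 2 * k + 1 \<in> beta_set x t} = beta_set (snd (quot t x)) s1"
        if "x \<in> {l \<in> partitions n. bg_rank l = j}" for x
      proof -
        have "is_partition x" "length x \<le> t" "bg_rank x = j"
          using that len by (auto simp: partitions_def)
        note c = quot_cards[OF this(1,2) t, unfolded this(3)]
        have "card {k. 2 * k \<in> beta_set x t} = s0" "card {k. 2 * k + 1 \<in> beta_set x t} = s1"
          using c(1,2) s(1,2) by linarith+
        then show ?thesis
          using beta_set_partition_of_beta[OF finite_halves(1)[OF finite_beta_set], of x t]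
            beta_set_partition_of_beta[OF finite_halves(2)[OF finite_beta_set], of x t]
          unfolding quot_def by simp
      qed
      have "beta_set l t = beta_set l' t"
      proof (intro set_eqI)
        fix x show "x \<in> beta_set l t \<longleftrightarrow> x \<in> beta_set l' t"
        proof (cases "even x")
          case True
          then obtain k where k: "x = 2 * k" by (elim evenE)
          have "{k. 2 * k \<in> beta_set l t} = {k. 2 * k \<in> beta_set l' t}"
            by (simp only: *[OF l] *[OF l'] eq)
          from eqset_imp_iff[OF this, of k] show ?thesis by (simp only: mem_Collect_eq k)
        next
          case False
          then obtain k where k: "x = 2 * k + 1" by (elim oddE)
          have "{k. 2 * k + 1 \<in> beta_set l t} = {k. 2 * k + 1 \<in> beta_set l' t}"
            by (simp only: *[OF l] *[OF l'] eq)
          from eqset_imp_iff[OF this, of k] show ?thesis by (simp only: mem_Collect_eq k)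
        qed
      qed
      moreover have "partition_of_beta (beta_set x t) = x" if "x \<in> {l \<in> partitions n. bg_rank l = j}" for x
        using that len by (intro partition_of_beta_set) (simp_all add: partitions_def)
      ultimately show "l = l'" using l l' by metis
    qed
    show "quot t ` {l \<in> partitions n. bg_rank l = j}
        = {p. \<exists>k. p \<in> bipartitions k \<and> 2 * k + core_size j = n}"
    proof (intro set_eqI iffI)
      fix p assume "p \<in> quot t ` {l \<in> partitions n. bg_rank l = j}"
      then obtain l where l: "l \<in> partitions n" "bg_rank l = j" and p: "p = quot t l" by blast
      have "is_partition l" "sum_list l = n" using l by (auto simp: partitions_def)
      from sum_list_quot[OF this(1) len[OF l(1)] t, unfolded this(2) l(2)] have "2 * (sum_list (fst p) + sum_list (snd p)) + core_size j = n"
        unfolding p core_size[symmetric] arith by simp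
      moreover have "p \<in> bipartitions (sum_list (fst p) + sum_list (snd p))"
        using quot_partitions[of t l] by (auto simp: bipartitions_def p case_prod_beta)
      ultimately show "p \<in> {p. \<exists>k. p \<in> bipartitions k \<and> 2 * k + core_size j = n}" by blast
    next
      fix p assume "p \<in> {p. \<exists>k. p \<in> bipartitions k \<and> 2 * k + core_size j = n}"
      then obtain u v where p: "p = (u, v)" and uv: "is_partition u" "is_partition v"
        and n: "2 * (sum_list u + sum_list v) + core_size j = n"
        by (auto simp: bipartitions_def)
      have lu: "length u \<le> s0" and lv: "length v \<le> s1"
        using length_le_sum_partition[OF uv(1)] length_le_sum_partition[OF uv(2)] n s(3,4) by simp_all
      \<comment> \<open>The inverse map: beta-sets of \<open>u\<close> and \<open>v\<close> of the
        forced sizes become the even and the odd beta-numbers.\<close>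
      define B where "B = (\<lambda>k. 2 * k) ` beta_set u s0 \<union> (\<lambda>k. 2 * k + 1) ` beta_set v s1"
      have B0: "{k. 2 * k \<in> B} = beta_set u s0" and B1: "{k. 2 * k + 1 \<in> B} = beta_set v s1"
        unfolding B_def by (auto simp: image_iff) presburger+
      have finB: "finite B" by (simp add: B_def finite_beta_set)
      have "card B = card ((\<lambda>k. 2 * k) ` beta_set u s0) + card ((\<lambda>k. 2 * k + 1) ` beta_set v s1)"
        unfolding B_def
      proof (rule card_Un_disjoint)
        show "(\<lambda>k. 2 * k) ` beta_set u s0 \<inter> (\<lambda>k. 2 * k + 1) ` beta_set v s1 = {}"
          by (auto simp: image_iff) presburger
      qed (auto simp: finite_beta_set)
      also have "\<dots> = s0 + s1"
        by (simp add: card_image inj_on_def card_beta_set uv)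
      also have "\<dots> = t"
      proof -
        have "int s0 + int s1 = 2 * int (t div 2)" using s by simp
        then show ?thesis using t by presburger
      qed
      finally have cB: "card B = t" .
      define l where "l = partition_of_beta B"
      have l: "is_partition l" "length l \<le> t" "beta_set l t = B"
        using partition_of_beta[OF finB] by (auto simp: l_def cB)
      have q: "quot t l = p"
        unfolding quot_def l(3) B0 B1 p
        using partition_of_beta_set[OF uv(1) lu] partition_of_beta_set[OF uv(2) lv] by simp
      have "bg_rank l = j"
        using quot_cards(1)[OF l(1,2) t] s(1) unfolding l(3) B0 card_beta_set[OF uv(1)] by linarith
      moreover have "sum_list l = n"
        using n sum_list_quot[OF l(1,2) t]
        unfolding q p fst_conv snd_conv \<open>bg_rank l = j\<close> core_size[symmetric] arith by simp
      ultimately show "p \<in> quot t ` {l \<in> partitions n. bg_rank l = j}"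
        using q l(1) by (auto simp: partitions_def)
    qed
  qed
qed

definition bip :: "int \<Rightarrow> int \<Rightarrow> nat \<Rightarrow> nat" where
  "bip a b n = card {p \<in> bipartitions n. (int (length (fst p)) - int (length (snd p))) mod b = a}"

text \<open>For even \<open>j\<close> the core has even size, so it only shifts \<open>n\<close>, by
  half of that size; under the bijection the quotient rank becomes the difference of the numbers of
  parts.\<close>

lemma pbar_mod_eq_bip:
  assumes "even j"
  shows "pbar_mod j a b (2 * (n + core_size j div 2)) = bip a b n"
proof -
  define N where "N = 2 * (n + core_size j div 2)"
  define t where "t = 2 * N + 2 * nat \<bar>j\<bar>"
  have "even (int (core_size j))" using assms by (simp add: core_size)
  then have ev: "even (core_size j)" by simp
  have im: "{p. \<exists>k. p \<in> bipartitions k \<and> 2 * k + core_size j = N} = bipartitions n"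
    using ev by (auto simp: N_def elim!: evenE)
  have bij: "bij_betw (quot t) {l \<in> partitions N. bg_rank l = j} (bipartitions n)"
    using bij_betw_quot[where j = j and n = N] unfolding im t_def[symmetric] .
  have tq: "two_quotient l = quot t l" if "l \<in> partitions N" for l
    using that length_le_sum_partition[of l]
    by (intro two_quotient_eq_quot) (auto simp: partitions_def t_def)
  have inj: "inj_on (quot t) {l \<in> partitions N. bg_rank l = j \<and> quot_rank l mod b = a}"
    by (rule inj_on_subset[OF bij_betw_imp_inj_on[OF bij]]) auto
  have "quot t ` {l \<in> partitions N. bg_rank l = j \<and> quot_rank l mod b = a} =
      {p \<in> bipartitions n. (int (length (fst p)) - int (length (snd p))) mod b = a}"
    unfolding bij_betw_imp_surj_on[OF bij, symmetric]
    by (auto simp: quot_rank_def tq image_iff)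
  then show ?thesis
    using card_image[OF inj] unfolding pbar_mod_def bip_def N_def by simp
qed

text \<open>Every integer is \<open>0\<close> modulo \<open>1\<close>. Therefore the later results
  are stated for all moduli \<open>b > 0\<close>, and both forms of \<open>\<alpha>\<close> are
  instances.\<close>

lemma pbar_eq_pbar_mod: "pbar j n = pbar_mod j 0 1 n"
  by (simp add: pbar_def pbar_mod_def)

section \<open>Generating functions and Fourier coefficients\<close>

lemma fps_conv_radius_ge_1:
  fixes f :: "complex fps"
  assumes "\<And>n. norm (fps_nth f n) \<le> 1"
  shows "fps_conv_radius f \<ge> 1"
  unfolding fps_conv_radius_def
proof (rule conv_radius_geI_ex')
  fix r :: real assume r: "0 < r" "ereal r < 1"
  have "norm (fps_nth f n * of_real r ^ n) \<le> r ^ n" for n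
    using mult_right_mono[OF assms[of n], of "r ^ n"] r by (simp add: norm_mult norm_power)
  then show "summable (\<lambda>n. fps_nth f n * of_real r ^ n)"
    by (intro summable_comparison_test'[OF summable_geometric[of r]]) (use r in auto)
qed

lemma norm_less_conv_radius:
  fixes f :: "complex fps"
  assumes "fps_conv_radius f \<ge> 1" "norm (q :: complex) < 1"
  shows "ereal (norm q) < fps_conv_radius f"
proof -
  have "ereal (norm q) < 1" using assms(2) by simp
  then show ?thesis using assms(1) by (rule less_le_trans)
qed

text \<open>Cauchy's coefficient formula. The series converges uniformly on the circle of radius
  \<open>r < 1\<close>, so it may be integrated term by term, and orthogonality of the characters
  leaves only the term of index \<open>n\<close>.\<close>

lemma has_integral_fps_coeff:
  fixes f :: "complex fps"
  assumes "fps_conv_radius f \<ge> 1" "0 < r" "r < 1"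
  shows "((\<lambda>\<theta>. eval_fps f (of_real r * cis \<theta>) * cis (- (real n * \<theta>)))
           has_integral (2 * pi * fps_nth f n * of_real r ^ n)) {-pi..pi}"
proof -
  define g where "g k \<theta> = fps_nth f k * of_real r ^ k * cis ((real k - real n) * \<theta>)" for k \<theta>
  have norm_r: "ereal (norm (of_real r * cis \<theta>)) < fps_conv_radius f" for \<theta>
    using assms by (intro norm_less_conv_radius) (simp_all add: norm_mult)
  have eqg: "fps_nth f k * (of_real r * cis \<theta>) ^ k * cis (- (real n * \<theta>)) = g k \<theta>" for k \<theta>
    by (simp add: g_def power_mult_distrib Complex.DeMoivre cis_mult algebra_simps)
  have "(\<lambda>k. fps_nth f k * (of_real r * cis \<theta>) ^ k) sums eval_fps f (of_real r * cis \<theta>)" for \<theta>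
    using sums_eval_fps[OF norm_r] .
  then have "(\<lambda>k. fps_nth f k * (of_real r * cis \<theta>) ^ k * cis (- (real n * \<theta>))) sums
      (eval_fps f (of_real r * cis \<theta>) * cis (- (real n * \<theta>)))" for \<theta>
    by (rule sums_mult2)
  then have "(\<lambda>k. g k \<theta>) sums (eval_fps f (of_real r * cis \<theta>) * cis (- (real n * \<theta>)))" for \<theta>
    unfolding eqg .
  then have sg: "suminf (\<lambda>k. g k \<theta>) = eval_fps f (of_real r * cis \<theta>) * cis (- (real n * \<theta>))" for \<theta>
    by (simp add: sums_iff)
  have "summable (\<lambda>k. norm (fps_nth f k * of_real r ^ k))"
    using norm_summable_fps[OF norm_r[of 0]] by simp
  then have ul: "uniform_limit {-pi..pi} (\<lambda>m \<theta>. \<Sum>k<m. g k \<theta>)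
      (\<lambda>\<theta>. eval_fps f (of_real r * cis \<theta>) * cis (- (real n * \<theta>))) sequentially"
    unfolding sg[symmetric] by (intro Weierstrass_m_test) (auto simp: g_def norm_mult)
  have "continuous_on {-pi..pi} (\<lambda>\<theta>. \<Sum>k<m. g k \<theta>)" for m
    unfolding g_def by (intro continuous_intros)
  from uniform_limit_integral[OF ul this] obtain I J where
    I: "\<And>m. ((\<lambda>\<theta>. \<Sum>k<m. g k \<theta>) has_integral I m) {-pi..pi}" and
    J: "((\<lambda>\<theta>. eval_fps f (of_real r * cis \<theta>) * cis (- (real n * \<theta>))) has_integral J) {-pi..pi}"
      "I \<longlonglongrightarrow> J" by auto
  have cisint: "((\<lambda>\<theta>. cis (real_of_int m * \<theta>)) has_integral (if m = 0 then 2 * pi else 0)) {-pi..pi}" for m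
  proof (cases "m = 0")
    case True
    then show ?thesis using has_integral_const_real[of "1::complex" "-pi" pi] by (simp add: scaleR_conv_of_real)
  next
    case False
    define F where "F \<theta> = cis (real_of_int m * \<theta>) / (\<i> * of_int m)" for \<theta>
    have "((\<lambda>\<theta>. cis (real_of_int m * \<theta>)) has_integral (F pi - F (-pi))) {-pi..pi}"
    proof (rule fundamental_theorem_of_calculus)
      fix x show "(F has_vector_derivative cis (real_of_int m * x)) (at x within {-pi..pi})"
      proof -
        have "((\<lambda>z::complex. exp (\<i> * of_int m * z) / (\<i> * of_int m)) has_field_derivative
             exp (\<i> * of_int m * of_real x)) (at (of_real x))"
          using False by (auto intro!: derivative_eq_intros simp: field_simps)
        moreover have "F = (\<lambda>x. exp (\<i> * of_int m * of_real x) / (\<i> * of_int m))"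
          by (simp add: fun_eq_iff F_def cis_conv_exp mult_ac)
        moreover have "cis (real_of_int m * x) = exp (\<i> * of_int m * of_real x)"
          by (simp add: cis_conv_exp mult_ac)
        ultimately show ?thesis using has_vector_derivative_real_field by simp
      qed
    qed simp
    moreover have "cis (real_of_int m * pi) = cis (- (real_of_int m * pi))"
    proof -
      have "cis (real_of_int m * pi) = cis (- (real_of_int m * pi)) * cis (2 * pi * real_of_int m)"
        unfolding cis_mult by (rule arg_cong[where f = cis]) simp
      also have "cis (2 * pi * real_of_int m) = 1" by (rule cis_multiple_2pi[OF Ints_of_int])
      finally show ?thesis by simp
    qed
    ultimately show ?thesis using False by (simp add: F_def)
  qed
  have "((\<lambda>\<theta>. \<Sum>k<m. g k \<theta>) has_integral
      (\<Sum>k<m. fps_nth f k * of_real r ^ k * (if int k - int n = 0 then 2 * pi else 0))) {-pi..pi}" for m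
    unfolding g_def
  proof (intro has_integral_sum)
    fix k show "((\<lambda>\<theta>. fps_nth f k * of_real r ^ k * cis ((real k - real n) * \<theta>)) has_integral
         fps_nth f k * of_real r ^ k * (if int k - int n = 0 then 2 * pi else 0)) {-pi..pi}"
      using has_integral_mult_right[OF cisint[of "int k - int n"], of "fps_nth f k * of_real r ^ k"]
      by (cases "k = n") simp_all
  qed simp
  with I have Ieq: "I m = (\<Sum>k<m. fps_nth f k * of_real r ^ k * (if int k - int n = 0 then 2 * pi else 0))" for m
    using has_integral_unique by blast
  have "I m = 2 * pi * fps_nth f n * of_real r ^ n" if "m > n" for m
  proof -
    have "I m = (\<Sum>k<m. if k = n then fps_nth f n * of_real r ^ n * (2 * pi) else 0)"
      unfolding Ieq by (rule sum.cong) auto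
    then show ?thesis using that by (simp add: mult_ac)
  qed
  then have "eventually (\<lambda>m. I m = 2 * pi * fps_nth f n * of_real r ^ n) sequentially"
    by (rule eventually_mono[OF eventually_gt_at_top[of n]])
  then have "I \<longlonglongrightarrow> 2 * pi * fps_nth f n * of_real r ^ n"
    by (rule tendsto_eventually)
  with J(2) have "J = 2 * pi * fps_nth f n * of_real r ^ n" by (rule LIMSEQ_unique)
  with J(1) show ?thesis by simp
qed

section \<open>Generating functions of partitions with bounded parts\<close>

definition bounded_partitions :: "nat \<Rightarrow> nat \<Rightarrow> nat list set" where
  "bounded_partitions M n = {l \<in> partitions n. \<forall>x\<in>set l. x \<le> M}"

lemma finite_bounded_partitions: "finite (bounded_partitions M n)"
  using finite_subset[OF _ finite_partitions[of n]] by (auto simp: bounded_partitions_def)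

lemma bounded_partitions_eq: "n \<le> M \<Longrightarrow> bounded_partitions M n = partitions n"
  using member_le_sum_list by (fastforce simp: bounded_partitions_def partitions_def)

lemma bounded_partitions_0: "bounded_partitions 0 n = (if n = 0 then {[]} else {})"
proof -
  have "l = []" if "l \<in> bounded_partitions 0 n" for l
    using that by (cases l) (auto simp: bounded_partitions_def partitions_def is_partition_def)
  moreover have "[] \<in> bounded_partitions 0 n \<longleftrightarrow> n = 0"
    by (auto simp: bounded_partitions_def partitions_def is_partition_def)
  ultimately show ?thesis by (cases "n = 0") auto
qed

lemma bounded_partitions_Suc:
  "bounded_partitions (Suc M) n = bounded_partitions M n \<union>
     (if Suc M \<le> n then (#) (Suc M) ` bounded_partitions (Suc M) (n - Suc M) else {})"
proof (intro set_eqI iffI)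
  fix l assume l: "l \<in> bounded_partitions (Suc M) n"
  show "l \<in> bounded_partitions M n \<union>
     (if Suc M \<le> n then (#) (Suc M) ` bounded_partitions (Suc M) (n - Suc M) else {})"
  proof (cases "Suc M \<in> set l")
    case False
    then have "\<forall>x\<in>set l. x \<le> M" using l by (metis (no_types, lifting) bounded_partitions_def le_Suc_eq mem_Collect_eq)
    then show ?thesis using l by (auto simp: bounded_partitions_def)
  next
    case True
    then obtain x l' where xl: "l = x # l'" by (cases l) auto
    have "x = Suc M" using True l unfolding xl
      by (auto simp: bounded_partitions_def partitions_def is_partition_def intro: antisym)
    then have "Suc M \<le> n" "l' \<in> bounded_partitions (Suc M) (n - Suc M)" using l unfolding xl
      by (auto simp: bounded_partitions_def partitions_def is_partition_def)
    then show ?thesis using xl \<open>x = Suc M\<close> by simp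
  qed
next
  fix l assume "l \<in> bounded_partitions M n \<union>
     (if Suc M \<le> n then (#) (Suc M) ` bounded_partitions (Suc M) (n - Suc M) else {})"
  then show "l \<in> bounded_partitions (Suc M) n"
    by (auto simp: bounded_partitions_def partitions_def is_partition_def le_Suc_eq split: if_splits)
qed

definition pgf :: "complex \<Rightarrow> nat \<Rightarrow> complex fps" where
  "pgf z M = Abs_fps (\<lambda>n. \<Sum>l\<in>bounded_partitions M n. z ^ length l)"

text \<open>The expansion of 1 / (1 - z q^k). With the coefficients given directly, the radius of
  convergence is immediate: they have modulus at most 1 for \<open>z\<close> on the unit
  circle.\<close>

definition geo :: "complex \<Rightarrow> nat \<Rightarrow> complex fps" where
  "geo z k = Abs_fps (\<lambda>n. if k dvd n then z ^ (n div k) else 0)"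

lemma geo_inverse:
  assumes "k > 0" shows "(1 - fps_const z * fps_X ^ k) * geo z k = 1"
proof (rule fps_ext)
  fix n
  have "fps_nth ((1 - fps_const z * fps_X ^ k) * geo z k) n =
      fps_nth (geo z k) n - z * (if n < k then 0 else fps_nth (geo z k) (n - k))"
    by (simp add: ring_distribs mult.assoc fps_X_power_mult_nth)
  also have "\<dots> = fps_nth 1 n"
  proof (cases "n < k")
    case True
    then show ?thesis using assms by (auto simp: geo_def dvd_imp_le)
  next
    case False
    then obtain m where m: "n = m + k" by (metis add.commute le_add_diff_inverse not_le)
    then show ?thesis using assms by (simp add: geo_def)
  qed
  finally show "fps_nth ((1 - fps_const z * fps_X ^ k) * geo z k) n = fps_nth 1 n" .
qed

lemma fps_conv_radius_geo: "norm z = 1 \<Longrightarrow> fps_conv_radius (geo z k) \<ge> 1"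
  by (rule fps_conv_radius_ge_1) (simp add: geo_def norm_power)

lemma eval_geo:
  assumes "k > 0" "norm z = 1" "norm q < 1"
  shows "eval_fps (geo z k) q = 1 / (1 - z * q ^ k)"
proof -
  have nr: "ereal (norm q) < fps_conv_radius (geo z k)"
    using fps_conv_radius_geo[OF assms(2), of k] assms(3) by (rule norm_less_conv_radius)
  have inf: "fps_conv_radius (1 - fps_const z * fps_X ^ k) = \<infinity>"
  proof -
    have "fps_conv_radius (fps_const z * fps_X ^ k) = \<infinity>"
      using fps_conv_radius_mult[of "fps_const z" "fps_X ^ k"] by simp
    then show ?thesis using fps_conv_radius_diff[of 1 "fps_const z * fps_X ^ k"] by simp
  qed
  have "eval_fps (1 - fps_const z * fps_X ^ k) q = 1 - z * q ^ k"
    using fps_conv_radius_mult[of "fps_const z" "fps_X ^ k"]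
    by (subst eval_fps_diff) (simp_all add: eval_fps_mult)
  moreover have "eval_fps ((1 - fps_const z * fps_X ^ k) * geo z k) q =
      eval_fps (1 - fps_const z * fps_X ^ k) q * eval_fps (geo z k) q"
    using nr inf by (intro eval_fps_mult) auto
  ultimately have "(1 - z * q ^ k) * eval_fps (geo z k) q = 1"
    by (simp add: geo_inverse assms(1))
  then show ?thesis by (metis mult_zero_left nonzero_eq_divide_eq mult.commute zero_neq_one)
qed

lemma pgf_0: "pgf z 0 = 1"
  by (rule fps_ext) (simp add: pgf_def bounded_partitions_0)

text \<open>Whether or not a part \<open>Suc M\<close> occurs, and its removal if it does, is the
  functional equation (1 - z q^(M+1)) F = G for the series \<open>F\<close> with bound
  \<open>Suc M\<close> and \<open>G\<close> with bound \<open>M\<close>; the inverse series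
  \<open>geo\<close> solves it.\<close>

lemma pgf_Suc: "pgf z (Suc M) = geo z (Suc M) * pgf z M"
proof -
  have rec: "fps_nth (pgf z (Suc M)) n = fps_nth (pgf z M) n +
      z * (if n < Suc M then 0 else fps_nth (pgf z (Suc M)) (n - Suc M))" for n
  proof (cases "n < Suc M")
    case True
    then have "bounded_partitions (Suc M) n = bounded_partitions M n"
      by (subst bounded_partitions_Suc) simp
    then show ?thesis using True by (simp add: pgf_def)
  next
    case False
    have "bounded_partitions M n \<inter> (#) (Suc M) ` bounded_partitions (Suc M) (n - Suc M) = {}"
      by (auto simp: bounded_partitions_def)
    then have "(\<Sum>l\<in>bounded_partitions (Suc M) n. z ^ length l) =
       (\<Sum>l\<in>bounded_partitions M n. z ^ length l) +
       (\<Sum>l\<in>(#) (Suc M) ` bounded_partitions (Suc M) (n - Suc M). z ^ length l)"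
      using False by (subst bounded_partitions_Suc) (simp add: sum.union_disjoint finite_bounded_partitions)
    then show ?thesis using False by (simp add: pgf_def sum.reindex sum_distrib_left)
  qed
  have "(1 - fps_const z * fps_X ^ Suc M) * pgf z (Suc M) = pgf z M"
  proof (rule fps_ext)
    fix n show "fps_nth ((1 - fps_const z * fps_X ^ Suc M) * pgf z (Suc M)) n = fps_nth (pgf z M) n"
      using rec[of n] by (simp add: ring_distribs mult.assoc fps_X_power_mult_nth del: power_Suc)
  qed
  then have "geo z (Suc M) * pgf z M = ((1 - fps_const z * fps_X ^ Suc M) * geo z (Suc M)) * pgf z (Suc M)"
    by (simp only: mult_ac)
  then show ?thesis by (simp only: geo_inverse[OF zero_less_Suc] mult_1_left)
qed

lemma pgf_prod:
  assumes "norm z = 1"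
  shows "fps_conv_radius (pgf z M) \<ge> 1"
    and "norm q < 1 \<Longrightarrow> eval_fps (pgf z M) q = (\<Prod>k=1..M. 1 / (1 - z * q ^ k))"
proof -
  show r: "fps_conv_radius (pgf z M) \<ge> 1" for M
  proof (induction M)
    case (Suc M)
    then show ?case
      using fps_conv_radius_mult[of "geo z (Suc M)" "pgf z M"] fps_conv_radius_geo[OF assms, of "Suc M"]
      by (auto simp: pgf_Suc intro: order_trans[rotated])
  qed (simp add: pgf_0)
  show "eval_fps (pgf z M) q = (\<Prod>k=1..M. 1 / (1 - z * q ^ k))" if q: "norm q < 1"
  proof (induction M)
    case (Suc M)
    have "eval_fps (pgf z (Suc M)) q = eval_fps (geo z (Suc M)) q * eval_fps (pgf z M) q"
      unfolding pgf_Suc using r[of M] fps_conv_radius_geo[OF assms, of "Suc M"]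
      by (intro eval_fps_mult norm_less_conv_radius q) auto
    then show ?case using Suc assms q by (simp add: eval_geo del: power_Suc)
  qed (simp add: pgf_0)
qed

lemma bipartitions_eq_UN: "bipartitions n = (\<Union>i\<in>{0..n}. partitions i \<times> partitions (n - i))"
  by (auto simp: bipartitions_def partitions_def)

lemma finite_bipartitions: "finite (bipartitions n)"
  unfolding bipartitions_eq_UN using finite_partitions by auto

text \<open>For \<open>n \<le> M\<close> the bound \<open>M\<close> on the parts is vacuous, so the
  Cauchy product runs over all pairs of partitions.\<close>

lemma pgf_mult_nth:
  assumes "n \<le> M"
  shows "fps_nth (pgf z M * pgf w M) n = (\<Sum>p\<in>bipartitions n. z ^ length (fst p) * w ^ length (snd p))"
proof -
  have "(\<Sum>p\<in>bipartitions n. z ^ length (fst p) * w ^ length (snd p)) =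
     (\<Sum>i=0..n. \<Sum>p\<in>partitions i \<times> partitions (n - i). z ^ length (fst p) * w ^ length (snd p))"
    unfolding bipartitions_eq_UN
    by (rule sum.UNION_disjoint) (auto simp: finite_partitions, auto simp: partitions_def)
  also have "\<dots> = (\<Sum>i=0..n. (\<Sum>l\<in>partitions i. z ^ length l) * (\<Sum>l\<in>partitions (n - i). w ^ length l))"
    by (simp add: sum_product sum.cartesian_product case_prod_beta)
  also have "\<dots> = fps_nth (pgf z M * pgf w M) n"
    using assms by (auto simp: fps_mult_nth pgf_def bounded_partitions_eq intro!: sum.cong)
  finally show ?thesis ..
qed

section \<open>Selecting a residue class by roots of unity\<close>

lemma sum_roots_of_unity:
  fixes b :: nat and m :: int
  assumes "b > 0"
  shows "(\<Sum>s<b. cis (2 * pi * real s * of_int m / real b)) = (if int b dvd m then of_nat b else 0)"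
proof -
  define x where "x = cis (2 * pi * of_int m / real b)"
  have pw: "cis (2 * pi * real s * of_int m / real b) = x ^ s" for s
    by (simp add: x_def Complex.DeMoivre algebra_simps)
  have xb: "x ^ b = 1"
  proof -
    have "x ^ b = cis (2 * pi * real_of_int m)" using assms by (simp add: x_def Complex.DeMoivre)
    then show ?thesis by (simp only: cis_multiple_2pi[OF Ints_of_int])
  qed
  show ?thesis
  proof (cases "int b dvd m")
    case True
    then obtain c where c: "m = int b * c" by (elim dvdE)
    have "x = cis (2 * pi * real_of_int c)" unfolding x_def c
      by (rule arg_cong[where f = cis]) (use assms in simp)
    also have "\<dots> = 1" by (rule cis_multiple_2pi[OF Ints_of_int])
    finally have "x = 1" .
    then show ?thesis using True by (simp add: pw)
  next
    case False
    have "x \<noteq> 1"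
    proof
      assume "x = 1"
      then have "cos (2 * pi * of_int m / real b) = 1" unfolding x_def by (metis cis.simps(1) one_complex.simps(1))
      then obtain c :: int where "2 * pi * of_int m / real b = of_int c * 2 * pi"
        by (auto simp: cos_one_2pi_int)
      then have "real_of_int m = real_of_int (c * int b)" using assms by (simp add: field_simps)
      then have "m = c * int b" by (simp only: of_int_eq_iff)
      then show False using False by simp
    qed
    then show ?thesis using False sum_gp_strict[of x b] xb by (simp add: pw)
  qed
qed

text \<open>A part of the first component carries \<open>cis \<phi>\<close> and one of the second
  \<open>cis (-\<phi>)\<close>, so \<open>cis \<phi>\<close> marks the difference of the numbers of
  parts while \<open>q\<close> marks the total size.\<close>

definition bip_gf :: "nat \<Rightarrow> real \<Rightarrow> complex \<Rightarrow> complex" where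
  "bip_gf M \<phi> q = (\<Prod>k=1..M. 1 / ((1 - cis \<phi> * q ^ k) * (1 - cis (-\<phi>) * q ^ k)))"

text \<open>Each summand integrates to a coefficient by Cauchy's formula. The weighted sum over the
  \<open>b\<close>-th roots of unity then annihilates the pairs outside the residue class
  \<open>a\<close> and counts the others \<open>b\<close> times.\<close>

lemma has_integral_bip:
  fixes a :: int and b n M :: nat and r :: real
  assumes "b > 0" "0 \<le> a" "a < int b" "n \<le> M" "0 < r" "r < 1"
  shows "((\<lambda>\<theta>. (\<Sum>s<b. cis (- (2 * pi * real s * of_int a / real b)) *
             bip_gf M (2 * pi * real s / real b) (of_real r * cis \<theta>)) * cis (- (real n * \<theta>)))
           has_integral (2 * pi * real b * real (bip a (int b) n) * r ^ n)) {-pi..pi}"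
proof -
  define \<phi> where "\<phi> s = 2 * pi * real s / real b" for s
  define c where "c s = cis (- (2 * pi * real s * of_int a / real b))" for s :: nat
  define f where "f s = pgf (cis (\<phi> s)) M * pgf (cis (- \<phi> s)) M" for s
  define P where "P = bipartitions n"
  have rad: "fps_conv_radius (pgf (cis x) M) \<ge> 1" for x
    by (rule pgf_prod) simp
  have radf: "fps_conv_radius (f s) \<ge> 1" for s
    using fps_conv_radius_mult[of "pgf (cis (\<phi> s)) M" "pgf (cis (- \<phi> s)) M"] rad
    by (auto simp: f_def intro: order_trans[rotated])
  have ev: "eval_fps (f s) q = bip_gf M (\<phi> s) q" if "norm q < 1" for s q
  proof -
    have "eval_fps (f s) q = eval_fps (pgf (cis (\<phi> s)) M) q * eval_fps (pgf (cis (- \<phi> s)) M) q"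
      unfolding f_def by (intro eval_fps_mult norm_less_conv_radius rad that)
    then show ?thesis
      by (simp add: pgf_prod(2) that bip_gf_def prod.distrib[symmetric])
  qed
  have "((\<lambda>\<theta>. \<Sum>s<b. c s * (eval_fps (f s) (of_real r * cis \<theta>) * cis (- (real n * \<theta>))))
      has_integral (\<Sum>s<b. c s * (2 * pi * fps_nth (f s) n * of_real r ^ n))) {-pi..pi}"
    by (intro has_integral_sum has_integral_mult_right has_integral_fps_coeff radf assms) auto
  also have "(\<Sum>s<b. c s * (2 * pi * fps_nth (f s) n * of_real r ^ n)) =
      2 * pi * (\<Sum>s<b. c s * fps_nth (f s) n) * of_real r ^ n"
    by (simp add: sum_distrib_left sum_distrib_right mult_ac)
  also have "(\<Sum>s<b. c s * fps_nth (f s) n) = real b * real (bip a (int b) n)"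
  proof -
    have "(\<Sum>s<b. c s * fps_nth (f s) n) = (\<Sum>s<b. \<Sum>p\<in>P.
        cis (2 * pi * real s * of_int (int (length (fst p)) - int (length (snd p)) - a) / real b))"
    proof (rule sum.cong)
      fix s
      show "c s * fps_nth (f s) n = (\<Sum>p\<in>P.
        cis (2 * pi * real s * of_int (int (length (fst p)) - int (length (snd p)) - a) / real b))"
        unfolding f_def pgf_mult_nth[OF assms(4)] P_def sum_distrib_left
      proof (rule sum.cong)
        fix p :: "nat list \<times> nat list"
        show "c s * (cis (\<phi> s) ^ length (fst p) * cis (- \<phi> s) ^ length (snd p)) =
          cis (2 * pi * real s * of_int (int (length (fst p)) - int (length (snd p)) - a) / real b)"
          unfolding c_def \<phi>_def Complex.DeMoivre cis_mult
          by (rule arg_cong[where f = cis]) (use assms(1) in \<open>simp add: field_simps\<close>)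
      qed simp
    qed simp
    also have "\<dots> = (\<Sum>p\<in>P. \<Sum>s<b.
        cis (2 * pi * real s * of_int (int (length (fst p)) - int (length (snd p)) - a) / real b))"
      by (rule sum.swap)
    also have "\<dots> = (\<Sum>p\<in>P. if (int (length (fst p)) - int (length (snd p))) mod int b = a then of_nat b else 0)"
    proof (rule sum.cong)
      fix p assume "p \<in> P"
      have "(int b dvd x - a) = (x mod int b = a)" for x
        using assms(2,3) by (metis mod_eq_dvd_iff mod_pos_pos_trivial)
      then show "(\<Sum>s<b. cis (2 * pi * real s * of_int (int (length (fst p)) - int (length (snd p)) - a) / real b))
          = (if (int (length (fst p)) - int (length (snd p))) mod int b = a then of_nat b else 0)"
        by (subst sum_roots_of_unity[OF assms(1)]) simp
    qed simp
    also have "\<dots> = of_nat (card {p \<in> P. (int (length (fst p)) - int (length (snd p))) mod int b = a}) * of_nat b"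
      by (subst sum.inter_filter[symmetric]) (simp_all add: P_def finite_bipartitions)
    finally show ?thesis by (simp add: bip_def P_def mult.commute)
  qed
  finally have int: "((\<lambda>\<theta>. \<Sum>s<b. c s * (bip_gf M (\<phi> s) (of_real r * cis \<theta>) * cis (- (real n * \<theta>))))
      has_integral (2 * pi * (real b * real (bip a (int b) n)) * of_real r ^ n)) {-pi..pi}"
    using assms by (subst (asm) ev) (simp_all add: norm_mult)
  then show ?thesis
    by (simp add: assms c_def \<phi>_def sum_distrib_right sum_distrib_left mult_ac)
qed

section \<open>Saddle point estimates\<close>

text \<open>For \<open>p = 1\<close> and \<open>p = 2\<close> these are, up to sign, the first and
  second derivatives in \<open>A\<close> of the logarithm of \<open>bip_gf M 0\<close> at
  \<open>exp (-A)\<close>; for \<open>p = 3\<close> the sum bounds the third-order remainder. The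
  factor 2 stands for the two components.\<close>

definition pow_sum :: "nat \<Rightarrow> nat \<Rightarrow> real \<Rightarrow> real" where
  "pow_sum p M A = (\<Sum>k=1..M. 2 * real k ^ p * exp (- (real k * A)) / (1 - exp (- (real k * A))) ^ p)"

lemma one_minus_exp_ge:
  assumes "y > 0" shows "1 - exp (-y) \<ge> y / (1 + y)" "1 - exp (-y) > (0::real)"
proof -
  have "exp (-y) \<le> 1 / (1 + y)"
    using exp_ge_add_one_self[of y] assms by (simp add: exp_minus inverse_eq_divide frac_le)
  then show "1 - exp (-y) \<ge> y / (1 + y)" using assms by (simp add: field_simps)
  show "1 - exp (-y) > 0" using assms by simp
qed

lemma sum_exp_le:
  assumes "A > (0::real)" shows "(\<Sum>k=1..M. exp (- (real k * A / 2))) \<le> 2 / A"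
proof -
  define w where "w = exp (- A / 2)"
  have w: "0 < w" "w < 1" using assms by (auto simp: w_def)
  have "(\<Sum>k=1..M. exp (- (real k * A / 2))) = (\<Sum>k=1..M. w ^ k)"
    by (intro sum.cong) (auto simp: w_def exp_of_nat_mult[symmetric])
  also have "\<dots> \<le> w / (1 - w)"
  proof -
    have "(1 - w) * (\<Sum>k=1..M. w ^ k) = w - w ^ Suc M"
    proof (induction M)
      case (Suc M)
      have "(1 - w) * (\<Sum>k=1..Suc M. w ^ k) = (1 - w) * (\<Sum>k=1..M. w ^ k) + (1 - w) * w ^ Suc M"
        by (simp add: distrib_left)
      also have "\<dots> = w - w ^ Suc M + (1 - w) * w ^ Suc M" by (simp only: Suc.IH)
      also have "\<dots> = w - w ^ Suc (Suc M)" by (simp add: algebra_simps)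
      finally show ?case .
    qed simp
    then have "(1 - w) * (\<Sum>k=1..M. w ^ k) \<le> w" using w by simp
    then show ?thesis using w by (simp add: field_simps)
  qed
  also have "\<dots> \<le> 2 / A"
  proof -
    have "1 / w \<ge> 1 + A / 2"
      using exp_ge_add_one_self[of "A / 2"] by (simp add: w_def exp_minus inverse_eq_divide)
    then have "1 \<ge> w * (1 + A / 2)" using w by (simp add: field_simps)
    then show ?thesis using w assms by (simp add: field_simps)
  qed
  finally show ?thesis .
qed

text \<open>Put \<open>y = k * A\<close>. Then \<open>k / (1 - exp (-y)) \<le> (1 + y) / A\<close>,
  and half of the decay of \<open>exp (-y)\<close> absorbs \<open>(1 + y) ^ p\<close>; the other
  half is summed geometrically, which produces the last factor \<open>1 / A\<close>.\<close>

lemma pow_sum_le: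
  assumes A: "A > 0" and p: "p \<le> 3" shows "pow_sum p M A \<le> 864 / A ^ Suc p"
proof -
  have "2 * real k ^ p * exp (- (real k * A)) / (1 - exp (- (real k * A))) ^ p
      \<le> 432 / A ^ p * exp (- (real k * A / 2))" if "k \<in> {1..M}" for k
  proof -
    define y where "y = real k * A"
    have y: "y > 0" using that A by (simp add: y_def)
    \<comment> \<open>Three factors \<open>exp (y / 6)\<close> make \<open>exp (y / 2)\<close>;
      hence the restriction \<open>p \<le> 3\<close> and the constant 216 = 6^3.\<close>
    have "1 + y \<le> 6 * exp (y / 6)" using exp_ge_add_one_self[of "y / 6"] by linarith
    then have "(1 + y) ^ 3 \<le> (6 * exp (y / 6)) ^ 3" using y by (intro power_mono) auto
    also have "\<dots> = 216 * exp (y / 2)" by (simp add: power_mult_distrib exp_of_nat_mult[symmetric])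
    finally have "(1 + y) ^ p \<le> 216 * exp (y / 2)"
      using power_increasing[OF p, of "1 + y"] y by linarith
    then have "(1 + y) ^ p * exp (-y) \<le> 216 * exp (y / 2) * exp (- y)" by (intro mult_right_mono) auto
    then have e: "(1 + y) ^ p * exp (-y) \<le> 216 * exp (- (y / 2))" by (simp add: exp_add[symmetric] mult.assoc)
    have "real k / (1 - exp (-y)) \<le> real k / (y / (1 + y))"
      using one_minus_exp_ge[OF y] y that by (intro divide_left_mono) auto
    also have "\<dots> = (1 + y) / A" using that A by (simp add: y_def field_simps)
    finally have "(real k / (1 - exp (-y))) ^ p \<le> ((1 + y) / A) ^ p"
      using one_minus_exp_ge[OF y] by (intro power_mono) auto
    then have "2 * (real k / (1 - exp (-y))) ^ p * exp (-y) \<le> 2 * ((1 + y) / A) ^ p * exp (-y)"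
      by (intro mult_right_mono) auto
    also have "\<dots> = 2 / A ^ p * ((1 + y) ^ p * exp (-y))" by (simp add: power_divide)
    also have "\<dots> \<le> 2 / A ^ p * (216 * exp (- (y / 2)))" using A by (intro mult_left_mono e) auto
    finally show ?thesis by (simp add: y_def power_divide mult_ac)
  qed
  then have "pow_sum p M A \<le> (\<Sum>k=1..M. 432 / A ^ p * exp (- (real k * A / 2)))"
    unfolding pow_sum_def by (rule sum_mono)
  also have "\<dots> = 432 / A ^ p * (\<Sum>k=1..M. exp (- (real k * A / 2)))" by (rule sum_distrib_left[symmetric])
  also have "\<dots> \<le> 432 / A ^ p * (2 / A)" using A by (intro mult_left_mono sum_exp_le) auto
  finally show ?thesis by (simp add: mult.commute)
qed

lemma pow_sum_nonneg: "A > 0 \<Longrightarrow> pow_sum p M A \<ge> 0"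
  unfolding pow_sum_def using one_minus_exp_ge(2)
  by (intro sum_nonneg divide_nonneg_nonneg mult_nonneg_nonneg zero_le_power) (auto intro: less_imp_le)

text \<open>The indices up to \<open>K\<close> are those with \<open>k * A \<le> 1\<close>, where
  \<open>exp (- (k * A))\<close> stays above \<open>1 / 3\<close>. All lower bounds below use only
  them, and \<open>1 \<le> M * A\<close> ensures that the product up to \<open>M\<close> contains
  them.\<close>

lemma floor_inverse:
  fixes A :: real and M :: nat
  assumes "0 < A" "A \<le> 1" "1 \<le> real M * A"
  defines "K \<equiv> nat \<lfloor>1 / A\<rfloor>"
  shows "K \<le> M" "real K \<ge> 1 / A - 1" "real K \<ge> 1 / (2 * A)" "\<And>k. k \<le> K \<Longrightarrow> real k * A \<le> 1"
proof -
  have one: "1 / A \<ge> 1" using assms by simp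
  have K: "real K = of_int \<lfloor>1 / A\<rfloor>" using one assms by (simp add: K_def)
  have up: "real K \<le> 1 / A" unfolding K by (rule of_int_floor_le)
  show lo: "real K \<ge> 1 / A - 1" unfolding K by linarith
  have "\<lfloor>1 / A\<rfloor> \<ge> 1" using one by simp
  then have "real K \<ge> 1" unfolding K by (simp only: of_int_1_le_iff)
  then show "real K \<ge> 1 / (2 * A)" using lo by (simp add: field_simps)
  have "1 / A \<le> real M" using assms by (simp add: field_simps)
  then show "K \<le> M" using up by linarith
  show "real k * A \<le> 1" if "k \<le> K" for k
  proof -
    have "real k \<le> 1 / A" using that up by linarith
    then show ?thesis using assms by (simp add: field_simps)
  qed
qed

lemma exp_minus_bounds:
  fixes y :: real assumes "0 < y" "y \<le> 1"
  shows "exp (-y) \<ge> 1 / 3" "1 - exp (-y) \<le> y" "1 - exp (-y) > 0"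
proof -
  have "exp (-1) \<le> exp (-y)" using assms by simp
  moreover have "exp (-1) \<ge> (1 / 3 :: real)"
    using exp_le by (simp add: exp_minus inverse_eq_divide field_simps)
  ultimately show "exp (-y) \<ge> 1 / 3" by linarith
  show "1 - exp (-y) \<le> y" using exp_ge_add_one_self[of "-y"] by linarith
  show "1 - exp (-y) > 0" using assms by simp
qed

text \<open>The terms with \<open>k * A \<le> 1\<close> suffice: there are at least
  \<open>1 / (2 * A)\<close> of them, each at least \<open>2 / (3 * A\<^sup>2)\<close>.\<close>

lemma pow_sum_2_ge:
  assumes "0 < A" "A \<le> 1" "1 \<le> real M * A"
  shows "pow_sum 2 M A \<ge> 1 / (3 * A ^ 3)"
proof -
  define K where "K = nat \<lfloor>1 / A\<rfloor>"
  note K = floor_inverse[OF assms, folded K_def]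
  have "1 / (3 * A ^ 3) = 1 / (2 * A) * (2 / 3 / A ^ 2)" using assms by (simp add: field_simps power_numeral_reduce)
  also have "\<dots> \<le> real K * (2 / 3 / A ^ 2)" using K(3) assms by (intro mult_right_mono) auto
  also have "\<dots> = (\<Sum>k=1..K. 2 / 3 / A ^ 2)" by simp
  also have "\<dots> \<le> (\<Sum>k=1..K. 2 * real k ^ 2 * exp (- (real k * A)) / (1 - exp (- (real k * A))) ^ 2)"
  proof (rule sum_mono)
    fix k assume k: "k \<in> {1..K}"
    define y where "y = real k * A"
    have y: "0 < y" "y \<le> 1" using k assms K(4)[of k] by (auto simp: y_def)
    note b = exp_minus_bounds[OF y]
    have "2 / 3 / A ^ 2 = 2 * real k ^ 2 * (1 / 3) / y ^ 2"
      using k assms by (simp add: y_def field_simps power_mult_distrib)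
    also have "\<dots> \<le> 2 * real k ^ 2 * exp (-y) / (1 - exp (-y)) ^ 2"
      using b y by (intro frac_le mult_left_mono power_mono) auto
    finally show "2 / 3 / A ^ 2 \<le> 2 * real k ^ 2 * exp (- (real k * A)) / (1 - exp (- (real k * A))) ^ 2"
      by (simp add: y_def)
  qed
  also have "\<dots> \<le> pow_sum 2 M A"
    unfolding pow_sum_def using K(1) by (intro sum_mono2) auto
  finally show ?thesis .
qed

text \<open>The intermediate value theorem: at \<open>1 / (2 * N)\<close> each of the
  \<open>2 * N\<close> terms is at least \<open>2 * N\<close>, and at the upper end the general
  bound \<open>864 / A ^ 2\<close> equals \<open>N\<close>. The lower bound on \<open>A\<close> is
  the hypothesis \<open>1 \<le> M * A\<close> for \<open>M = 2 * N\<close>.\<close>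

lemma saddle_exists:
  fixes N :: nat assumes "N \<ge> 1"
  obtains A where "1 / (2 * real N) \<le> A" "A \<le> sqrt (864 / real N)" "pow_sum 1 (2 * N) A = real N"
proof -
  define M where "M = 2 * N"
  define a where "a = 1 / (2 * real N)"
  define c where "c = sqrt (864 / real N)"
  have a: "a > 0" "a * real M = 1" using assms by (auto simp: a_def M_def)
  have ac: "a \<le> c"
  proof -
    have "a ^ 2 \<le> 864 / real N" using assms
      by (simp add: a_def power2_eq_square field_simps)
    then show ?thesis unfolding c_def by (rule real_le_rsqrt)
  qed
  have up: "pow_sum 1 M c \<le> real N"
  proof -
    have "c > 0" using a(1) ac by linarith
    moreover have "c ^ 2 = 864 / real N" by (simp add: c_def)
    ultimately show ?thesis using pow_sum_le[of c 1 M] assms by (simp add: power2_eq_square)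
  qed
  have lo: "real N \<le> pow_sum 1 M a"
  proof -
    have "real M \<le> 2 * real k ^ 1 * exp (- (real k * a)) / (1 - exp (- (real k * a))) ^ 1"
      if k: "k \<in> {1..M}" for k
    proof -
      define y where "y = real k * a"
      have "y \<le> real M * a" unfolding y_def using k a by (intro mult_right_mono) auto
      then have y: "0 < y" "y \<le> 1" using k a by (auto simp: y_def mult.commute)
      \<comment> \<open>Since \<open>exp y - 1 \<le> 2 * y\<close> on the unit interval, each term
        is at least \<open>1 / a\<close>, which is \<open>M\<close>.\<close>
      have "exp y \<le> 1 + y + y\<^sup>2" using exp_bound[of y] y by simp
      moreover have "y\<^sup>2 \<le> y" using y by (simp add: power2_eq_square mult_left_le)
      ultimately have "exp y - 1 \<le> 2 * y" by linarith
      then have "(exp y - 1) * exp (-y) \<le> 2 * y * exp (-y)" by (intro mult_right_mono) auto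
      then have "1 - exp (-y) \<le> 2 * y * exp (-y)"
        by (simp add: left_diff_distrib exp_minus_inverse)
      then have "real M * (1 - exp (-y)) \<le> real M * (2 * y * exp (-y))" by (intro mult_left_mono) auto
      also have "\<dots> = 2 * real k * exp (-y) * (a * real M)" by (simp add: y_def)
      finally have "real M * (1 - exp (-y)) \<le> 2 * real k * exp (-y)" using a by simp
      then show ?thesis using one_minus_exp_ge(2)[OF y(1)] by (simp add: y_def pos_le_divide_eq)
    qed
    then have "(\<Sum>k=1..M. real M) \<le> pow_sum 1 M a" unfolding pow_sum_def by (rule sum_mono)
    moreover have "real N \<le> real M * real M" using assms by (simp add: M_def)
    ultimately show ?thesis by simp
  qed
  have "continuous_on {a..c} (pow_sum 1 M)"
    unfolding pow_sum_def
    by (intro continuous_intros) (use a in auto)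
  from IVT2'[of "pow_sum 1 M", OF up lo ac this] obtain A where "a \<le> A" "A \<le> c" "pow_sum 1 M A = real N"
    by auto
  then show thesis using that by (simp add: a_def c_def M_def)
qed

section \<open>Decay of the normalised generating function on the circle\<close>

definition psi :: "real \<Rightarrow> real \<Rightarrow> complex" where
  "psi x \<alpha> = (1 - of_real x) / (1 - of_real x * cis \<alpha>)"

lemma norm_psi_sq:
  assumes "0 \<le> x" "x < 1"
  shows "(norm (psi x \<alpha>))\<^sup>2 = 1 / (1 + 2 * x * (1 - cos \<alpha>) / (1 - x)\<^sup>2)"
proof -
  have id: "(1 - x * c)\<^sup>2 + (x * s)\<^sup>2 = (1 - x)\<^sup>2 + 2 * x * (1 - c) + x\<^sup>2 * (s\<^sup>2 + c\<^sup>2 - 1)" for c s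
    by (simp add: algebra_simps power2_eq_square)
  have "(norm (1 - of_real x * cis \<alpha>))\<^sup>2 = (1 - x * cos \<alpha>)\<^sup>2 + (x * sin \<alpha>)\<^sup>2"
    by (simp add: cmod_power2)
  also have "\<dots> = (1 - x)\<^sup>2 + 2 * x * (1 - cos \<alpha>) + x\<^sup>2 * ((sin \<alpha>)\<^sup>2 + (cos \<alpha>)\<^sup>2 - 1)"
    by (rule id)
  finally have d: "(norm (1 - of_real x * cis \<alpha>))\<^sup>2 = (1 - x)\<^sup>2 + 2 * x * (1 - cos \<alpha>)" by simp
  have n: "(norm (1 - of_real x :: complex))\<^sup>2 = (1 - x)\<^sup>2"
    by (metis norm_of_real of_real_1 of_real_diff power2_abs)
  have pos: "(1 - x)\<^sup>2 > 0" using assms by simp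
  moreover have "2 * x * (1 - cos \<alpha>) \<ge> 0" using assms by simp
  ultimately have "(1 - x)\<^sup>2 + 2 * x * (1 - cos \<alpha>) > 0" by linarith
  then show ?thesis
    unfolding psi_def norm_divide power_divide d n using pos by (simp add: field_simps)
qed

lemma norm_psi_le_1:
  assumes "0 \<le> x" "x < 1" shows "norm (psi x \<alpha>) \<le> 1"
proof -
  have "2 * x * (1 - cos \<alpha>) / (1 - x)\<^sup>2 \<ge> 0" using assms by simp
  then have "(norm (psi x \<alpha>))\<^sup>2 \<le> 1" unfolding norm_psi_sq[OF assms] by (simp add: field_simps)
  then show ?thesis by (simp add: power_le_one_iff)
qed

lemma inverse_one_plus_le_exp:
  fixes z :: real assumes "0 \<le> z" "z \<le> 1" shows "1 / (1 + z) \<le> exp (- (z / 2))"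
proof -
  have "exp (z / 2) \<le> 1 + z / 2 + (z / 2)\<^sup>2" using assms by (intro exp_bound) auto
  moreover have "z\<^sup>2 \<le> z" using assms by (simp add: power2_eq_square mult_left_le)
  ultimately have "exp (z / 2) \<le> 1 + z" using assms by (simp add: power_divide)
  then have "1 / (1 + z) \<le> 1 / exp (z / 2)" using assms by (intro divide_left_mono) auto
  then show ?thesis by (simp add: exp_minus inverse_eq_divide)
qed

text \<open>As \<open>1 - exp (-y) \<le> y\<close> and \<open>exp (-y) \<ge> 1 / 4\<close>, the
  fraction in the formula for the modulus is at least \<open>z\<close>. The parameter
  \<open>z\<close> is free because it is used in two ways: proportional to (\<theta> / A)^2 near the
  real axis, and as \<open>(1 - cos \<alpha>) / 2\<close> elsewhere.\<close>

lemma norm_psi_sq_le: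
  assumes y: "0 < y" "y \<le> 1" and z: "0 \<le> z" "z \<le> 1" "z * y\<^sup>2 \<le> (1 - cos \<alpha>) / 2"
  shows "(norm (psi (exp (-y)) \<alpha>))\<^sup>2 \<le> exp (- (z / 2))"
proof -
  note b = exp_minus_bounds[OF y]
  have "z \<le> (1 - cos \<alpha>) / 2 / y\<^sup>2" using z y by (simp add: field_simps)
  also have "\<dots> \<le> 2 * exp (-y) * (1 - cos \<alpha>) / (1 - exp (-y))\<^sup>2"
  proof (rule frac_le)
    have "1 / 2 * (1 - cos \<alpha>) \<le> 2 * exp (-y) * (1 - cos \<alpha>)" using b by (intro mult_right_mono) auto
    then show "(1 - cos \<alpha>) / 2 \<le> 2 * exp (- y) * (1 - cos \<alpha>)" by simp
    show "(1 - exp (- y))\<^sup>2 \<le> y\<^sup>2" using b by (intro power_mono) auto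
    show "0 \<le> 2 * exp (- y) * (1 - cos \<alpha>)" by simp
    show "0 < (1 - exp (- y))\<^sup>2" using b by simp
  qed
  finally have "(norm (psi (exp (-y)) \<alpha>))\<^sup>2 \<le> 1 / (1 + z)"
    using z b by (subst norm_psi_sq) (auto intro!: divide_left_mono mult_pos_pos add_pos_nonneg)
  then show ?thesis using inverse_one_plus_le_exp[OF z(1,2)] by linarith
qed

lemma norm_psi_le_exp:
  assumes y: "0 < y" "y \<le> 1"
  shows "norm (psi (exp (-y)) \<alpha>) \<le> exp (- ((1 - cos \<alpha>) / 8))"
proof -
  have "(1 - cos \<alpha>) / 2 * y\<^sup>2 \<le> (1 - cos \<alpha>) / 2 * 1"
    using y by (intro mult_left_mono) (auto simp: power_le_one)
  moreover have "cos \<alpha> \<ge> -1" by simp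
  ultimately have "(norm (psi (exp (-y)) \<alpha>))\<^sup>2 \<le> exp (- ((1 - cos \<alpha>) / 2 / 2))"
    using y by (intro norm_psi_sq_le) auto
  also have "\<dots> = (exp (- ((1 - cos \<alpha>) / 8)))\<^sup>2" by (simp add: exp_of_nat_mult[symmetric])
  finally show ?thesis by (rule power2_le_imp_le) simp
qed

text \<open>By Taylor, since x^4 / 24 is at most x^2 / 6 in this range and 1/2 - 1/6 = 1/3. The
  range is what \<open>\<bar>\<theta>\<bar> \<le> 2 * A\<close> and \<open>k \<le> 1 / A\<close>
  leave for \<open>k * \<theta>\<close>.\<close>

lemma one_minus_cos_ge:
  fixes x :: real assumes "\<bar>x\<bar> \<le> 2" shows "1 - cos x \<ge> x\<^sup>2 / 3"
proof -
  obtain t where t: "cos x = (\<Sum>m<4. cos_coeff m * x ^ m) + cos (t + 1/2 * real 4 * pi) / fact 4 * x ^ 4"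
    using Maclaurin_cos_expansion[of x 4] by auto
  have "(\<Sum>m<4. cos_coeff m * x ^ m) = 1 - x\<^sup>2 / 2"
  proof -
    have "{..<4::nat} = {0, 1, 2, 3}" by auto
    then show ?thesis by (simp add: cos_coeff_def)
  qed
  moreover have "cos (t + 1/2 * real 4 * pi) / fact 4 * x ^ 4 \<le> 1 / 24 * x ^ 4"
    by (intro mult_right_mono) (auto simp: fact_numeral)
  moreover have "x ^ 4 \<le> 4 * x\<^sup>2"
  proof -
    have "x\<^sup>2 \<le> 2\<^sup>2" using assms by (metis abs_ge_zero power2_abs power_mono)
    then have "x\<^sup>2 * x\<^sup>2 \<le> 4 * x\<^sup>2" by (intro mult_right_mono) auto
    then show ?thesis by (simp add: power_numeral_reduce power2_eq_square mult_ac)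
  qed
  ultimately show ?thesis using t by linarith
qed

text \<open>Each \<open>psi x\<close> is the characteristic function of a geometric variable. For
  \<open>\<phi> = 0\<close> the product is thus the characteristic function of the size of a random
  pair; in general it is \<open>bip_gf\<close> on the circle divided by the untwisted value at the
  positive real point.\<close>

definition quotient_gf :: "nat \<Rightarrow> real \<Rightarrow> real \<Rightarrow> real \<Rightarrow> complex" where
  "quotient_gf M A \<phi> \<theta> = (\<Prod>k=1..M. psi (exp (- (real k * A))) (real k * \<theta> + \<phi>) *
                              psi (exp (- (real k * A))) (real k * \<theta> - \<phi>))"

lemma norm_quotient_gf_le_prod:
  assumes A: "0 < A" "A \<le> 1" "1 \<le> real M * A"
    and f: "\<And>k. 1 \<le> k \<Longrightarrow> k \<le> nat \<lfloor>1 / A\<rfloor> \<Longrightarrow>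
      norm (psi (exp (- (real k * A))) (real k * \<theta> + \<phi>) * psi (exp (- (real k * A))) (real k * \<theta> - \<phi>))
        \<le> exp (- f k)"
  shows "norm (quotient_gf M A \<phi> \<theta>) \<le> exp (- (\<Sum>k=1..nat \<lfloor>1 / A\<rfloor>. f k))"
proof -
  define K where "K = nat \<lfloor>1 / A\<rfloor>"
  note K = floor_inverse[OF A, folded K_def]
  define g where "g k = norm (psi (exp (- (real k * A))) (real k * \<theta> + \<phi>) * psi (exp (- (real k * A))) (real k * \<theta> - \<phi>))" for k
  have g1: "0 \<le> g k \<and> g k \<le> 1" if "k \<ge> 1" for k
    using that A unfolding g_def norm_mult by (auto intro!: mult_le_one norm_psi_le_1)
  have "norm (quotient_gf M A \<phi> \<theta>) = (\<Prod>k=1..M. g k)"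
    by (simp add: quotient_gf_def prod_norm[symmetric] g_def)
  also have "\<dots> = (\<Prod>k\<in>{1..K} \<union> {K+1..M}. g k)" using K(1) by (intro prod.cong) auto
  also have "\<dots> = (\<Prod>k=1..K. g k) * (\<Prod>k=K+1..M. g k)" by (rule prod.union_disjoint) auto
  also have "\<dots> \<le> (\<Prod>k=1..K. exp (- f k)) * 1"
    using g1 f by (intro mult_mono prod_mono prod_le_1 prod_nonneg) (auto simp: g_def K_def)
  also have "\<dots> = exp (- (\<Sum>k=1..K. f k))" by (simp add: exp_sum sum_negf[symmetric])
  finally show ?thesis by (simp add: K_def)
qed

text \<open>For \<open>k \<le> 1 / A\<close> the angle \<open>k * \<theta>\<close> stays in [-2, 2],
  where \<open>1 - cos\<close> has a quadratic lower bound. At least \<open>1 / (2 * A)\<close>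
  factors each contribute an exponent of order (\<theta> / A)^2, in accordance with a variance of
  order A^(-3).\<close>

lemma norm_quotient_gf_major:
  assumes A: "0 < A" "A \<le> 1" "1 \<le> real M * A" and th: "\<bar>\<theta>\<bar> \<le> 2 * A"
  shows "norm (quotient_gf M A 0 \<theta>) \<le> exp (- (\<theta>\<^sup>2 / (24 * A ^ 3)))"
proof -
  define K where "K = nat \<lfloor>1 / A\<rfloor>"
  note K = floor_inverse[OF A, folded K_def]
  have "norm (quotient_gf M A 0 \<theta>) \<le> exp (- (\<Sum>k=1..K. \<theta>\<^sup>2 / (12 * A\<^sup>2)))"
    unfolding K_def
  proof (rule norm_quotient_gf_le_prod[OF A])
    fix k assume k: "1 \<le> k" "k \<le> nat \<lfloor>1 / A\<rfloor>"
    define y where "y = real k * A"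
    have y: "0 < y" "y \<le> 1" using k A K(4)[of k] by (auto simp: y_def K_def)
    have "\<bar>real k * \<theta>\<bar> \<le> real k * (2 * A)" using th by (simp add: abs_mult mult_left_mono)
    also have "\<dots> \<le> 2" using y by (simp add: y_def)
    finally have "1 - cos (real k * \<theta>) \<ge> (real k * \<theta>)\<^sup>2 / 3" by (rule one_minus_cos_ge)
    \<comment> \<open>This \<open>z\<close> is the same for all \<open>k\<close>, as the factor
      \<open>k\<close> of the angle cancels against that of \<open>y\<close>.\<close>
    moreover have "\<theta>\<^sup>2 / (6 * A\<^sup>2) * y\<^sup>2 = (real k * \<theta>)\<^sup>2 / 6"
      using A by (simp add: y_def power_mult_distrib)
    moreover have "\<theta>\<^sup>2 \<le> (2 * A)\<^sup>2" using th by (metis abs_ge_zero power2_abs power_mono)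
    then have "\<theta>\<^sup>2 \<le> 4 * A\<^sup>2" by (simp add: power_mult_distrib)
    then have "\<theta>\<^sup>2 \<le> 6 * A\<^sup>2" using zero_le_power2[of A] by linarith
    then have "\<theta>\<^sup>2 / (6 * A\<^sup>2) \<le> 1" using A by (simp add: divide_le_eq)
    ultimately have "(norm (psi (exp (-y)) (real k * \<theta>)))\<^sup>2 \<le> exp (- (\<theta>\<^sup>2 / (6 * A\<^sup>2) / 2))"
      using y by (intro norm_psi_sq_le) auto
    then show "norm (psi (exp (- (real k * A))) (real k * \<theta> + 0) * psi (exp (- (real k * A))) (real k * \<theta> - 0))
        \<le> exp (- (\<theta>\<^sup>2 / (12 * A\<^sup>2)))"
      by (simp add: norm_mult power2_eq_square y_def)
  qed
  also have "\<dots> \<le> exp (- (\<theta>\<^sup>2 / (24 * A ^ 3)))"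
  proof -
    have "\<theta>\<^sup>2 / (24 * A ^ 3) = 1 / (2 * A) * (\<theta>\<^sup>2 / (12 * A\<^sup>2))" by (simp add: power_numeral_reduce)
    also have "\<dots> \<le> real K * (\<theta>\<^sup>2 / (12 * A\<^sup>2))" using K(3) A by (intro mult_right_mono) auto
    finally show ?thesis by simp
  qed
  finally show ?thesis .
qed

text \<open>The mean of the cosines of \<open>k * \<theta> + \<phi>\<close> and
  \<open>k * \<theta> - \<phi>\<close> is \<open>cos \<phi> * cos (k * \<theta>)\<close>, so the two
  \<open>psi\<close> factors of index \<open>k\<close> combine into one term.\<close>

lemma norm_quotient_gf_le:
  assumes A: "0 < A" "A \<le> 1" "1 \<le> real M * A"
  shows "norm (quotient_gf M A \<phi> \<theta>) \<le> exp (- ((\<Sum>k=1..nat \<lfloor>1 / A\<rfloor>. 1 - cos \<phi> * cos (real k * \<theta>)) / 4))"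
proof -
  have "norm (quotient_gf M A \<phi> \<theta>) \<le> exp (- (\<Sum>k=1..nat \<lfloor>1 / A\<rfloor>. (1 - cos \<phi> * cos (real k * \<theta>)) / 4))"
  proof (rule norm_quotient_gf_le_prod[OF A])
    fix k assume k: "1 \<le> k" "k \<le> nat \<lfloor>1 / A\<rfloor>"
    have y: "0 < real k * A" "real k * A \<le> 1" using k A floor_inverse(4)[OF A, of k] by auto
    have "norm (psi (exp (- (real k * A))) (real k * \<theta> + \<phi>) * psi (exp (- (real k * A))) (real k * \<theta> - \<phi>))
       \<le> exp (- ((1 - cos (real k * \<theta> + \<phi>)) / 8)) * exp (- ((1 - cos (real k * \<theta> - \<phi>)) / 8))"
      unfolding norm_mult by (intro mult_mono norm_psi_le_exp y) auto
    also have "\<dots> = exp (- ((1 - cos \<phi> * cos (real k * \<theta>)) / 4))"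
      by (simp add: exp_add[symmetric] cos_add cos_diff field_simps)
    finally show "norm (psi (exp (- (real k * A))) (real k * \<theta> + \<phi>) * psi (exp (- (real k * A))) (real k * \<theta> - \<phi>))
       \<le> exp (- ((1 - cos \<phi> * cos (real k * \<theta>)) / 4))" .
  qed
  then show ?thesis by (simp add: sum_divide_distrib)
qed

text \<open>Some multiple \<open>m * \<theta>\<close> lies on the half circle where
  \<open>cos\<close> is not positive. Every pair \<open>k\<close>, \<open>k + m\<close> then
  contributes a fixed amount, and enough pairs fit below \<open>1 / A\<close>.\<close>

lemma sum_one_minus_cos_ge:
  fixes \<theta> A :: real
  assumes A: "0 < A" "A \<le> 1 / 20" and th: "2 * A \<le> \<bar>\<theta>\<bar>" "\<bar>\<theta>\<bar> \<le> pi"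
  shows "(\<Sum>k=1..nat \<lfloor>1 / A\<rfloor>. 1 - cos (real k * \<theta>)) \<ge> 1 / (40 * A)"
proof -
  define K where "K = nat \<lfloor>1 / A\<rfloor>"
  \<comment> \<open>The first multiple of \<open>\<bar>\<theta>\<bar>\<close> to reach
    \<open>pi / 2\<close>; as \<open>\<bar>\<theta>\<bar> \<le> pi\<close> it does not pass
    \<open>3 * pi / 2\<close>.\<close>
  define m where "m = nat \<lceil>pi / (2 * \<bar>\<theta>\<bar>)\<rceil>"
  define f where "f k = 1 - cos (real k * \<theta>)" for k
  have f0: "f k \<ge> 0" for k by (simp add: f_def)
  have th0: "\<bar>\<theta>\<bar> > 0" using A th by linarith
  have c0: "pi / (2 * \<bar>\<theta>\<bar>) > 0" using th0 by simp
  have m: "real m = of_int \<lceil>pi / (2 * \<bar>\<theta>\<bar>)\<rceil>" using c0 by (simp add: m_def less_imp_le)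
  have m1: "pi / (2 * \<bar>\<theta>\<bar>) \<le> real m" "real m < pi / (2 * \<bar>\<theta>\<bar>) + 1"
    unfolding m by linarith+
  have K: "real K \<ge> 1 / A - 1" "real K \<le> 1 / A"
    using A by (simp_all add: K_def)
  have cosm: "cos (real m * \<theta>) \<le> 0"
  proof -
    have lo: "pi / 2 \<le> real m * \<bar>\<theta>\<bar>" using m1(1) th0 by (simp add: field_simps)
    have up: "real m * \<bar>\<theta>\<bar> \<le> 3 * pi / 2"
    proof -
      have "real m * \<bar>\<theta>\<bar> \<le> (pi / (2 * \<bar>\<theta>\<bar>) + 1) * \<bar>\<theta>\<bar>" using m1(2) th0 by (intro mult_right_mono) auto
      also have "\<dots> = pi / 2 + \<bar>\<theta>\<bar>" using th0 by (simp add: field_simps)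
      finally show ?thesis using th by simp
    qed
    have "cos (real m * \<bar>\<theta>\<bar>) = - cos (real m * \<bar>\<theta>\<bar> - pi)" by (simp add: cos_diff)
    moreover have "cos (real m * \<bar>\<theta>\<bar> - pi) \<ge> 0" using lo up by (intro cos_ge_zero) auto
    moreover have "cos (real m * \<bar>\<theta>\<bar>) = cos (real m * \<theta>)" by (simp add: abs_if)
    ultimately show ?thesis by linarith
  qed
  \<comment> \<open>Here \<open>m\<close> is at most \<open>0.8 / A + 1\<close> and \<open>K\<close>
    at least \<open>1 / A - 1\<close>; the loss of 2 is at most half of \<open>0.2 / A\<close>
    because \<open>A \<le> 1 / 20\<close>.\<close>
  have mK: "real K - real m \<ge> 1 / (10 * A)"
  proof -
    have "pi / (2 * \<bar>\<theta>\<bar>) \<le> pi / (4 * A)" using th A by (intro divide_left_mono) auto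
    moreover have "pi / (4 * A) \<le> 3.2 / (4 * A)" using pi_approx A by (intro divide_right_mono) auto
    moreover have "3.2 / (4 * A) = 0.8 * (1 / A)" using A by simp
    moreover have "1 / (10 * A) = 0.1 * (1 / A)" using A by simp
    moreover have "1 / A \<ge> 20" using A by (simp add: field_simps)
    ultimately show ?thesis using K m1 by linarith
  qed
  \<comment> \<open>As \<open>m \<theta>\<close> is far from \<open>0\<close> modulo \<open>2 pi\<close>, \<open>k \<theta>\<close> and \<open>(k + m) \<theta>\<close> cannot both be close to it.\<close>
  have pair: "f k + f (k + m) \<ge> 1 / 2" for k
  proof -
    let ?a = "cis (real k * \<theta>)" and ?b = "cis (real m * \<theta>)"
    have sq: "(norm (1 - cis x))\<^sup>2 = 2 * (1 - cos x)" for x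
    proof -
      have "(norm (1 - cis x))\<^sup>2 = (1 - cos x)\<^sup>2 + (sin x)\<^sup>2" by (simp add: cmod_power2)
      also have "\<dots> = 2 * (1 - cos x)" using sin_cos_squared_add[of x]
        by (simp add: power2_diff)
      finally show ?thesis .
    qed
    have "norm (1 - ?b) = norm (?a * (1 - ?b))" by (simp add: norm_mult)
    also have "?a * (1 - ?b) = (1 - cis (real (k + m) * \<theta>)) - (1 - ?a)"
      by (simp add: cis_mult algebra_simps)
    also have "norm \<dots> \<le> norm (1 - cis (real (k + m) * \<theta>)) + norm (1 - ?a)" by (rule norm_triangle_ineq4)
    finally have "(norm (1 - ?b))\<^sup>2 \<le> (norm (1 - cis (real (k + m) * \<theta>)) + norm (1 - ?a))\<^sup>2"
      by (intro power_mono) auto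
    also have "\<dots> \<le> 2 * (norm (1 - cis (real (k + m) * \<theta>)))\<^sup>2 + 2 * (norm (1 - ?a))\<^sup>2"
      using sum_squares_bound[of "norm (1 - cis (real (k + m) * \<theta>))" "norm (1 - ?a)"]
      by (simp add: power2_sum)
    finally have "2 * (1 - cos (real m * \<theta>)) \<le> 2 * (2 * f (k + m)) + 2 * (2 * f k)"
      unfolding sq f_def .
    then show ?thesis using cosm by argo
  qed
  have "m \<le> K"
  proof -
    have "1 / (10 * A) > 0" using A by simp
    then show ?thesis using mK by linarith
  qed
  have "1 / (10 * A) / 2 \<le> (real K - real m) / 2" using mK by simp
  also have "\<dots> = (\<Sum>k=1..K-m. 1 / 2)" using \<open>m \<le> K\<close> by (simp add: of_nat_diff)
  also have "\<dots> \<le> (\<Sum>k=1..K-m. f k + f (k + m))" using pair by (intro sum_mono) auto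
  also have "\<dots> = (\<Sum>k=1..K-m. f k) + (\<Sum>k=1+m..K-m+m. f k)"
    by (simp only: sum.distrib sum.shift_bounds_cl_nat_ivl)
  also have "\<dots> \<le> (\<Sum>k=1..K. f k) + (\<Sum>k=1..K. f k)"
    using f0 \<open>m \<le> K\<close> by (intro add_mono sum_mono2) auto
  finally show ?thesis unfolding K_def f_def by simp
qed

lemma norm_quotient_gf_minor:
  assumes A: "0 < A" "A \<le> 1 / 20" "1 \<le> real M * A" and th: "2 * A \<le> \<bar>\<theta>\<bar>" "\<bar>\<theta>\<bar> \<le> pi"
  shows "norm (quotient_gf M A 0 \<theta>) \<le> exp (- (1 / (160 * A)))"
proof -
  have "norm (quotient_gf M A 0 \<theta>) \<le> exp (- ((\<Sum>k=1..nat \<lfloor>1 / A\<rfloor>. 1 - cos (real k * \<theta>)) / 4))"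
    using norm_quotient_gf_le[of A M 0 \<theta>] A by simp
  also have "\<dots> \<le> exp (- (1 / (160 * A)))"
    using sum_one_minus_cos_ge[OF A(1,2) th] by simp
  finally show ?thesis .
qed

text \<open>With \<open>u = cos x\<close> this bounds the sum of \<open>1 - g cos x\<close> and \<open>1 - g cos (2 x)\<close>: if the first
  is small then the second is not.\<close>

lemma quadratic_cos_bound:
  fixes g u :: real assumes "\<bar>g\<bar> \<le> 1" "\<bar>u\<bar> \<le> 1"
  shows "(1 - g * u) + (1 - g * (2 * u\<^sup>2 - 1)) \<ge> min (2 - 2 * g) (7 / 8)"
proof (cases "g \<ge> 0")
  case True
  have "u\<^sup>2 \<le> 1" using assms(2) by (simp add: abs_square_le_1)
  then have "u + 2 * u\<^sup>2 \<le> 3" using assms(2) by linarith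
  then have "g * (u + 2 * u\<^sup>2) \<le> g * 3" using True by (rule mult_left_mono)
  then show ?thesis by (simp add: algebra_simps)
next
  case False
  \<comment> \<open>Completing the square: \<open>u + 2 * u\<^sup>2\<close> is never below
    \<open>- 1 / 8\<close>. With \<open>g \<ge> -1\<close> this gives
    \<open>2 + 9 * g / 8 \<ge> 7 / 8\<close>.\<close>
  have "2 * (u + 1 / 4)\<^sup>2 \<ge> 0" by simp
  then have "u + 2 * u\<^sup>2 + 1 / 8 \<ge> 0" by (simp add: power2_eq_square algebra_simps)
  then have "(- g) * (u + 2 * u\<^sup>2 + 1 / 8) \<ge> 0" using False by (intro mult_nonneg_nonneg) auto
  then have "(1 - g * u) + (1 - g * (2 * u\<^sup>2 - 1)) \<ge> 2 + g + g / 8" by (simp add: algebra_simps)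
  then show ?thesis using assms(1) by linarith
qed

text \<open>A single factor can have modulus 1, for instance at
  \<open>\<phi> = k * \<theta> = pi\<close>, so the index \<open>k\<close> is paired with
  \<open>2 * k\<close>. The bound is uniform in \<open>\<theta>\<close> and a genuine decay as soon
  as \<open>cos \<phi> < 1\<close>.\<close>

lemma norm_quotient_gf_twisted:
  assumes A: "0 < A" "A \<le> 1 / 20" "1 \<le> real M * A"
  shows "norm (quotient_gf M A \<phi> \<theta>) \<le> exp (- (min (2 - 2 * cos \<phi>) (7 / 8) / (32 * A)))"
proof -
  define K where "K = nat \<lfloor>1 / A\<rfloor>"
  define h where "h = K div 2"
  define c where "c = min (2 - 2 * cos \<phi>) (7 / 8)"
  define f where "f k = 1 - cos \<phi> * cos (real k * \<theta>)" for k
  have c: "c \<ge> 0" by (simp add: c_def)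
  have K: "real K \<ge> 1 / A - 1"
    using A by (simp add: K_def)
  have f0: "f k \<ge> 0" for k
  proof -
    have "\<bar>cos \<phi> * cos (real k * \<theta>)\<bar> \<le> 1" unfolding abs_mult by (intro mult_le_one) auto
    then show ?thesis unfolding f_def by linarith
  qed
  have pair: "f k + f (2 * k) \<ge> c" for k
    using quadratic_cos_bound[of "cos \<phi>" "cos (real k * \<theta>)"] cos_double_cos[of "real k * \<theta>"]
    unfolding f_def c_def by (simp add: mult.assoc)
  have "1 / A \<ge> 20" using A by (simp add: field_simps)
  moreover have "real h \<ge> (real K - 1) / 2" unfolding h_def
    by (cases "even K") (auto elim!: evenE oddE simp: field_simps)
  ultimately have "real h \<ge> 1 / (4 * A)" using K by simp
  then have "1 / (4 * A) * c \<le> real h * c" using c by (rule mult_right_mono)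
  also have "\<dots> = (\<Sum>k=1..h. c)" by simp
  also have "\<dots> \<le> (\<Sum>k=1..h. f k + f (2 * k))" using pair by (intro sum_mono) auto
  also have "\<dots> = (\<Sum>k=1..h. f k) + sum f ((\<lambda>k. 2 * k) ` {1..h})"
    by (simp add: sum.distrib sum.reindex inj_on_def)
  also have "\<dots> \<le> (\<Sum>k=1..K. f k) + (\<Sum>k=1..K. f k)"
    using f0 by (intro add_mono sum_mono2) (auto simp: h_def)
  finally have "c / (8 * A) \<le> (\<Sum>k=1..K. f k)" by simp
  then have "exp (- ((\<Sum>k=1..K. f k) / 4)) \<le> exp (- (c / (32 * A)))" by simp
  moreover have "norm (quotient_gf M A \<phi> \<theta>) \<le> exp (- ((\<Sum>k=1..K. f k) / 4))"
    using norm_quotient_gf_le[of A M \<phi> \<theta>] A unfolding K_def f_def by simp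
  ultimately show ?thesis unfolding c_def by linarith
qed

text \<open>Taylor's theorem at 0 for -Log (1 - x e^z). On the half-plane
  \<open>Re z \<le> 0\<close> the argument of the logarithm has real part at least
  \<open>1 - x\<close>, so the principal branch is analytic there, and its third derivative is at
  most \<open>2 * x / (1 - x) ^ 3\<close> in modulus.\<close>

lemma psi_expansion:
  assumes "0 < x" "x < 1"
  obtains R where "psi x \<alpha> = exp (of_real \<alpha> * \<i> * (x / (1 - x)) - of_real (\<alpha>\<^sup>2 * (x / (1 - x)\<^sup>2) / 2) + R)"
    "norm R \<le> x / (1 - x) ^ 3 * \<bar>\<alpha>\<bar> ^ 3"
proof -
  define S where "S = {z. Re z \<le> 0}"
  define w where "w z = 1 - of_real x * exp z" for z :: complex
  define f where "f i z = (if i = 0 then - Ln (w z) else if i = 1 then of_real x * exp z / w z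
      else if i = 2 then of_real x * exp z / (w z)\<^sup>2 else of_real x * exp z * (1 + of_real x * exp z) / (w z) ^ 3)"
    for i :: nat and z
  have nxe: "norm (of_real x * exp z) \<le> x" if "z \<in> S" for z :: complex
  proof -
    have "x * exp (Re z) \<le> x * 1" using that assms by (intro mult_left_mono) (auto simp: S_def)
    then show ?thesis using assms by (simp add: norm_mult)
  qed
  have rew: "Re (w z) \<ge> 1 - x" if "z \<in> S" for z
    using nxe[OF that] complex_Re_le_cmod[of "of_real x * exp z"] by (simp add: w_def)
  have nw: "norm (w z) \<ge> 1 - x" if "z \<in> S" for z
    using rew[OF that] complex_Re_le_cmod[of "w z"] by linarith
  have w0: "w z \<noteq> 0" "w z \<notin> \<real>\<^sub>\<le>\<^sub>0" if "z \<in> S" for z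
    using rew[OF that] assms by (auto simp: complex_nonpos_Reals_iff)
  have conv: "convex S" unfolding S_def by (rule convex_halfspace_Re_le)
  have dw: "(w has_field_derivative - (of_real x * exp z)) (at z within S)" for z
    unfolding w_def by (auto intro!: derivative_eq_intros)
  have der: "(f i has_field_derivative f (Suc i) z) (at z within S)" if "z \<in> S" "i \<le> 2" for i z
  proof -
    consider "i = 0" | "i = 1" | "i = 2" using \<open>i \<le> 2\<close> by linarith
    then show ?thesis
    proof cases
      case 1
      show ?thesis unfolding 1 f_def
        using w0[OF that(1)] by (auto intro!: derivative_eq_intros dw simp: field_simps)
    next
      case 2
      show ?thesis unfolding 2 f_def
        using w0[OF that(1)] by (auto intro!: derivative_eq_intros dw simp: field_simps power2_eq_square w_def)
    next
      case 3
      let ?E = "of_real x * exp z" and ?W = "w z"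
      have W: "?W \<noteq> 0" using w0[OF that(1)] by simp
      have "((\<lambda>z. of_real x * exp z / (w z)\<^sup>2) has_field_derivative
          (?E * ?W\<^sup>2 - ?E * (2 * ?W * (- ?E))) / (?W\<^sup>2 * ?W\<^sup>2)) (at z within S)"
        using W by (auto intro!: derivative_eq_intros dw)
      moreover have "(?E * ?W\<^sup>2 - ?E * (2 * ?W * (- ?E))) / (?W\<^sup>2 * ?W\<^sup>2) = ?E * (?W + 2 * ?E) / ?W ^ 3"
        using W by (simp add: divide_simps) (simp add: power2_eq_square power3_eq_cube power4_eq_xxxx algebra_simps)
      moreover have "?W + 2 * ?E = 1 + ?E" by (simp add: w_def)
      ultimately show ?thesis unfolding 3 f_def by simp
    qed
  qed
  have B: "norm (f (Suc 2) z) \<le> 2 * x / (1 - x) ^ 3" if "z \<in> S" for z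
  proof -
    have "norm (1 + of_real x * exp z) \<le> 1 + x"
      using norm_triangle_ineq[of 1 "of_real x * exp z"] nxe[OF that] by simp
    then have "norm (of_real x * exp z) * norm (1 + of_real x * exp z) \<le> x * 2"
      using nxe[OF that] assms by (intro mult_mono) auto
    then have "norm (of_real x * exp z) * norm (1 + of_real x * exp z) / norm (w z) ^ 3 \<le> x * 2 / (1 - x) ^ 3"
      using nw[OF that] assms by (intro frac_le power_mono) auto
    then show ?thesis by (simp add: f_def norm_mult norm_divide norm_power mult.commute)
  qed
  define R where "R = f 0 (\<i> * \<alpha>) - (\<Sum>i\<le>2. f i 0 * (\<i> * \<alpha> - 0) ^ i / fact i)"
  have "norm R \<le> 2 * x / (1 - x) ^ 3 * norm (\<i> * \<alpha> - 0) ^ Suc 2 / fact 2"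
    unfolding R_def by (rule complex_Taylor[OF conv der B]) (auto simp: S_def)
  then have R: "norm R \<le> x / (1 - x) ^ 3 * \<bar>\<alpha>\<bar> ^ 3"
    by (simp add: norm_mult eval_nat_numeral)
  have S: "0 \<in> S" "\<i> * \<alpha> \<in> S" by (auto simp: S_def)
  have sum3: "(\<Sum>i\<le>2. g i) = g 0 + g 1 + g 2" for g :: "nat \<Rightarrow> complex"
    by (simp add: numeral_2_eq_2)
  have w0': "w 0 = of_real (1 - x)" by (simp add: w_def)
  have "f 0 (\<i> * \<alpha>) - f 0 0 = of_real \<alpha> * \<i> * (x / (1 - x)) - of_real (\<alpha>\<^sup>2 * (x / (1 - x)\<^sup>2) / 2) + R"
    unfolding R_def sum3 by (simp add: f_def w0' power_mult_distrib fact_2)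
  moreover have "exp (f 0 (\<i> * \<alpha>) - f 0 0) = psi x \<alpha>"
    using w0[OF S(1)] w0[OF S(2)]
    by (simp add: f_def exp_diff exp_minus psi_def w_def cis_conv_exp field_simps)
  ultimately show thesis using that R by metis
qed

text \<open>For \<open>\<phi> = 0\<close> the two factors of index \<open>k\<close> coincide, whence
  the factor 2 in \<open>pow_sum\<close>; the exponents of the single expansions add up.\<close>

lemma quotient_gf_expansion:
  assumes A: "A > 0"
  obtains R where "quotient_gf M A 0 \<theta> = exp (\<i> * of_real (\<theta> * pow_sum 1 M A) - of_real (\<theta>\<^sup>2 * pow_sum 2 M A / 2) + R)"
    "norm R \<le> \<bar>\<theta>\<bar> ^ 3 * pow_sum 3 M A"
proof -
  define x where "x k = exp (- (real k * A))" for k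
  have x: "0 < x k" "x k < 1" if "k \<in> {1..M}" for k using that A by (auto simp: x_def)
  have "\<forall>k\<in>{1..M}. \<exists>R. psi (x k) (real k * \<theta>) = exp (of_real (real k * \<theta>) * \<i> * (x k / (1 - x k))
      - of_real ((real k * \<theta>)\<^sup>2 * (x k / (1 - x k)\<^sup>2) / 2) + R) \<and>
      norm R \<le> x k / (1 - x k) ^ 3 * \<bar>real k * \<theta>\<bar> ^ 3"
    using psi_expansion[OF x] by (metis (no_types, lifting))
  then obtain r where r: "\<And>k. k \<in> {1..M} \<Longrightarrow> psi (x k) (real k * \<theta>) = exp (of_real (real k * \<theta>) * \<i> * (x k / (1 - x k))
      - of_real ((real k * \<theta>)\<^sup>2 * (x k / (1 - x k)\<^sup>2) / 2) + r k)"
      "\<And>k. k \<in> {1..M} \<Longrightarrow> norm (r k) \<le> x k / (1 - x k) ^ 3 * \<bar>real k * \<theta>\<bar> ^ 3"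
    using bchoice[of "{1..M}"] by metis
  define R where "R = (\<Sum>k=1..M. 2 * r k)"
  have "quotient_gf M A 0 \<theta> = (\<Prod>k=1..M. exp (\<i> * of_real (\<theta> * (2 * real k ^ 1 * x k / (1 - x k) ^ 1))
      - of_real (\<theta>\<^sup>2 * (2 * real k ^ 2 * x k / (1 - x k) ^ 2) / 2) + 2 * r k))"
    unfolding quotient_gf_def
  proof (rule prod.cong)
    fix k assume k: "k \<in> {1..M}"
    have "psi (x k) (real k * \<theta>) * psi (x k) (real k * \<theta>) = exp (2 * (of_real (real k * \<theta>) * \<i> * (x k / (1 - x k))
      - of_real ((real k * \<theta>)\<^sup>2 * (x k / (1 - x k)\<^sup>2) / 2) + r k))"
      unfolding r(1)[OF k] by (simp only: mult_exp_exp mult_2)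
    also have "2 * (of_real (real k * \<theta>) * \<i> * (x k / (1 - x k))
      - of_real ((real k * \<theta>)\<^sup>2 * (x k / (1 - x k)\<^sup>2) / 2) + r k) =
       \<i> * of_real (\<theta> * (2 * real k ^ 1 * x k / (1 - x k) ^ 1))
      - of_real (\<theta>\<^sup>2 * (2 * real k ^ 2 * x k / (1 - x k) ^ 2) / 2) + 2 * r k"
      by (simp add: power_mult_distrib algebra_simps)
    finally show "psi (exp (- (real k * A))) (real k * \<theta> + 0) * psi (exp (- (real k * A))) (real k * \<theta> - 0) =
        exp (\<i> * of_real (\<theta> * (2 * real k ^ 1 * x k / (1 - x k) ^ 1))
      - of_real (\<theta>\<^sup>2 * (2 * real k ^ 2 * x k / (1 - x k) ^ 2) / 2) + 2 * r k)"
      by (simp add: x_def)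
  qed simp
  also have "\<dots> = exp (\<Sum>k=1..M. \<i> * of_real (\<theta> * (2 * real k ^ 1 * x k / (1 - x k) ^ 1))
      - of_real (\<theta>\<^sup>2 * (2 * real k ^ 2 * x k / (1 - x k) ^ 2) / 2) + 2 * r k)"
    by (rule exp_sum[symmetric]) simp
  also have "(\<Sum>k=1..M. \<i> * of_real (\<theta> * (2 * real k ^ 1 * x k / (1 - x k) ^ 1))
      - of_real (\<theta>\<^sup>2 * (2 * real k ^ 2 * x k / (1 - x k) ^ 2) / 2) + 2 * r k) =
      \<i> * of_real (\<theta> * pow_sum 1 M A) - of_real (\<theta>\<^sup>2 * pow_sum 2 M A / 2) + R"
    unfolding pow_sum_def x_def[symmetric] R_def sum.distrib sum_subtractf
    by (simp only: sum_distrib_left[symmetric] of_real_sum[symmetric] sum_divide_distrib[symmetric])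
  finally have main: "quotient_gf M A 0 \<theta> = exp (\<i> * of_real (\<theta> * pow_sum 1 M A) - of_real (\<theta>\<^sup>2 * pow_sum 2 M A / 2) + R)" .
  have "norm R \<le> (\<Sum>k=1..M. \<bar>\<theta>\<bar> ^ 3 * (2 * real k ^ 3 * x k / (1 - x k) ^ 3))"
    unfolding R_def
  proof (rule order_trans[OF norm_sum sum_mono])
    fix k assume k: "k \<in> {1..M}"
    show "norm (2 * r k) \<le> \<bar>\<theta>\<bar> ^ 3 * (2 * real k ^ 3 * x k / (1 - x k) ^ 3)"
      using mult_left_mono[OF r(2)[OF k], of 2] by (simp add: norm_mult abs_mult power_mult_distrib mult_ac)
  qed
  also have "\<dots> = \<bar>\<theta>\<bar> ^ 3 * pow_sum 3 M A" unfolding pow_sum_def x_def by (rule sum_distrib_left[symmetric])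
  finally show thesis using that main by blast
qed

section \<open>Hermite polynomials\<close>

text \<open>The three-term recurrence in the normalisation \<open>exp (- t\<^sup>2 + X * t)\<close>:
  monic polynomials, equal to the physicists' Hermite polynomials at \<open>x / 2\<close>.\<close>

fun herm :: "nat \<Rightarrow> real \<Rightarrow> real" where
  "herm 0 x = 1"
| "herm (Suc 0) x = x"
| "herm (Suc (Suc n)) x = x * herm (Suc n) x - 2 * real (Suc n) * herm n x"

lemma herm_Suc: "herm (Suc n) x = x * herm n x - 2 * real n * herm (n - 1) x"
  by (cases n) auto

text \<open>The Appell property: differentiating the recurrence and inserting the claim for the two
  smaller indices reproduces the recurrence.\<close>

lemma has_derivative_herm:
  "(herm n has_real_derivative real n * herm (n - 1) x) (at x within S)"
proof (induction n arbitrary: x rule: less_induct)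
  case (less n)
  consider "n = 0" | "n = 1" | m where "n = Suc (Suc m)" by (metis One_nat_def old.nat.exhaust)
  then show ?case
  proof cases
    case 1
    have "herm 0 = (\<lambda>x. 1)" by (simp add: fun_eq_iff)
    then show ?thesis using 1 by simp
  next
    case 2
    have "herm (Suc 0) = (\<lambda>x. x)" by (simp add: fun_eq_iff)
    then show ?thesis using 2 by simp
  next
    case (3 m)
    have "herm n = (\<lambda>x. x * herm (Suc m) x - 2 * real (Suc m) * herm m x)"
      by (simp add: fun_eq_iff 3)
    moreover have "((\<lambda>x. x * herm (Suc m) x - 2 * real (Suc m) * herm m x) has_real_derivative
        (herm (Suc m) x + x * (real (Suc m) * herm m x)) - 2 * real (Suc m) * (real m * herm (m - 1) x)) (at x within S)"
      using less[of "Suc m" x] less[of m x] 3 by (auto intro!: derivative_eq_intros)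
    moreover have "(herm (Suc m) x + x * (real (Suc m) * herm m x)) - 2 * real (Suc m) * (real m * herm (m - 1) x)
        = real n * herm (n - 1) x"
      unfolding 3 by (simp add: herm_Suc[of m] algebra_simps)
    ultimately show ?thesis by simp
  qed
qed

text \<open>A derivative in \<open>t\<close> multiplies by \<open>X - 2 * t\<close> and adds the
  derivative of the polynomial factor; by the Appell property this is one step of the recurrence at
  the point \<open>X - 2 * t\<close>.\<close>

lemma hermite_eq_herm: "hermite d X = herm d X"
proof -
  have "(deriv ^^ d) (\<lambda>t. exp (- (t ^ 2) + X * t)) = (\<lambda>t. herm d (X - 2 * t) * exp (- (t ^ 2) + X * t))"
  proof (induction d)
    case (Suc d)
    have "deriv (\<lambda>t. herm d (X - 2 * t) * exp (- (t ^ 2) + X * t)) t =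
        herm (Suc d) (X - 2 * t) * exp (- (t ^ 2) + X * t)" for t
    proof (rule DERIV_imp_deriv)
      have 1: "((\<lambda>t. herm d (X - 2 * t)) has_real_derivative real d * herm (d - 1) (X - 2 * t) * (-2)) (at t)"
        by (rule DERIV_chain'[OF _ has_derivative_herm]) (auto intro!: derivative_eq_intros)
      show "((\<lambda>t. herm d (X - 2 * t) * exp (- (t ^ 2) + X * t)) has_real_derivative
          herm (Suc d) (X - 2 * t) * exp (- (t ^ 2) + X * t)) (at t)"
        by (rule derivative_eq_intros 1 refl)+ (simp add: herm_Suc algebra_simps)
    qed
    then show ?case unfolding funpow.simps o_apply Suc.IH by (rule ext)
  qed simp
  then show ?thesis by (simp add: hermite_def)
qed

text \<open>In the induction step both sides have the same derivative and the same value at 0. The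
  coefficients \<open>herm (d - i) 0\<close> are what the Gaussian moments supply.\<close>

lemma herm_expansion: "herm d X = (\<Sum>i\<le>d. real (d choose i) * X ^ i * herm (d - i) 0)"
proof (induction d arbitrary: X)
  case (Suc d)
  define g where "g X = (\<Sum>i\<le>Suc d. real (Suc d choose i) * X ^ i * herm (Suc d - i) 0)" for X
  have dg: "(g has_real_derivative real (Suc d) * herm d x) (at x)" for x
  proof -
    have "(g has_real_derivative (\<Sum>i\<le>Suc d. real (Suc d choose i) * (real i * x ^ (i - 1)) * herm (Suc d - i) 0)) (at x)"
      unfolding g_def by (intro DERIV_sum) (auto intro!: derivative_eq_intros)
    moreover have "(\<Sum>i\<le>Suc d. real (Suc d choose i) * (real i * x ^ (i - 1)) * herm (Suc d - i) 0)
        = (\<Sum>i\<le>d. real (Suc d choose Suc i) * (real (Suc i) * x ^ i) * herm (d - i) 0)"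
      by (subst sum.atMost_Suc_shift) simp
    also have "\<dots> = (\<Sum>i\<le>d. real (Suc d) * (real (d choose i) * x ^ i * herm (d - i) 0))"
    proof (rule sum.cong)
      fix i
      have "real (Suc i) * real (Suc d choose Suc i) = real (Suc d) * real (d choose i)"
        by (metis Suc_times_binomial of_nat_mult)
      then show "real (Suc d choose Suc i) * (real (Suc i) * x ^ i) * herm (d - i) 0 =
          real (Suc d) * (real (d choose i) * x ^ i * herm (d - i) 0)"
        by (metis (no_types, opaque_lifting) mult.assoc mult.commute)
    qed simp
    also have "\<dots> = real (Suc d) * herm d x" by (simp only: Suc.IH[of x] sum_distrib_left)
    finally show ?thesis using \<open>(g has_real_derivative _) (at x)\<close> by simp
  qed
  have "((\<lambda>x. herm (Suc d) x - g x) has_real_derivative 0) (at x)" for x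
    using DERIV_diff[OF has_derivative_herm[of "Suc d" x UNIV] dg[of x]] by simp
  then have "herm (Suc d) X - g X = herm (Suc d) 0 - g 0"
    using DERIV_isconst_all by (metis (no_types, lifting))
  moreover have "g 0 = herm (Suc d) 0"
    unfolding g_def by (subst sum.atMost_Suc_shift) simp
  ultimately show ?case by (simp add: g_def)
qed simp

lemma herm_even_0: "herm (2 * k) 0 = (-1) ^ k * fact (2 * k) / fact k"
proof (induction k)
  case (Suc k)
  have "herm (2 * Suc k) 0 = - 2 * real (Suc (2 * k)) * herm (2 * k) 0" by (simp add: algebra_simps)
  also have "\<dots> = - 2 * real (Suc (2 * k)) * ((-1) ^ k * fact (2 * k) / fact k)" by (simp only: Suc.IH)
  also have "\<dots> = (-1) ^ Suc k * fact (2 * Suc k) / fact (Suc k)"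
    by (simp add: field_simps del: of_nat_Suc) (simp add: algebra_simps)
  finally show ?case .
qed simp

lemma herm_odd_0: "herm (2 * k + 1) 0 = 0"
  by (induction k) auto

text \<open>The normal moment \<open>fact (2 * k) / (2 ^ k * fact k)\<close> times (i sqrt 2)^(2k) =
  (-2)^k is \<open>herm (2 * k) 0\<close>; odd moments and odd values at 0 vanish. The factor
  \<open>sqrt (2 * pi)\<close>, from the unnormalised density, cancels later in a quotient.\<close>

lemma gaussian_herm_moment:
  "has_bochner_integral lborel (\<lambda>u. of_real (exp (- (u\<^sup>2 / 2))) * (\<i> * of_real (sqrt 2 * u)) ^ D)
     (of_real (sqrt (2 * pi) * herm D 0) :: complex)"
proof -
  have dens: "exp (- (u\<^sup>2 / 2)) = sqrt (2 * pi) * std_normal_density u" for u :: real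
    by (simp add: std_normal_density_def)
  have "has_bochner_integral lborel (\<lambda>u. std_normal_density u * u ^ D)
      (if even D then fact D / (2 ^ (D div 2) * fact (D div 2)) else 0)"
  proof (cases "even D")
    case True
    then obtain k where "D = 2 * k" by (elim evenE)
    then show ?thesis using std_normal_moment_even[of k] by simp
  next
    case False
    then obtain k where "D = 2 * k + 1" by (elim oddE)
    then show ?thesis using std_normal_moment_odd[of k] by simp
  qed
  from has_bochner_integral_mult_right[OF has_bochner_integral_of_real[OF this], of "of_real (sqrt (2 * pi)) * (\<i> * of_real (sqrt 2)) ^ D"]
  have "has_bochner_integral lborel (\<lambda>u. of_real (sqrt (2 * pi)) * (\<i> * of_real (sqrt 2)) ^ D * of_real (std_normal_density u * u ^ D))
     (of_real (sqrt (2 * pi)) * (\<i> * of_real (sqrt 2)) ^ D * of_real (if even D then fact D / (2 ^ (D div 2) * fact (D div 2)) else 0) :: complex)"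
    by simp
  moreover have "of_real (sqrt (2 * pi)) * (\<i> * of_real (sqrt 2)) ^ D * of_real (std_normal_density u * u ^ D)
      = of_real (exp (- (u\<^sup>2 / 2))) * (\<i> * of_real (sqrt 2 * u)) ^ D" for u
    unfolding dens by (simp add: power_mult_distrib)
  moreover have "of_real (sqrt (2 * pi)) * (\<i> * of_real (sqrt 2)) ^ D * of_real (if even D then fact D / (2 ^ (D div 2) * fact (D div 2)) else 0)
      = (of_real (sqrt (2 * pi) * herm D 0) :: complex)"
  proof (cases "even D")
    case True
    then obtain k where k: "D = 2 * k" by (elim evenE)
    have "(\<i> * of_real (sqrt 2)) ^ D = (of_real ((-2) ^ k) :: complex)"
    proof -
      have "(\<i> * complex_of_real (sqrt 2))\<^sup>2 = -2"
        by (simp add: power_mult_distrib flip: of_real_power)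
      then show ?thesis unfolding k power_mult by simp
    qed
    note m1 = this
    have m2: "(-2) ^ k * (fact (2 * k) / (2 ^ k * fact k)) = herm (2 * k) 0"
      unfolding herm_even_0 by (simp add: field_simps flip: power_mult_distrib)
    have e: "(if even D then fact D / (2 ^ (D div 2) * fact (D div 2)) else 0) = fact (2 * k) / (2 ^ k * fact k)"
      by (simp add: k)
    show ?thesis unfolding e m1 unfolding k m2[symmetric] by (simp only: of_real_mult mult.assoc)
  next
    case False
    then obtain k where "D = 2 * k + 1" by (elim oddE)
    then show ?thesis using False herm_odd_0[of k] by simp
  qed
  ultimately show ?thesis by simp
qed

section \<open>Sign alternation and hyperbolicity\<close>

lemma herm_minus: "herm n (-x) = (-1) ^ n * herm n x"
  by (induction n x rule: herm.induct) (simp_all add: algebra_simps)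

lemma tendsto_herm_gaussian_at_top:
  "((\<lambda>x. herm n x * exp (- (x\<^sup>2 / 4))) \<longlongrightarrow> 0) at_top"
proof -
  have base: "((\<lambda>x::real. x ^ k * exp (- (x\<^sup>2 / 4))) \<longlongrightarrow> 0) at_top" for k
  proof (rule Lim_null_comparison)
    show "\<forall>\<^sub>F x::real in at_top. norm (x ^ k * exp (- (x\<^sup>2 / 4))) \<le> x ^ k / exp x"
      using eventually_ge_at_top[of 4]
    proof eventually_elim
      case (elim x)
      have "x * 4 \<le> x * x" using elim by (intro mult_left_mono) auto
      then have "exp (- (x\<^sup>2 / 4)) \<le> exp (- x)" by (simp add: power2_eq_square)
      then have "x ^ k * exp (- (x\<^sup>2 / 4)) \<le> x ^ k * exp (- x)" using elim by (intro mult_left_mono) auto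
      then show ?case using elim by (simp add: exp_minus inverse_eq_divide)
    qed
    show "((\<lambda>x::real. x ^ k / exp x) \<longlongrightarrow> 0) at_top" by (rule tendsto_power_div_exp_0)
  qed
  have "((\<lambda>x. \<Sum>i\<le>n. real (n choose i) * herm (n - i) 0 * (x ^ i * exp (- (x\<^sup>2 / 4)))) \<longlongrightarrow>
      (\<Sum>i\<le>n. real (n choose i) * herm (n - i) 0 * 0)) at_top"
    by (intro tendsto_sum tendsto_mult_left base)
  moreover have "(\<Sum>i\<le>n. real (n choose i) * herm (n - i) 0 * (x ^ i * exp (- (x\<^sup>2 / 4)))) = herm n x * exp (- (x\<^sup>2 / 4))" for x
    by (subst herm_expansion[of n x]) (simp add: sum_distrib_left sum_distrib_right mult_ac)
  ultimately show ?thesis by simp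
qed

lemma herm_gaussian_small:
  assumes "e > 0"
  obtains b where "b > c" "\<bar>herm n b * exp (- (b\<^sup>2 / 4))\<bar> < e"
proof -
  have "\<forall>\<^sub>F x in at_top. \<bar>herm n x * exp (- (x\<^sup>2 / 4))\<bar> < e"
    using tendstoD[OF tendsto_herm_gaussian_at_top[of n] assms] by (simp add: dist_real_def)
  then have "\<forall>\<^sub>F x in at_top. \<bar>herm n x * exp (- (x\<^sup>2 / 4))\<bar> < e \<and> x > c"
    using eventually_gt_at_top[of c] by eventually_elim simp
  then obtain b where "\<bar>herm n b * exp (- (b\<^sup>2 / 4))\<bar> < e \<and> b > c"
    using eventually_happens' trivial_limit_at_top_linorder by blast
  then show thesis using that by blast
qed

text \<open>The function \<open>w = herm d x * exp (- x\<^sup>2 / 4)\<close> satisfies \<open>w' = - herm (d + 1) x * exp (- x\<^sup>2 / 4) / 2\<close>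
  and vanishes at infinity, so the mean value theorem between consecutive alternation points of
  \<open>w\<close>, and to the left and right of all of them, gives one alternation point more.\<close>

lemma herm_alternates:
  "\<exists>p :: nat \<Rightarrow> real. (\<forall>i<d. p i < p (Suc i)) \<and> (\<forall>i\<le>d. (-1) ^ (d + i) * herm d (p i) > 0)"
proof (induction d)
  case 0
  then show ?case by simp
next
  case (Suc d)
  then obtain p where p: "\<And>i. i < d \<Longrightarrow> p i < p (Suc i)" "\<And>i. i \<le> d \<Longrightarrow> (-1) ^ (d + i) * herm d (p i) > 0" by auto
  define w where "w x = herm d x * exp (- (x\<^sup>2 / 4))" for x
  have dw: "(w has_real_derivative - (herm (Suc d) x * exp (- (x\<^sup>2 / 4)) / 2)) (at x)" for x
  proof -
    have "((\<lambda>x. exp (- (x\<^sup>2 / 4))) has_real_derivative exp (- (x\<^sup>2 / 4)) * (- (x / 2))) (at x)"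
      by (auto intro!: derivative_eq_intros)
    from DERIV_mult[OF has_derivative_herm[of d] this] show ?thesis
      unfolding w_def by (rule DERIV_cong) (simp add: herm_Suc field_simps)
  qed
  have wp: "(-1) ^ (d + i) * w (p i) > 0" if "i \<le> d" for i
    using p(2)[OF that] mult_pos_pos[of "(-1) ^ (d + i) * herm d (p i)" "exp (- ((p i)\<^sup>2 / 4))"]
    by (simp add: w_def mult.assoc)
  have wm: "\<bar>w (- x)\<bar> = \<bar>w x\<bar>" for x by (simp add: w_def herm_minus abs_mult power_abs)
  \<comment> \<open>Wanted are ends \<open>a < b\<close> with \<open>(-1) ^ (d + i) * w\<close>
    larger at \<open>b\<close>. Between consecutive points the signs provide this; beyond the
    extreme points the other end is taken so far out that \<open>w\<close> is smaller there in
    modulus.\<close>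
  have ab: "\<exists>a b. a < b \<and> (i = 0 \<or> a = p (i - 1)) \<and> (i = Suc d \<or> b = p i) \<and>
      (-1) ^ (d + i) * w a < (-1) ^ (d + i) * w b" if i: "i \<le> Suc d" for i
  proof -
    consider "i = 0" | "i = Suc d" | "1 \<le> i" "i \<le> d" using i by linarith
    then show ?thesis
    proof cases
      case 1
      \<comment> \<open>Decay is known towards plus infinity; the parity of \<open>herm d\<close>
        carries it to the point \<open>- b\<close> on the left.\<close>
      obtain b where b: "b > - p 0" "\<bar>w b\<bar> < (-1) ^ d * w (p 0)"
        using herm_gaussian_small[of "(-1) ^ d * w (p 0)" "- p 0" d] wp[of 0] unfolding w_def by auto
      have "(-1) ^ d * w (- b) \<le> \<bar>(-1) ^ d * w (- b)\<bar>" by simp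
      also have "\<dots> = \<bar>w b\<bar>" by (simp add: abs_mult power_abs wm)
      finally have "(-1) ^ d * w (- b) < (-1) ^ d * w (p 0)" using b by linarith
      then show ?thesis using 1 b by (intro exI[of _ "- b"] exI[of _ "p 0"]) auto
    next
      case 2
      have "w (p d) > 0" using wp[of d] by (simp add: power_add flip: power_mult_distrib)
      then obtain b where b: "b > p d" "\<bar>w b\<bar> < w (p d)"
        using herm_gaussian_small[of "w (p d)" "p d" d] unfolding w_def by auto
      have "(-1 :: real) ^ (d + Suc d) = -1" by (simp add: power_add flip: power_mult_distrib)
      then show ?thesis using 2 b by (intro exI[of _ "p d"] exI[of _ b]) auto
    next
      case 3
      then obtain k where k: "i = Suc k" by (cases i) auto
      have "(-1) ^ (d + k) * w (p k) > 0" "(-1) ^ (d + i) * w (p i) > 0" using wp[of k] wp[of i] 3 k by auto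
      then have "(-1) ^ (d + i) * w (p k) < (-1) ^ (d + i) * w (p i)" by (simp add: k)
      then show ?thesis using 3 k p(1)[of k] by (intro exI[of _ "p k"] exI[of _ "p i"]) auto
    qed
  qed
  have "\<exists>y. (i = 0 \<or> p (i - 1) < y) \<and> (i = Suc d \<or> y < p i) \<and> (-1) ^ (Suc d + i) * herm (Suc d) y > 0"
    if i: "i \<le> Suc d" for i
  proof -
    from ab[OF i] obtain a b where ab: "a < b" "i = 0 \<or> a = p (i - 1)" "i = Suc d \<or> b = p i"
      "(-1) ^ (d + i) * w a < (-1) ^ (d + i) * w b" by blast
    obtain z where z: "a < z" "z < b" "w b - w a = (b - a) * - (herm (Suc d) z * exp (- (z\<^sup>2 / 4)) / 2)"
      using MVT2[OF ab(1) dw] by blast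
    \<comment> \<open>The derivative of \<open>w\<close> carries a minus sign, which turns
      \<open>(-1) ^ (d + i)\<close> into \<open>(-1) ^ (Suc d + i)\<close>.\<close>
    have "0 < (-1) ^ (d + i) * (w b - w a)" using ab(4) by (simp add: right_diff_distrib)
    also have "\<dots> = ((-1) ^ (Suc d + i) * herm (Suc d) z) * ((b - a) * exp (- (z\<^sup>2 / 4)) / 2)"
      unfolding z(3) by simp
    finally have "(-1) ^ (Suc d + i) * herm (Suc d) z > 0"
      using ab(1) by (subst (asm) zero_less_mult_iff) (auto simp: mult_less_0_iff)
    then show ?thesis using z ab by (intro exI[of _ z]) auto
  qed
  then obtain q where q: "\<And>i. i \<le> Suc d \<Longrightarrow> (i = 0 \<or> p (i - 1) < q i) \<and> (i = Suc d \<or> q i < p i) \<and>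
      (-1) ^ (Suc d + i) * herm (Suc d) (q i) > 0" by metis
  have "q i < q (Suc i)" if "i < Suc d" for i
    using q[of i] q[of "Suc i"] that by fastforce
  then show ?case using q by blast
qed

text \<open>The \<open>d + 1\<close> points of alternating sign enclose \<open>d\<close> distinct
  real zeros. The polynomial is nonzero of degree at most \<open>d\<close>, so there are no further
  complex ones.\<close>

lemma hyperbolic_jensenI:
  assumes p: "\<And>i. i < d \<Longrightarrow> p i < p (Suc i)"
    and s: "\<And>i. i \<le> d \<Longrightarrow> (-1) ^ (d + i) * jensen d n \<alpha> (p i :: real) > 0"
  shows "hyperbolic_jensen d n \<alpha>"
proof -
  define P where "P = (\<Sum>k\<le>d. monom (real (d choose k) * \<alpha> (n + k)) k)"
  define Q where "Q = (\<Sum>k\<le>d. monom (complex_of_real (real (d choose k) * \<alpha> (n + k))) k)"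
  have P: "poly P x = jensen d n \<alpha> x" for x
    by (simp add: P_def jensen_def poly_sum poly_monom)
  have Q: "poly Q z = jensen d n \<alpha> z" for z
    by (simp add: Q_def jensen_def poly_sum poly_monom)
  have QP: "poly Q (of_real x) = of_real (poly P x)" for x
    unfolding P Q jensen_def by simp
  have degQ: "degree Q \<le> d" unfolding Q_def
    by (intro degree_sum_le) (auto intro: order_trans[OF degree_monom_le])
  have Q0: "Q \<noteq> 0"
  proof
    assume "Q = 0"
    then have "poly P (p 0) = 0" using QP[of "p 0"] by simp
    then show False using s[of 0] by (simp add: P)
  qed
  have "\<exists>z. p i < z \<and> z < p (Suc i) \<and> poly P z = 0" if "i < d" for i
  proof -
    have "(-1) ^ (d + i) * poly P (p i) > 0" "(-1) ^ (d + Suc i) * poly P (p (Suc i)) > 0"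
      using s[of i] s[of "Suc i"] that by (auto simp: P)
    then have "poly P (p i) * poly P (p (Suc i)) < 0"
      by (cases "even (d + i)") (auto simp: mult_less_0_iff)
    then show ?thesis using poly_IVT[OF p[OF that], of P] by auto
  qed
  then obtain z where z: "\<And>i. i < d \<Longrightarrow> p i < z i \<and> z i < p (Suc i) \<and> poly P (z i) = 0" by metis
  have pm: "p i \<le> p k" if "i \<le> k" "k \<le> d" for i k
    using that
  proof (induction k)
    case (Suc k)
    then show ?case using p[of k] by (cases "i = Suc k") auto
  qed simp
  have zm: "z i < z k" if "i < k" "k < d" for i k
    using z[of i] z[of k] pm[of "Suc i" k] that by fastforce
  have inj: "inj_on z {..<d}"
    by (rule linorder_inj_onI') (use zm in fastforce)
  define R where "R = complex_of_real ` z ` {..<d}"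
  have "card R = card (z ` {..<d})" unfolding R_def by (intro card_image) (simp add: inj_on_def)
  also have "\<dots> = d" by (subst card_image[OF inj]) simp
  finally have "card R = d" .
  moreover have "R \<subseteq> {x. poly Q x = 0}" using z by (auto simp: R_def QP)
  moreover have "card {x. poly Q x = 0} \<le> d" using card_poly_roots_bound[OF Q0] degQ by simp
  ultimately have "R = {x. poly Q x = 0}"
    using poly_roots_finite[OF Q0] by (intro card_subset_eq) (auto dest: card_mono[rotated] intro: antisym)
  then have "x \<in> R" if "poly Q x = 0" for x
    using that by blast
  moreover have "R \<subseteq> \<real>" by (auto simp: R_def)
  ultimately have "x \<in> \<real>" if "poly Q x = 0" for x
    using that by blast
  then show ?thesis unfolding hyperbolic_jensen_def Q[symmetric] by blast
qed

section \<open>The local limit theorem\<close>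

lemma bip_gf_eq_quotient_gf:
  assumes "A > 0"
  shows "bip_gf M \<phi> (of_real (exp (-A)) * cis \<theta>) = bip_gf M 0 (of_real (exp (-A))) * quotient_gf M A \<phi> \<theta>"
    and "bip_gf M 0 (of_real (exp (-A))) \<noteq> 0"
proof -
  have ek: "exp (-A) ^ k = exp (- (real k * A))" for k
    by (simp add: exp_of_nat_mult[symmetric])
  have pw: "(complex_of_real (exp (-A)) * cis \<theta>) ^ k = of_real (exp (- (real k * A))) * cis (real k * \<theta>)" for k
    unfolding power_mult_distrib Complex.DeMoivre ek[symmetric] by simp
  have pw0: "complex_of_real (exp (-A)) ^ k = of_real (exp (- (real k * A)))" for k
    unfolding ek[symmetric] by simp
  have lt: "exp (- (real k * A)) < 1" if "k \<ge> 1" for k using that assms by simp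
  have ne: "1 - complex_of_real (exp (- (real k * A))) \<noteq> 0" if "k \<ge> 1" for k
    using lt[OF that] by (metis of_real_1 of_real_eq_iff less_irrefl right_minus_eq)
  show "bip_gf M 0 (of_real (exp (-A))) \<noteq> 0"
    unfolding bip_gf_def pw0 using ne by (auto simp: prod_zero_iff)
  show "bip_gf M \<phi> (of_real (exp (-A)) * cis \<theta>) = bip_gf M 0 (of_real (exp (-A))) * quotient_gf M A \<phi> \<theta>"
    unfolding bip_gf_def quotient_gf_def prod.distrib[symmetric] pw pw0
  proof (rule prod.cong)
    fix k assume k: "k \<in> {1..M}"
    let ?x = "complex_of_real (exp (- (real k * A)))"
    have c: "cis \<phi> * (?x * cis (real k * \<theta>)) = ?x * cis (real k * \<theta> + \<phi>)"
      "cis (-\<phi>) * (?x * cis (real k * \<theta>)) = ?x * cis (real k * \<theta> - \<phi>)"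
      by (simp_all add: cis_mult mult.left_commute add.commute)
    show "1 / ((1 - cis \<phi> * (?x * cis (real k * \<theta>))) * (1 - cis (- \<phi>) * (?x * cis (real k * \<theta>)))) =
      1 / ((1 - cis 0 * ?x) * (1 - cis (- 0) * ?x)) *
      (psi (exp (- (real k * A))) (real k * \<theta> + \<phi>) * psi (exp (- (real k * A))) (real k * \<theta> - \<phi>))"
      unfolding c psi_def using ne[of k] k by simp
  qed simp
qed

lemma continuous_on_quotient_gf:
  assumes "A > 0" shows "continuous_on S (quotient_gf M A \<phi>)"
proof -
  have ne: "1 - complex_of_real (exp (- (real k * A))) * cis x \<noteq> 0" if "k \<in> {1..M}" for k x
  proof
    assume "1 - complex_of_real (exp (- (real k * A))) * cis x = 0"
    then have "norm (complex_of_real (exp (- (real k * A))) * cis x) = 1" by simp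
    then show False using that assms by (simp add: norm_mult)
  qed
  show ?thesis unfolding quotient_gf_def psi_def
    by (intro continuous_intros) (use ne in auto)
qed

text \<open>If a pair of partitions with parts at most \<open>2 N\<close> has probability proportional to \<open>exp (- A n)\<close>, \<open>n\<close> its
  size, then the mean and the variance of \<open>n\<close> are \<open>pow_sum 1 (2 * N) A\<close> and
  \<open>pow_sum 2 (2 * N) A\<close>. The bound \<open>2 N\<close> on the parts does not affect the coefficients of \<open>q\<close> up to
  \<open>q ^ (2 N)\<close>.\<close>

definition saddle :: "nat \<Rightarrow> real" where
  "saddle N = (SOME A. 1 / (2 * real N) \<le> A \<and> A \<le> sqrt (864 / real N) \<and> pow_sum 1 (2 * N) A = real N)"

definition width :: "nat \<Rightarrow> real" where
  "width N = sqrt (pow_sum 2 (2 * N) (saddle N))"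

lemma saddle:
  assumes "N \<ge> 1"
  shows "1 / (2 * real N) \<le> saddle N" "saddle N \<le> sqrt (864 / real N)"
    "pow_sum 1 (2 * N) (saddle N) = real N" "saddle N > 0" "1 \<le> real (2 * N) * saddle N"
proof -
  have "\<exists>A. 1 / (2 * real N) \<le> A \<and> A \<le> sqrt (864 / real N) \<and> pow_sum 1 (2 * N) A = real N"
    using saddle_exists[OF assms] by metis
  from someI_ex[OF this, folded saddle_def]
  show *: "1 / (2 * real N) \<le> saddle N" "saddle N \<le> sqrt (864 / real N)"
    "pow_sum 1 (2 * N) (saddle N) = real N" by auto
  have "1 / (2 * real N) > 0" using assms by simp
  then show "saddle N > 0" using *(1) by linarith
  show "1 \<le> real (2 * N) * saddle N" using *(1) assms by (simp add: field_simps)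
qed

lemma saddle_tendsto_0: "saddle \<longlonglongrightarrow> 0"
proof (rule tendsto_sandwich)
  show "\<forall>\<^sub>F N in sequentially. 0 \<le> saddle N"
    using eventually_ge_at_top[of 1] by eventually_elim (use saddle(4) in \<open>auto intro: less_imp_le\<close>)
  show "\<forall>\<^sub>F N in sequentially. saddle N \<le> sqrt (864 / real N)"
    using eventually_ge_at_top[of 1] by eventually_elim (rule saddle(2))
  have "(\<lambda>N. sqrt (864 / real N)) \<longlonglongrightarrow> sqrt 0"
    by (intro tendsto_real_sqrt lim_const_over_n)
  then show "(\<lambda>N. sqrt (864 / real N)) \<longlonglongrightarrow> 0" by simp
qed simp

lemma width_bounds:
  assumes "N \<ge> 1" "saddle N \<le> 1"
  shows "1 / (3 * saddle N ^ 3) \<le> (width N)\<^sup>2" "(width N)\<^sup>2 \<le> 864 / saddle N ^ 3" "width N > 0"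
proof -
  note s = saddle[OF assms(1)]
  have lo: "1 / (3 * saddle N ^ 3) \<le> pow_sum 2 (2 * N) (saddle N)"
    using s assms by (intro pow_sum_2_ge) auto
  moreover have "1 / (3 * saddle N ^ 3) > 0" using s by simp
  ultimately have pos: "pow_sum 2 (2 * N) (saddle N) > 0" by linarith
  then have w: "(width N)\<^sup>2 = pow_sum 2 (2 * N) (saddle N)" unfolding width_def by simp
  show "width N > 0" using pos by (simp add: width_def)
  show "1 / (3 * saddle N ^ 3) \<le> (width N)\<^sup>2" using lo w by simp
  show "(width N)\<^sup>2 \<le> 864 / saddle N ^ 3"
    using pow_sum_le[of "saddle N" 2 "2 * N"] s unfolding w by (simp add: numeral_3_eq_3)
qed

lemma eventually_saddle_le:
  assumes "e > 0" shows "\<forall>\<^sub>F N in sequentially. N \<ge> 1 \<and> saddle N \<le> e"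
proof -
  have "\<forall>\<^sub>F N in sequentially. saddle N < e" using order_tendstoD(2)[OF saddle_tendsto_0 assms] .
  then show ?thesis using eventually_ge_at_top[of 1] by eventually_elim auto
qed

text \<open>The integrand of the Fourier integral for the coefficient of index \<open>N\<close>,
  divided by the value of the generating function at the saddle point. The summand
  \<open>s = 0\<close> carries the whole limit.\<close>

definition twist :: "nat \<Rightarrow> int \<Rightarrow> nat \<Rightarrow> real \<Rightarrow> complex" where
  "twist b a N \<theta> = (\<Sum>s<b. cis (- (2 * pi * real s * of_int a / real b)) *
      quotient_gf (2 * N) (saddle N) (2 * pi * real s / real b) \<theta>) * cis (- (real N * \<theta>))"

lemma continuous_on_twist: "N \<ge> 1 \<Longrightarrow> continuous_on S (twist b a N)"
  unfolding twist_def by (intro continuous_intros continuous_on_quotient_gf saddle(4))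

text \<open>It comes from the binomial expansion of \<open>(X * c + (1 - c) / \<delta>) ^ d\<close>
  with \<open>c = cis (- \<theta>)\<close> and \<open>1 / \<delta> = sqrt 2 * width N\<close>: the
  term with \<open>X ^ i\<close> carries \<open>c ^ i\<close> and the power \<open>D = d - i\<close>
  of the second summand.\<close>

definition saddle_kernel :: "nat \<Rightarrow> int \<Rightarrow> nat \<Rightarrow> nat \<Rightarrow> nat \<Rightarrow> real \<Rightarrow> complex" where
  "saddle_kernel b a D i N \<theta> = twist b a N \<theta> * cis (- (real i * \<theta>)) *
     ((1 - cis (- \<theta>)) * of_real (sqrt 2 * width N)) ^ D"

lemma continuous_on_saddle_kernel: "N \<ge> 1 \<Longrightarrow> continuous_on S (saddle_kernel b a D i N)"
  unfolding saddle_kernel_def by (intro continuous_intros continuous_on_twist)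

section \<open>Bounds and pointwise limit of the normalised integrand\<close>

lemma norm_one_minus_cis_le: "norm (1 - cis (-x)) \<le> \<bar>x\<bar>"
  using iexp_approx1[of "-x" 0] by (simp add: cis_conv_exp norm_minus_commute)

text \<open>A single term of the exponential series at \<open>c * x\<close> is at most the whole
  series.\<close>

lemma power_exp_bound:
  fixes c x :: real assumes "c > 0" "x \<ge> 0" shows "x ^ m * exp (- (c * x)) \<le> fact m / c ^ m"
proof -
  have "(c * x) ^ m / fact m \<le> exp (c * x)"
  proof -
    have "summable (\<lambda>n. (c * x) ^ n /\<^sub>R fact n)" by (rule summable_exp_generic)
    then have "sum (\<lambda>n. (c * x) ^ n /\<^sub>R fact n) {m} \<le> (\<Sum>n. (c * x) ^ n /\<^sub>R fact n)"
      by (rule sum_le_suminf) (use assms in auto)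
    then show ?thesis by (simp add: exp_def divide_inverse mult.commute)
  qed
  then have "c ^ m * x ^ m \<le> fact m * exp (c * x)" by (simp add: field_simps power_mult_distrib)
  then have "c ^ m * x ^ m * exp (- (c * x)) \<le> fact m * exp (c * x) * exp (- (c * x))"
    by (intro mult_right_mono) auto
  then have "c ^ m * x ^ m * exp (- (c * x)) \<le> fact m" by (simp add: mult.assoc exp_minus_inverse)
  then show ?thesis using assms by (simp add: field_simps)
qed

text \<open>For \<open>0 < s < b\<close> the angle is not a multiple of \<open>2 * pi\<close>, so
  the decay rate is positive; the finitely many \<open>s\<close> have a common one.\<close>

lemma twisted_terms_small:
  obtains c where "c > 0"
    "\<And>N s \<theta>. N \<ge> 1 \<Longrightarrow> saddle N \<le> 1 / 20 \<Longrightarrow> 0 < s \<Longrightarrow> s < b \<Longrightarrow>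
       norm (quotient_gf (2 * N) (saddle N) (2 * pi * real s / real b) \<theta>) \<le> exp (- (c / saddle N))"
proof -
  define g where "g s = min (2 - 2 * cos (2 * pi * real s / real b)) (7 / 8) / 32" for s
  have gpos: "g s > 0" if "0 < s" "s < b" for s
  proof -
    have "cos (2 * pi * real s / real b) \<noteq> 1"
    proof
      assume "cos (2 * pi * real s / real b) = 1"
      then obtain m :: int where m: "2 * pi * real s / real b = of_int m * 2 * pi"
        by (auto simp: cos_one_2pi_int)
      then have "real s = of_int m * real b" using that by (simp add: field_simps)
      then have "of_int (int s) = (of_int (m * int b) :: real)" by simp
      then have "int s = m * int b" by (simp only: of_int_eq_iff)
      then have "int b dvd int s" by simp
      then show False using that by (auto dest: dvd_imp_le)
    qed
    then have "cos (2 * pi * real s / real b) < 1" using cos_le_one[of "2 * pi * real s / real b"] by linarith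
    then show ?thesis by (simp add: g_def)
  qed
  \<comment> \<open>The inserted \<open>1\<close> keeps the set nonempty when
    \<open>b \<le> 1\<close>.\<close>
  define c where "c = Min (insert 1 (g ` {s. 0 < s \<and> s < b}))"
  have c: "c > 0" unfolding c_def using gpos by (subst Min_gr_iff) auto
  have cg: "c \<le> g s" if "0 < s" "s < b" for s
    unfolding c_def using that by (intro Min_le) auto
  have "norm (quotient_gf (2 * N) (saddle N) (2 * pi * real s / real b) \<theta>) \<le> exp (- (c / saddle N))"
    if N: "N \<ge> 1" "saddle N \<le> 1 / 20" and s: "0 < s" "s < b" for N s \<theta>
  proof -
    have "norm (quotient_gf (2 * N) (saddle N) (2 * pi * real s / real b) \<theta>) \<le> exp (- (g s / saddle N))"
      using norm_quotient_gf_twisted[of "saddle N" "2 * N" "2 * pi * real s / real b" \<theta>] saddle[OF N(1)] N(2)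
      by (simp add: g_def)
    also have "\<dots> \<le> exp (- (c / saddle N))" using cg[OF s] saddle(4)[OF N(1)] by (simp add: divide_right_mono)
    finally show ?thesis .
  qed
  then show thesis using that c by blast
qed

lemma twist_decompose:
  assumes "b > 0"
  shows "twist b a N \<theta> = quotient_gf (2 * N) (saddle N) 0 \<theta> * cis (- (real N * \<theta>)) +
    (\<Sum>s=1..<b. cis (- (2 * pi * real s * of_int a / real b)) *
      quotient_gf (2 * N) (saddle N) (2 * pi * real s / real b) \<theta>) * cis (- (real N * \<theta>))"
proof -
  have "{..<b} = insert 0 {1..<b}" using assms by auto
  then show ?thesis unfolding twist_def by (simp add: distrib_right)
qed

lemma norm_twisted_sum_le:
  assumes "\<And>s. 0 < s \<Longrightarrow> s < b \<Longrightarrow> norm (f s) \<le> e" "e \<ge> 0"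
  shows "norm ((\<Sum>s=1..<b. cis (g s) * f s) * cis h) \<le> real b * e"
proof -
  have "norm (\<Sum>s=1..<b. cis (g s) * f s) \<le> (\<Sum>s=1..<b. e)"
    using assms by (intro sum_norm_le) (auto simp: norm_mult)
  also have "\<dots> \<le> real b * e" using assms(2) by (simp add: mult_right_mono)
  finally show ?thesis by (simp add: norm_mult)
qed

text \<open>The Gaussian term covers \<open>\<bar>\<theta>\<bar> \<le> 2 * A\<close>. The remaining
  angles at \<open>s = 0\<close> account for one copy of the exponentially small term, the twisted
  summands for at most \<open>b\<close> copies.\<close>

lemma norm_twist_le:
  assumes "b > 0"
  obtains c where "c > 0"
    "\<And>N \<theta>. N \<ge> 1 \<Longrightarrow> saddle N \<le> 1 / 20 \<Longrightarrow> \<bar>\<theta>\<bar> \<le> pi \<Longrightarrow>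
       norm (twist b a N \<theta>) \<le> exp (- ((width N * \<theta>)\<^sup>2 / 20736)) + real (Suc b) * exp (- (c / saddle N))"
proof -
  obtain c0 where c0: "c0 > 0" "\<And>N s \<theta>. N \<ge> 1 \<Longrightarrow> saddle N \<le> 1 / 20 \<Longrightarrow> 0 < s \<Longrightarrow> s < b \<Longrightarrow>
       norm (quotient_gf (2 * N) (saddle N) (2 * pi * real s / real b) \<theta>) \<le> exp (- (c0 / saddle N))"
    using twisted_terms_small[of b] by blast
  define c where "c = min c0 (1 / 160)"
  have "norm (twist b a N \<theta>) \<le> exp (- ((width N * \<theta>)\<^sup>2 / 20736)) + real (Suc b) * exp (- (c / saddle N))"
    if N: "N \<ge> 1" "saddle N \<le> 1 / 20" and th: "\<bar>\<theta>\<bar> \<le> pi" for N \<theta>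
  proof -
    define A where "A = saddle N"
    have A: "0 < A" "A \<le> 1 / 20" "1 \<le> real (2 * N) * A" using saddle[OF N(1)] N(2) by (auto simp: A_def)
    have main: "norm (quotient_gf (2 * N) A 0 \<theta>) \<le> exp (- ((width N * \<theta>)\<^sup>2 / 20736)) + exp (- (c / A))"
    proof (cases "\<bar>\<theta>\<bar> \<le> 2 * A")
      case True
      have "norm (quotient_gf (2 * N) A 0 \<theta>) \<le> exp (- (\<theta>\<^sup>2 / (24 * A ^ 3)))"
        using A True by (intro norm_quotient_gf_major) auto
      also have "\<dots> \<le> exp (- ((width N * \<theta>)\<^sup>2 / 20736))"
      proof -
        \<comment> \<open>The constant is 20736 = 24 * 864: the rate \<open>1 / (24 * A ^ 3)\<close>
          against the upper bound \<open>864 / A ^ 3\<close> for the variance.\<close>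
        have "(width N)\<^sup>2 * \<theta>\<^sup>2 \<le> 864 / A ^ 3 * \<theta>\<^sup>2"
          using width_bounds(2)[OF N(1)] A unfolding A_def by (intro mult_right_mono) auto
        then show ?thesis by (simp add: power_mult_distrib)
      qed
      finally show ?thesis by (smt (verit) exp_gt_zero)
    next
      case False
      have "norm (quotient_gf (2 * N) A 0 \<theta>) \<le> exp (- (1 / (160 * A)))"
        using A False th by (intro norm_quotient_gf_minor) auto
      also have "\<dots> \<le> exp (- (c / A))"
      proof -
        have "c / A \<le> (1 / 160) / A" using A by (intro divide_right_mono) (auto simp: c_def)
        then show ?thesis by simp
      qed
      finally show ?thesis by (smt (verit) exp_gt_zero)
    qed
    have tw: "norm ((\<Sum>s=1..<b. cis (- (2 * pi * real s * of_int a / real b)) *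
      quotient_gf (2 * N) A (2 * pi * real s / real b) \<theta>) * cis (- (real N * \<theta>))) \<le> real b * exp (- (c / A))"
    proof (rule norm_twisted_sum_le)
      fix s assume s: "0 < s" "s < b"
      have "norm (quotient_gf (2 * N) A (2 * pi * real s / real b) \<theta>) \<le> exp (- (c0 / A))"
        using c0(2)[OF N s] by (simp add: A_def)
      also have "c / A \<le> c0 / A" using A by (intro divide_right_mono) (auto simp: c_def)
      then have "exp (- (c0 / A)) \<le> exp (- (c / A))" by simp
      finally show "norm (quotient_gf (2 * N) A (2 * pi * real s / real b) \<theta>) \<le> exp (- (c / A))" .
    qed simp
    have "norm (twist b a N \<theta>) \<le> norm (quotient_gf (2 * N) A 0 \<theta> * cis (- (real N * \<theta>))) + real b * exp (- (c / A))"
      unfolding twist_decompose[OF assms] A_def[symmetric]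
      by (rule order_trans[OF norm_triangle_ineq]) (use tw in simp)
    also have "norm (quotient_gf (2 * N) A 0 \<theta> * cis (- (real N * \<theta>))) = norm (quotient_gf (2 * N) A 0 \<theta>)"
      by (simp add: norm_mult)
    finally show ?thesis using main by (simp add: A_def algebra_simps)
  qed
  moreover have "c > 0" using c0 by (simp add: c_def)
  ultimately show thesis using that by blast
qed

text \<open>A central limit theorem. The mean is \<open>N\<close>, so the linear term cancels
  against the factor \<open>cis (- (real N * \<theta>))\<close>; the quadratic term is exactly
  \<open>- u\<^sup>2 / 2\<close>, as \<open>width\<close> is the standard deviation; and the cubic
  remainder is of order A^(-4) / width^3, hence of order sqrt A.\<close>

lemma twist_tendsto:
  assumes "b > 0"
  shows "(\<lambda>N. twist b a N (u / width N)) \<longlonglongrightarrow> of_real (exp (- (u\<^sup>2 / 2)))"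
proof -
  obtain c0 where c0: "c0 > 0" "\<And>N s \<theta>. N \<ge> 1 \<Longrightarrow> saddle N \<le> 1 / 20 \<Longrightarrow> 0 < s \<Longrightarrow> s < b \<Longrightarrow>
       norm (quotient_gf (2 * N) (saddle N) (2 * pi * real s / real b) \<theta>) \<le> exp (- (c0 / saddle N))"
    using twisted_terms_small[of b] by blast
  have "\<forall>N. \<exists>R. N \<ge> 1 \<longrightarrow> quotient_gf (2 * N) (saddle N) 0 (u / width N) =
      exp (\<i> * of_real (u / width N * pow_sum 1 (2 * N) (saddle N))
        - of_real ((u / width N)\<^sup>2 * pow_sum 2 (2 * N) (saddle N) / 2) + R) \<and>
      norm R \<le> \<bar>u / width N\<bar> ^ 3 * pow_sum 3 (2 * N) (saddle N)"
    using quotient_gf_expansion[OF saddle(4)] by metis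
  then obtain R where R: "\<And>N. N \<ge> 1 \<Longrightarrow> quotient_gf (2 * N) (saddle N) 0 (u / width N) =
      exp (\<i> * of_real (u / width N * pow_sum 1 (2 * N) (saddle N))
        - of_real ((u / width N)\<^sup>2 * pow_sum 2 (2 * N) (saddle N) / 2) + R N)"
      "\<And>N. N \<ge> 1 \<Longrightarrow> norm (R N) \<le> \<bar>u / width N\<bar> ^ 3 * pow_sum 3 (2 * N) (saddle N)" by metis
  note ev = eventually_saddle_le[of "1 / 20"]
  have Rbound: "\<forall>\<^sub>F N in sequentially. norm (R N) \<le> \<bar>u\<bar> ^ 3 * (864 * sqrt (27 * saddle N))"
    using ev[simplified]
  proof eventually_elim
    case (elim N)
    define A where "A = saddle N"
    have A: "A > 0" "A \<le> 1" using saddle(4)[of N] elim by (auto simp: A_def)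
    note w = width_bounds[of N, folded A_def]
    have w: "1 / (3 * A ^ 3) \<le> (width N)\<^sup>2" "width N > 0" using w elim A by auto
    \<comment> \<open>This is the cube of the lower bound for the variance; squaring both sides
      avoids fractional powers of \<open>A\<close>.\<close>
    have "1 / (width N ^ 3 * A ^ 4) \<le> sqrt (27 * A)"
    proof (rule real_le_rsqrt)
      have "(1 / (3 * A ^ 3)) ^ 3 \<le> ((width N)\<^sup>2) ^ 3" using w A by (intro power_mono) auto
      then have "1 / (27 * A ^ 9) \<le> width N ^ 6" using A
        by (simp add: power_divide power_mult_distrib flip: power_mult)
      then have "1 \<le> width N ^ 6 * (27 * A ^ 9)" using A by (simp add: field_simps)
      then have "1 / (width N ^ 6 * A ^ 8) \<le> width N ^ 6 * (27 * A ^ 9) / (width N ^ 6 * A ^ 8)"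
        using A w by (intro divide_right_mono) auto
      also have "\<dots> = 27 * A" using A w by (simp add: power_numeral_reduce)
      finally show "(1 / (width N ^ 3 * A ^ 4))\<^sup>2 \<le> 27 * A"
        by (simp add: power_divide power_mult_distrib flip: power_mult)
    qed
    moreover have "pow_sum 3 (2 * N) A \<le> 864 / A ^ 4" using pow_sum_le[of A 3 "2 * N"] A by simp
    then have "\<bar>u / width N\<bar> ^ 3 * pow_sum 3 (2 * N) A \<le> \<bar>u / width N\<bar> ^ 3 * (864 / A ^ 4)"
      by (intro mult_left_mono) auto
    moreover have "\<bar>u / width N\<bar> ^ 3 * (864 / A ^ 4) = \<bar>u\<bar> ^ 3 * (864 * (1 / (width N ^ 3 * A ^ 4)))"
      using w by (simp add: abs_divide power_divide)
    ultimately have "\<bar>u / width N\<bar> ^ 3 * pow_sum 3 (2 * N) A \<le> \<bar>u\<bar> ^ 3 * (864 * sqrt (27 * A))"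
      by (smt (verit) mult_left_mono zero_le_power abs_ge_zero)
    then show ?case using R(2)[of N] elim by (simp add: A_def)
  qed
  have "(\<lambda>N. \<bar>u\<bar> ^ 3 * (864 * sqrt (27 * saddle N))) \<longlonglongrightarrow> \<bar>u\<bar> ^ 3 * (864 * sqrt (27 * 0))"
    by (intro tendsto_intros saddle_tendsto_0)
  then have "R \<longlonglongrightarrow> 0" by (intro Lim_null_comparison[OF Rbound]) simp
  then have "(\<lambda>N. exp (- of_real (u\<^sup>2 / 2) + R N)) \<longlonglongrightarrow> exp (- of_real (u\<^sup>2 / 2) + 0)"
    by (intro tendsto_intros)
  then have lim1: "(\<lambda>N. exp (- of_real (u\<^sup>2 / 2) + R N)) \<longlonglongrightarrow> of_real (exp (- (u\<^sup>2 / 2)))"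
    by (simp add: exp_of_real[symmetric])
  have eq1: "\<forall>\<^sub>F N in sequentially. exp (- of_real (u\<^sup>2 / 2) + R N) =
      quotient_gf (2 * N) (saddle N) 0 (u / width N) * cis (- (real N * (u / width N)))"
    using ev[simplified]
  proof eventually_elim
    case (elim N)
    have w: "width N > 0" using width_bounds(3)[of N] elim by simp
    have "(u / width N)\<^sup>2 * pow_sum 2 (2 * N) (saddle N) = u\<^sup>2"
    proof -
      have "pow_sum 2 (2 * N) (saddle N) = (width N)\<^sup>2"
        using saddle(4)[of N] elim by (simp add: width_def pow_sum_nonneg)
      then show ?thesis using w by (simp add: power_divide)
    qed
    then have "quotient_gf (2 * N) (saddle N) 0 (u / width N) =
        exp (\<i> * of_real (real N * (u / width N)) - of_real (u\<^sup>2 / 2) + R N)"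
      using R(1)[of N] saddle(3)[of N] elim by (simp add: mult.commute)
    then show ?case by (simp add: cis_conv_exp mult_exp_exp)
  qed
  have lim1': "(\<lambda>N. quotient_gf (2 * N) (saddle N) 0 (u / width N) * cis (- (real N * (u / width N))))
     \<longlonglongrightarrow> of_real (exp (- (u\<^sup>2 / 2)))"
    using Lim_transform_eventually[OF lim1 eq1] .
  define T where "T N = (\<Sum>s=1..<b. cis (- (2 * pi * real s * of_int a / real b)) *
      quotient_gf (2 * N) (saddle N) (2 * pi * real s / real b) (u / width N)) * cis (- (real N * (u / width N)))" for N
  have Tb: "norm (T N) \<le> real b * (saddle N / c0)" if N: "N \<ge> 1" "saddle N \<le> 1 / 20" for N
  proof -
    have A: "saddle N > 0" using saddle(4) N by blast
    have e: "exp (- (c0 / saddle N)) \<le> saddle N / c0"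
    proof -
      have "1 / saddle N * exp (- (c0 * (1 / saddle N))) \<le> 1 / c0"
        using power_exp_bound[of c0 "1 / saddle N" 1] A c0(1) by simp
      then have "saddle N * (1 / saddle N * exp (- (c0 * (1 / saddle N)))) \<le> saddle N * (1 / c0)"
        using A by (intro mult_left_mono) auto
      then show ?thesis using A by simp
    qed
    have "norm (quotient_gf (2 * N) (saddle N) (2 * pi * real s / real b) (u / width N)) \<le> saddle N / c0"
      if "0 < s" "s < b" for s
      using c0(2)[OF N that, of "u / width N"] e by linarith
    then show ?thesis unfolding T_def using c0(1) A by (intro norm_twisted_sum_le) auto
  qed
  have Tev: "\<forall>\<^sub>F N in sequentially. norm (T N) \<le> real b * (saddle N / c0)"
    using eventually_saddle_le[of "1 / 20", simplified] by eventually_elim (use Tb in auto)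
  have "(\<lambda>N. real b * (saddle N / c0)) \<longlonglongrightarrow> 0"
    by (intro tendsto_mult_right_zero tendsto_divide_zero saddle_tendsto_0)
  with Tev have lim2: "T \<longlonglongrightarrow> 0" by (rule Lim_null_comparison)
  show ?thesis using tendsto_add[OF lim1' lim2] unfolding twist_decompose[OF assms] T_def by simp
qed

lemma inverse_width_tendsto_0: "(\<lambda>N. 1 / width N) \<longlonglongrightarrow> 0"
proof (rule Lim_null_comparison)
  show "\<forall>\<^sub>F N in sequentially. norm (1 / width N) \<le> sqrt (3 * saddle N ^ 3)"
    using eventually_saddle_le[of 1, OF zero_less_one]
  proof eventually_elim
    case (elim N)
    note w = width_bounds[of N]
    have A: "saddle N > 0" using saddle(4) elim by blast
    have "(1 / width N)\<^sup>2 \<le> 3 * saddle N ^ 3"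
      using w elim A by (simp add: power_divide field_simps)
    then have "1 / width N \<le> sqrt (3 * saddle N ^ 3)" by (rule real_le_rsqrt)
    then show ?case using w(3) elim by simp
  qed
  have "(\<lambda>N. sqrt (3 * saddle N ^ 3)) \<longlonglongrightarrow> sqrt (3 * 0 ^ 3)"
    by (intro tendsto_intros saddle_tendsto_0)
  then show "(\<lambda>N. sqrt (3 * saddle N ^ 3)) \<longlonglongrightarrow> 0" by simp
qed

section \<open>Dominated convergence on the scale of the standard deviation\<close>

definition scaled_kernel :: "nat \<Rightarrow> int \<Rightarrow> nat \<Rightarrow> nat \<Rightarrow> nat \<Rightarrow> real \<Rightarrow> complex" where
  "scaled_kernel b a D i N u = indicator {-pi..pi} (u / width N) *\<^sub>R saddle_kernel b a D i N (u / width N)"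

text \<open>To first order \<open>1 - cis (- x)\<close> is \<open>\<i> * x\<close>, and the factor
  \<open>sqrt 2 * width N\<close> undoes the scaling \<open>x = u / width N\<close>. For fixed
  \<open>u\<close> the cut-off at \<open>pi\<close> is eventually inactive.\<close>

lemma scaled_kernel_tendsto:
  assumes "b > 0"
  shows "(\<lambda>N. scaled_kernel b a D i N u) \<longlonglongrightarrow> of_real (exp (- (u\<^sup>2 / 2))) * (\<i> * of_real (sqrt 2 * u)) ^ D"
proof -
  note ev = eventually_saddle_le[of 1, OF zero_less_one]
  note inv = inverse_width_tendsto_0
  have th: "(\<lambda>N. u / width N) \<longlonglongrightarrow> 0"
    using tendsto_mult_right_zero[OF inv, of u] by simp
  have l1: "(\<lambda>N. cis (- (real i * (u / width N)))) \<longlonglongrightarrow> cis (- (real i * 0))"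
    by (intro tendsto_cis tendsto_intros th)
  have l2: "(\<lambda>N. (1 - cis (- (u / width N))) * of_real (sqrt 2 * width N)) \<longlonglongrightarrow> \<i> * of_real (sqrt 2 * u)"
  proof (rule LIM_zero_cancel, rule Lim_null_comparison)
    show "\<forall>\<^sub>F N in sequentially. norm ((1 - cis (- (u / width N))) * of_real (sqrt 2 * width N) - \<i> * of_real (sqrt 2 * u))
        \<le> sqrt 2 * u\<^sup>2 * (1 / width N)"
      using ev
    proof eventually_elim
      case (elim N)
      have w: "width N > 0" using width_bounds(3)[of N] elim by simp
      define x where "x = - (u / width N)"
      have "norm (cis x - (1 + \<i> * of_real x)) \<le> \<bar>x\<bar>\<^sup>2 / 2"
        using iexp_approx1[of x 1] by (simp add: cis_conv_exp numeral_2_eq_2)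
      moreover have "(1 - cis x) * of_real (sqrt 2 * width N) - \<i> * of_real (sqrt 2 * u)
          = - ((cis x - (1 + \<i> * of_real x)) * of_real (sqrt 2 * width N))"
        using w by (simp add: x_def field_simps)
      ultimately have "norm ((1 - cis x) * of_real (sqrt 2 * width N) - \<i> * of_real (sqrt 2 * u))
          \<le> \<bar>x\<bar>\<^sup>2 / 2 * (sqrt 2 * width N)"
        using w by (simp add: norm_mult mult_right_mono)
      also have "\<dots> \<le> \<bar>x\<bar>\<^sup>2 * (sqrt 2 * width N)" using w by (intro mult_right_mono) auto
      also have "\<dots> = sqrt 2 * u\<^sup>2 * (1 / width N)" using w by (simp add: x_def power_divide power2_eq_square)
      finally show ?case by (simp add: x_def)
    qed
    show "(\<lambda>N. sqrt 2 * u\<^sup>2 * (1 / width N)) \<longlonglongrightarrow> 0" by (rule tendsto_mult_right_zero[OF inv])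
  qed
  have "(\<lambda>N. saddle_kernel b a D i N (u / width N)) \<longlonglongrightarrow>
      of_real (exp (- (u\<^sup>2 / 2))) * cis (- (real i * 0)) * (\<i> * of_real (sqrt 2 * u)) ^ D"
    unfolding saddle_kernel_def by (intro tendsto_mult twist_tendsto[OF assms] l1 tendsto_power l2)
  then have lim: "(\<lambda>N. saddle_kernel b a D i N (u / width N)) \<longlonglongrightarrow>
      of_real (exp (- (u\<^sup>2 / 2))) * (\<i> * of_real (sqrt 2 * u)) ^ D" by simp
  have "\<forall>\<^sub>F N in sequentially. \<bar>u / width N\<bar> < pi"
    using tendstoD[OF th, of pi] by (simp add: dist_real_def)
  then have "\<forall>\<^sub>F N in sequentially. saddle_kernel b a D i N (u / width N) = scaled_kernel b a D i N u"
  proof eventually_elim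
    case (elim N)
    then have "u / width N \<in> {-pi..pi}" unfolding abs_less_iff by simp
    then show ?case by (simp add: scaled_kernel_def)
  qed
  from Lim_transform_eventually[OF lim this] show ?thesis .
qed

text \<open>The Gaussian term outweighs every power of \<open>u\<close>. The term
  \<open>exp (- c / A)\<close> is constant in \<open>u\<close>, but inside the cut-off
  \<open>u\<^sup>2\<close> is at most a multiple of A^(-3), so this term outweighs every power of
  \<open>u\<close> as well.\<close>

lemma scaled_kernel_dominated:
  assumes "b > 0"
  obtains B where "\<And>N u. N \<ge> 1 \<Longrightarrow> saddle N \<le> 1 / 20 \<Longrightarrow> norm (scaled_kernel b a D i N u) \<le> B * inverse (1 + u\<^sup>2)"
proof -
  obtain c where c: "c > 0"
    "\<And>N \<theta>. N \<ge> 1 \<Longrightarrow> saddle N \<le> 1 / 20 \<Longrightarrow> \<bar>\<theta>\<bar> \<le> pi \<Longrightarrow>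
       norm (twist b a N \<theta>) \<le> exp (- ((width N * \<theta>)\<^sup>2 / 20736)) + real (Suc b) * exp (- (c / saddle N))"
    using norm_twist_le[OF assms] by blast
  \<comment> \<open>One power of \<open>Y\<close> more than the kernel needs; it provides the
    integrable factor \<open>1 / (1 + u\<^sup>2)\<close>.\<close>
  define m where "m = Suc D"
  \<comment> \<open>Half of 1 / 20736, since \<open>Y = 1 + 2 * u\<^sup>2\<close>.\<close>
  define \<kappa> where "\<kappa> = (1 / 41472 :: real)"
  define B1 where "B1 = exp \<kappa> * (fact m / \<kappa> ^ m)"
  \<comment> \<open>27649 = 1 + 2 * 16 * 864: the cut-off gives
    \<open>u\<^sup>2 \<le> 16 * (width N)\<^sup>2\<close>, with 4 in place of \<open>pi\<close>, and
    the variance is at most \<open>864 / A ^ 3\<close>.\<close>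
  define B2 where "B2 = 27649 ^ m * (fact (3 * m) / c ^ (3 * m))"
  define B where "B = B1 + real (Suc b) * B2"
  have "norm (scaled_kernel b a D i N u) \<le> B * inverse (1 + u\<^sup>2)" if N: "N \<ge> 1" "saddle N \<le> 1 / 20" for N u
  proof (cases "\<bar>u / width N\<bar> \<le> pi")
    case False
    then have "scaled_kernel b a D i N u = 0" by (auto simp: scaled_kernel_def indicator_def abs_le_iff)
    moreover have "B \<ge> 0" using c by (simp add: B_def B1_def B2_def \<kappa>_def)
    ultimately show ?thesis by simp
  next
    case True
    define A where "A = saddle N"
    have A: "0 < A" "A \<le> 1" using saddle(4)[OF N(1)] N by (auto simp: A_def)
    have w: "width N > 0" "(width N)\<^sup>2 \<le> 864 / A ^ 3" using width_bounds[OF N(1)] A by (auto simp: A_def)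
    define Y where "Y = 1 + 2 * u\<^sup>2"
    have Y: "Y \<ge> 1" by (simp add: Y_def)
    have "norm (saddle_kernel b a D i N (u / width N)) =
        norm (twist b a N (u / width N)) * (norm (1 - cis (- (u / width N))) * (sqrt 2 * width N)) ^ D"
      using w by (simp add: saddle_kernel_def norm_mult norm_power)
    also have "\<dots> \<le> (exp (- (u\<^sup>2 / 20736)) + real (Suc b) * exp (- (c / A))) * Y ^ D"
    proof (rule mult_mono)
      show "norm (twist b a N (u / width N)) \<le> exp (- (u\<^sup>2 / 20736)) + real (Suc b) * exp (- (c / A))"
        using c(2)[OF N True] w by (simp add: A_def)
      have "norm (1 - cis (- (u / width N))) * (sqrt 2 * width N) \<le> \<bar>u / width N\<bar> * (sqrt 2 * width N)"
        using w by (intro mult_right_mono norm_one_minus_cis_le) auto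
      also have "\<dots> = sqrt 2 * \<bar>u\<bar>" using w by (simp add: abs_divide)
      also have "\<dots> \<le> Y"
      proof (rule power2_le_imp_le)
        have "1 * Y \<le> Y * Y" using Y by (intro mult_right_mono) auto
        moreover have "(sqrt 2 * \<bar>u\<bar>)\<^sup>2 = 2 * u\<^sup>2" by (simp add: power_mult_distrib)
        ultimately show "(sqrt 2 * \<bar>u\<bar>)\<^sup>2 \<le> Y\<^sup>2" unfolding power2_eq_square[of Y] by (simp add: Y_def)
      qed (use Y in simp)
      finally show "(norm (1 - cis (- (u / width N))) * (sqrt 2 * width N)) ^ D \<le> Y ^ D"
        using w by (intro power_mono) auto
    qed (use w in auto)
    finally have K: "norm (saddle_kernel b a D i N (u / width N)) \<le> (exp (- (u\<^sup>2 / 20736)) + real (Suc b) * exp (- (c / A))) * Y ^ D" .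
    have e1: "exp (- (u\<^sup>2 / 20736)) * Y ^ m \<le> B1"
    proof -
      have "exp (- (u\<^sup>2 / 20736)) = exp \<kappa> * exp (- (\<kappa> * Y))"
        unfolding mult_exp_exp by (simp add: \<kappa>_def Y_def field_simps)
      then have "exp (- (u\<^sup>2 / 20736)) * Y ^ m = exp \<kappa> * (Y ^ m * exp (- (\<kappa> * Y)))" by simp
      also have "\<dots> \<le> B1" unfolding B1_def
        by (intro mult_left_mono power_exp_bound) (use Y in \<open>auto simp: \<kappa>_def\<close>)
      finally show ?thesis .
    qed
    have e2: "exp (- (c / A)) * Y ^ m \<le> B2"
    proof -
      have "(u / width N)\<^sup>2 \<le> 4\<^sup>2" using True pi_less_4 by (intro abs_le_square_iff[THEN iffD1]) auto
      then have "u\<^sup>2 \<le> 16 * (width N)\<^sup>2" using w by (simp add: power_divide divide_le_eq)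
      then have "u\<^sup>2 \<le> 16 * (864 / A ^ 3)" using w by linarith
      moreover have "1 \<le> 1 / A ^ 3" using A by (simp add: power_le_one)
      ultimately have "Y \<le> 27649 * (1 / A ^ 3)" unfolding Y_def by simp
      then have "Y ^ m \<le> (27649 * (1 / A ^ 3)) ^ m" using Y by (intro power_mono) auto
      also have "\<dots> = 27649 ^ m * (1 / A) ^ (3 * m)"
        by (simp only: power_mult_distrib power_mult power_one_over)
      finally have "exp (- (c / A)) * Y ^ m \<le> exp (- (c / A)) * (27649 ^ m * (1 / A) ^ (3 * m))"
        by (intro mult_left_mono) auto
      also have "\<dots> = 27649 ^ m * ((1 / A) ^ (3 * m) * exp (- (c * (1 / A))))" by simp
      also have "\<dots> \<le> B2" unfolding B2_def
        by (intro mult_left_mono power_exp_bound) (use c A in auto)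
      finally show ?thesis .
    qed
    have "norm (saddle_kernel b a D i N (u / width N)) * Y \<le> (exp (- (u\<^sup>2 / 20736)) + real (Suc b) * exp (- (c / A))) * Y ^ D * Y"
      using K Y by (intro mult_right_mono) auto
    also have "\<dots> = exp (- (u\<^sup>2 / 20736)) * Y ^ m + real (Suc b) * (exp (- (c / A)) * Y ^ m)"
      by (simp add: m_def algebra_simps)
    also have "\<dots> \<le> B" unfolding B_def by (intro add_mono mult_left_mono e1 e2) auto
    finally have "norm (saddle_kernel b a D i N (u / width N)) * Y \<le> B" .
    moreover have "norm (saddle_kernel b a D i N (u / width N)) * (1 + u\<^sup>2) \<le> norm (saddle_kernel b a D i N (u / width N)) * Y"
      by (intro mult_left_mono) (auto simp: Y_def)
    ultimately have "norm (saddle_kernel b a D i N (u / width N)) * (1 + u\<^sup>2) \<le> B" by linarith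
    moreover have "1 + u\<^sup>2 > 0" by (simp add: add_pos_nonneg)
    ultimately have "norm (saddle_kernel b a D i N (u / width N)) \<le> B * inverse (1 + u\<^sup>2)"
      by (simp add: pos_le_divide_eq divide_inverse[symmetric])
    moreover have "norm (scaled_kernel b a D i N u) \<le> norm (saddle_kernel b a D i N (u / width N))"
      by (simp add: scaled_kernel_def indicator_def)
    ultimately show ?thesis by linarith
  qed
  then show thesis using that by blast
qed

lemma integral_scaled_kernel_tendsto:
  assumes "b > 0"
  shows "(\<lambda>N. integral\<^sup>L lborel (scaled_kernel b a D i N)) \<longlonglongrightarrow> of_real (sqrt (2 * pi) * herm D 0)"
proof -
  obtain B where B: "\<And>N u. N \<ge> 1 \<Longrightarrow> saddle N \<le> 1 / 20 \<Longrightarrow> norm (scaled_kernel b a D i N u) \<le> B * inverse (1 + u\<^sup>2)"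
    using scaled_kernel_dominated[OF assms] by blast
  \<comment> \<open>The majorant is available for large \<open>N\<close>, so dominated convergence
    is applied to the shifted sequence.\<close>
  obtain N0 where N0: "\<And>N. N \<ge> N0 \<Longrightarrow> N \<ge> 1 \<and> saddle N \<le> 1 / 20"
    using eventually_saddle_le[of "1 / 20"] by (auto simp: eventually_sequentially)
  define f where "f u = of_real (exp (- (u\<^sup>2 / 2))) * (\<i> * of_real (sqrt 2 * u)) ^ D" for u :: real
  have "(\<lambda>k. integral\<^sup>L lborel (scaled_kernel b a D i (k + N0))) \<longlonglongrightarrow> integral\<^sup>L lborel f"
  proof (rule integral_dominated_convergence)
    show "f \<in> borel_measurable lborel" unfolding f_def by measurable
    show "scaled_kernel b a D i (k + N0) \<in> borel_measurable lborel" for k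
    proof -
      have [measurable]: "saddle_kernel b a D i (k + N0) \<in> borel_measurable borel"
        using N0[of "k + N0"] by (intro borel_measurable_continuous_onI continuous_on_saddle_kernel) auto
      show ?thesis unfolding scaled_kernel_def by measurable
    qed
    have "integrable lborel (\<lambda>u::real. inverse (1 + u\<^sup>2))"
      using integrable_inverse_1_plus_square by (simp add: set_integrable_def)
    then show "integrable lborel (\<lambda>u. B * inverse (1 + u\<^sup>2))" by (rule integrable_mult_right)
    show "AE u in lborel. (\<lambda>k. scaled_kernel b a D i (k + N0) u) \<longlonglongrightarrow> f u"
      unfolding f_def by (intro AE_I2 LIMSEQ_ignore_initial_segment scaled_kernel_tendsto assms)
    show "AE u in lborel. norm (scaled_kernel b a D i (k + N0) u) \<le> B * inverse (1 + u\<^sup>2)" for k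
      using N0[of "k + N0"] by (intro AE_I2 B) auto
  qed
  moreover have "integral\<^sup>L lborel f = of_real (sqrt (2 * pi) * herm D 0)"
    unfolding f_def by (rule has_bochner_integral_integral_eq[OF gaussian_herm_moment])
  ultimately have "(\<lambda>k. integral\<^sup>L lborel (scaled_kernel b a D i (k + N0))) \<longlonglongrightarrow> of_real (sqrt (2 * pi) * herm D 0)"
    by simp
  then show ?thesis by (rule LIMSEQ_offset)
qed

lemma integral_scaled_kernel:
  assumes "N \<ge> 1" "saddle N \<le> 1"
  shows "integral\<^sup>L lborel (scaled_kernel b a D i N) = of_real (width N) * integral {-pi..pi} (saddle_kernel b a D i N)"
proof -
  have w: "width N > 0" using width_bounds(3)[OF assms] .
  define g where "g x = indicator {-pi..pi} x *\<^sub>R saddle_kernel b a D i N x" for x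
  have "integral\<^sup>L lborel g = \<bar>1 / width N\<bar> *\<^sub>R integral\<^sup>L lborel (\<lambda>u. g (0 + 1 / width N * u))"
    using w by (intro lborel_integral_real_affine) auto
  also have "(\<lambda>u. g (0 + 1 / width N * u)) = scaled_kernel b a D i N"
    by (simp add: g_def scaled_kernel_def fun_eq_iff)
  finally have "integral\<^sup>L lborel (scaled_kernel b a D i N) = of_real (width N) * integral\<^sup>L lborel g"
    using w by (simp add: scaleR_conv_of_real)
  also have "integral\<^sup>L lborel g = integral {-pi..pi} (saddle_kernel b a D i N)"
    using set_borel_integral_eq_integral(2)[OF borel_integrable_atLeastAtMost'[OF continuous_on_saddle_kernel[OF assms(1)]]]
    unfolding set_lebesgue_integral_def g_def .
  finally show ?thesis .
qed

text \<open>The condition \<open>k \<le> N\<close> keeps \<open>N + k\<close> within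
  \<open>2 * N\<close>, up to which the truncated product has the right coefficients.\<close>

lemma has_integral_twist:
  assumes "b > 0" "0 \<le> a" "a < int b" "N \<ge> 1" "k \<le> N"
  shows "((\<lambda>\<theta>. twist b a N \<theta> * cis (- (real k * \<theta>))) has_integral
     (2 * pi * real b * real (bip a (int b) (N + k)) * exp (- saddle N) ^ (N + k) /
        bip_gf (2 * N) 0 (of_real (exp (- saddle N))))) {-pi..pi}"
proof -
  let ?Z = "bip_gf (2 * N) 0 (of_real (exp (- saddle N)))"
  have A: "saddle N > 0" using saddle(4)[OF assms(4)] .
  have Z: "?Z \<noteq> 0" using bip_gf_eq_quotient_gf(2)[OF A] .
  have "((\<lambda>\<theta>. (\<Sum>s<b. cis (- (2 * pi * real s * of_int a / real b)) *
             bip_gf (2 * N) (2 * pi * real s / real b) (of_real (exp (- saddle N)) * cis \<theta>)) * cis (- (real (N + k) * \<theta>)))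
           has_integral (2 * pi * real b * real (bip a (int b) (N + k)) * exp (- saddle N) ^ (N + k))) {-pi..pi}"
    using assms A by (intro has_integral_bip) auto
  moreover have "(\<Sum>s<b. cis (- (2 * pi * real s * of_int a / real b)) *
             bip_gf (2 * N) (2 * pi * real s / real b) (of_real (exp (- saddle N)) * cis \<theta>)) * cis (- (real (N + k) * \<theta>))
      = ?Z * (twist b a N \<theta> * cis (- (real k * \<theta>)))" for \<theta>
  proof -
    have "cis (- (real (N + k) * \<theta>)) = cis (- (real N * \<theta>)) * cis (- (real k * \<theta>))"
      by (simp add: cis_mult algebra_simps)
    then show ?thesis
      unfolding bip_gf_eq_quotient_gf(1)[OF A] twist_def by (simp add: sum_distrib_left mult_ac)
  qed
  ultimately have "((\<lambda>\<theta>. ?Z * (twist b a N \<theta> * cis (- (real k * \<theta>)))) has_integral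
      (2 * pi * real b * real (bip a (int b) (N + k)) * exp (- saddle N) ^ (N + k))) {-pi..pi}" by simp
  from has_integral_mult_right[OF this, of "1 / ?Z"] show ?thesis using Z by simp
qed

section \<open>Jensen polynomials\<close>

text \<open>By the binomial theorem under the integral, the coefficient of \<open>X ^ i\<close> is
  an integral of one kernel. The value of the generating function, the power of the radius and the
  Jacobian \<open>width N\<close> are common to all terms and cancel in the quotient by
  \<open>\<alpha> N\<close>, itself the kernel integral with \<open>D = i = 0\<close>.\<close>

lemma jensen_hat_bip:
  fixes a :: int and b N d :: nat
  assumes b: "b > 0" "0 \<le> a" "a < int b" and N: "N \<ge> 1" "d \<le> N" "saddle N \<le> 1"
  defines "L \<equiv> \<lambda>D i. integral\<^sup>L lborel (scaled_kernel b a D i N)"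
  shows "jensen_hat d N (\<lambda>n. real (bip a (int b) n)) saddle (\<lambda>n. 1 / (sqrt 2 * width n)) X
      = (\<Sum>i\<le>d. (real (d choose i) * Re (L (d - i) i / L 0 0)) * X ^ i)"
proof -
  define \<alpha> where "\<alpha> n = real (bip a (int b) n)" for n
  define \<delta> where "\<delta> = 1 / (sqrt 2 * width N)"
  define A where "A = saddle N"
  have w: "width N > 0" using width_bounds(3)[OF N(1,3)] .
  have \<delta>: "\<delta> > 0" using w by (simp add: \<delta>_def)
  define I where "I k = integral {-pi..pi} (\<lambda>\<theta>. twist b a N \<theta> * cis (- (real k * \<theta>)))" for k
  define J where "J D i = integral {-pi..pi} (saddle_kernel b a D i N)" for D i
  define C where "C = bip_gf (2 * N) 0 (of_real (exp (- A))) / (2 * pi * real b * of_real (exp (- A) ^ N))"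
  have C0: "C \<noteq> 0" using bip_gf_eq_quotient_gf(2)[OF saddle(4)[OF N(1)]] b by (simp add: C_def A_def)
  have hasI: "((\<lambda>\<theta>. twist b a N \<theta> * cis (- (real k * \<theta>))) has_integral I k) {-pi..pi}" if "k \<le> d" for k
    unfolding I_def using has_integral_twist[OF b N(1), of k] that N(2) by (intro integrable_integral) auto
  have hasJ: "(saddle_kernel b a D i N has_integral J D i) {-pi..pi}" for D i
    unfolding J_def by (intro integrable_integral integrable_continuous_real continuous_on_saddle_kernel N(1))
  have \<alpha>I: "complex_of_real (\<alpha> (N + k) * exp (- A) ^ k) = C * I k" if "k \<le> d" for k
  proof -
    have "I k = 2 * pi * real b * \<alpha> (N + k) * exp (- A) ^ (N + k) / bip_gf (2 * N) 0 (of_real (exp (- A)))"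
      using has_integral_twist[OF b N(1), of k] that N(2) hasI[OF that] has_integral_unique
      by (auto simp: \<alpha>_def A_def)
    then show ?thesis using b bip_gf_eq_quotient_gf(2)[OF saddle(4)[OF N(1)], of "2 * N"]
      by (simp add: C_def A_def power_add)
  qed
  have sums: "(\<Sum>k\<le>d. inverse (of_real \<delta> ^ d) * of_nat (d choose k) * of_real ((\<delta> * X - 1) ^ k) * I k)
      = (\<Sum>i\<le>d. of_nat (d choose i) * of_real (X ^ i) * J (d - i) i)"
  proof (rule has_integral_unique)
    show "((\<lambda>\<theta>. \<Sum>k\<le>d. inverse (of_real \<delta> ^ d) * of_nat (d choose k) * of_real ((\<delta> * X - 1) ^ k) *
          (twist b a N \<theta> * cis (- (real k * \<theta>)))) has_integral
        (\<Sum>k\<le>d. inverse (of_real \<delta> ^ d) * of_nat (d choose k) * of_real ((\<delta> * X - 1) ^ k) * I k)) {-pi..pi}"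
      by (intro has_integral_sum has_integral_mult_right hasI) auto
    have "((\<lambda>\<theta>. \<Sum>i\<le>d. of_nat (d choose i) * of_real (X ^ i) * saddle_kernel b a (d - i) i N \<theta>) has_integral
        (\<Sum>i\<le>d. of_nat (d choose i) * of_real (X ^ i) * J (d - i) i)) {-pi..pi}"
      by (intro has_integral_sum has_integral_mult_right hasJ) auto
    moreover have "(\<Sum>i\<le>d. of_nat (d choose i) * of_real (X ^ i) * saddle_kernel b a (d - i) i N \<theta>) =
        (\<Sum>k\<le>d. inverse (of_real \<delta> ^ d) * of_nat (d choose k) * of_real ((\<delta> * X - 1) ^ k) *
          (twist b a N \<theta> * cis (- (real k * \<theta>))))" for \<theta>
    proof -
      define c where "c = cis (- \<theta>)"
      have ck: "cis (- (real k * \<theta>)) = c ^ k" for k by (simp add: c_def Complex.DeMoivre)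
      have "(\<Sum>k\<le>d. inverse (of_real \<delta> ^ d) * of_nat (d choose k) * of_real ((\<delta> * X - 1) ^ k) *
          (twist b a N \<theta> * cis (- (real k * \<theta>)))) =
          twist b a N \<theta> * (inverse (of_real \<delta> ^ d) * (\<Sum>k\<le>d. of_nat (d choose k) * (of_real (\<delta> * X - 1) * c) ^ k * 1 ^ (d - k)))"
        unfolding ck by (simp add: sum_distrib_left power_mult_distrib mult_ac)
      also have "(\<Sum>k\<le>d. of_nat (d choose k) * (of_real (\<delta> * X - 1) * c) ^ k * 1 ^ (d - k)) =
          (of_real (\<delta> * X - 1) * c + 1) ^ d" by (rule binomial_ring[symmetric])
      also have "inverse (of_real \<delta> ^ d) * (of_real (\<delta> * X - 1) * c + 1) ^ d =
          ((of_real (\<delta> * X - 1) * c + 1) / of_real \<delta>) ^ d"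
        unfolding divide_inverse power_mult_distrib power_inverse by (rule mult.commute)
      \<comment> \<open>The constant \<open>-1\<close> in \<open>\<delta> * X - 1\<close> pairs with
        the binomial \<open>1\<close> to form \<open>1 - c\<close>, which is of order
        \<open>\<delta>\<close> on the relevant scale; so the division by \<open>\<delta>\<close>
        has a limit.\<close>
      also have "(of_real (\<delta> * X - 1) * c + 1) / of_real \<delta> = of_real X * c + (1 - c) * of_real (sqrt 2 * width N)"
      proof -
        have "complex_of_real (sqrt 2 * width N) = 1 / of_real \<delta>" using w by (simp add: \<delta>_def)
        then show ?thesis using \<delta> by (simp add: field_simps)
      qed
      also have "(of_real X * c + (1 - c) * of_real (sqrt 2 * width N)) ^ d =
          (\<Sum>i\<le>d. of_nat (d choose i) * (of_real X * c) ^ i * ((1 - c) * of_real (sqrt 2 * width N)) ^ (d - i))"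
        by (rule binomial_ring)
      also have "twist b a N \<theta> * \<dots> = (\<Sum>i\<le>d. of_nat (d choose i) * of_real (X ^ i) * saddle_kernel b a (d - i) i N \<theta>)"
        unfolding saddle_kernel_def ck c_def[symmetric]
        by (simp add: sum_distrib_left power_mult_distrib mult_ac)
      finally show ?thesis ..
    qed
    ultimately show "((\<lambda>\<theta>. \<Sum>k\<le>d. inverse (of_real \<delta> ^ d) * of_nat (d choose k) * of_real ((\<delta> * X - 1) ^ k) *
          (twist b a N \<theta> * cis (- (real k * \<theta>)))) has_integral
        (\<Sum>i\<le>d. of_nat (d choose i) * of_real (X ^ i) * J (d - i) i)) {-pi..pi}" by simp
  qed
  have "complex_of_real (jensen_hat d N \<alpha> saddle (\<lambda>n. 1 / (sqrt 2 * width n)) X) =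
      inverse (of_real \<delta> ^ d) / of_real (\<alpha> N) * (\<Sum>k\<le>d. of_nat (d choose k) * of_real ((\<delta> * X - 1) ^ k) * of_real (\<alpha> (N + k) * exp (- A) ^ k))"
    unfolding jensen_hat_def jensen_def \<delta>_def[symmetric] A_def[symmetric]
    by (simp add: power_divide exp_minus power_inverse power_mult_distrib divide_inverse mult_ac)
  also have "(\<Sum>k\<le>d. of_nat (d choose k) * of_real ((\<delta> * X - 1) ^ k) * of_real (\<alpha> (N + k) * exp (- A) ^ k)) =
      (\<Sum>k\<le>d. of_nat (d choose k) * of_real ((\<delta> * X - 1) ^ k) * (C * I k))"
    by (intro sum.cong refl) (simp only: \<alpha>I atMost_iff)
  also have "complex_of_real (\<alpha> N) = C * I 0" using \<alpha>I[of 0] by simp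
  also have "(\<Sum>k\<le>d. of_nat (d choose k) * of_real ((\<delta> * X - 1) ^ k) * (C * I k)) =
      C * (\<Sum>k\<le>d. of_nat (d choose k) * of_real ((\<delta> * X - 1) ^ k) * I k)"
    unfolding sum_distrib_left by (intro sum.cong refl) (simp only: mult_ac)
  also have "inverse (of_real \<delta> ^ d) / (C * I 0) * (C * (\<Sum>k\<le>d. of_nat (d choose k) * of_real ((\<delta> * X - 1) ^ k) * I k)) =
      inverse (of_real \<delta> ^ d) * (\<Sum>k\<le>d. of_nat (d choose k) * of_real ((\<delta> * X - 1) ^ k) * I k) / I 0"
    using C0 by simp
  also have "inverse (of_real \<delta> ^ d) * (\<Sum>k\<le>d. of_nat (d choose k) * of_real ((\<delta> * X - 1) ^ k) * I k) =
     (\<Sum>k\<le>d. inverse (of_real \<delta> ^ d) * of_nat (d choose k) * of_real ((\<delta> * X - 1) ^ k) * I k)"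
    unfolding sum_distrib_left by (intro sum.cong refl) (simp only: mult.assoc)
  also note sums
  also have "I 0 = J 0 0" by (simp add: I_def J_def saddle_kernel_def[abs_def])
  also have "(\<Sum>i\<le>d. of_nat (d choose i) * of_real (X ^ i) * J (d - i) i) / J 0 0 =
      (\<Sum>i\<le>d. of_real (real (d choose i) * X ^ i) * (L (d - i) i / L 0 0))"
    unfolding L_def integral_scaled_kernel[OF N(1,3)] J_def[symmetric] using w
    by (simp add: sum_divide_distrib)
  finally have "jensen_hat d N \<alpha> saddle (\<lambda>n. 1 / (sqrt 2 * width n)) X =
      Re (\<Sum>i\<le>d. of_real (real (d choose i) * X ^ i) * (L (d - i) i / L 0 0))"
    by (metis Re_complex_of_real)
  also have "\<dots> = (\<Sum>i\<le>d. (real (d choose i) * Re (L (d - i) i / L 0 0)) * X ^ i)"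
    unfolding Re_sum
    by (intro sum.cong refl)
      (simp only: times_complex.sel Re_complex_of_real Im_complex_of_real mult_zero_left diff_zero mult_ac)
  finally show ?thesis by (simp add: \<alpha>_def[abs_def])
qed

text \<open>On \<open>K\<close>, bounded by \<open>B\<close>, the difference is dominated by the sum
  of the coefficient errors weighted with the powers of \<open>\<bar>B\<bar>\<close>, which does not
  depend on the point.\<close>

lemma uniform_limit_polynomial:
  fixes c :: "nat \<Rightarrow> nat \<Rightarrow> real"
  assumes "\<And>i. i \<le> d \<Longrightarrow> (\<lambda>n. c n i) \<longlonglongrightarrow> l i" "compact K"
  shows "uniform_limit K (\<lambda>n X. \<Sum>i\<le>d. c n i * X ^ i) (\<lambda>X. \<Sum>i\<le>d. l i * X ^ i) sequentially"
proof -
  obtain B where B: "\<And>X. X \<in> K \<Longrightarrow> \<bar>X\<bar> \<le> B"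
    using compact_imp_bounded[OF assms(2)] by (auto simp: bounded_iff)
  define h where "h n = (\<Sum>i\<le>d. \<bar>c n i - l i\<bar> * \<bar>B\<bar> ^ i)" for n
  have bound: "dist (\<Sum>i\<le>d. c n i * X ^ i) (\<Sum>i\<le>d. l i * X ^ i) \<le> h n" if "X \<in> K" for n X
  proof -
    have "dist (\<Sum>i\<le>d. c n i * X ^ i) (\<Sum>i\<le>d. l i * X ^ i) = \<bar>\<Sum>i\<le>d. (c n i - l i) * X ^ i\<bar>"
      by (simp add: dist_real_def sum_subtractf left_diff_distrib)
    also have "\<dots> \<le> (\<Sum>i\<le>d. \<bar>(c n i - l i) * X ^ i\<bar>)" by (rule sum_abs)
    also have "\<dots> \<le> h n" unfolding h_def
    proof (rule sum_mono)
      fix i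
      have "\<bar>X\<bar> ^ i \<le> \<bar>B\<bar> ^ i" using B[OF that] by (intro power_mono) auto
      then show "\<bar>(c n i - l i) * X ^ i\<bar> \<le> \<bar>c n i - l i\<bar> * \<bar>B\<bar> ^ i"
        by (simp add: abs_mult power_abs mult_left_mono)
    qed
    finally show ?thesis .
  qed
  have "h \<longlonglongrightarrow> (\<Sum>i\<le>d. \<bar>l i - l i\<bar> * \<bar>B\<bar> ^ i)"
    unfolding h_def by (intro tendsto_intros assms(1)) auto
  then have h0: "h \<longlonglongrightarrow> 0" by simp
  show ?thesis
  proof (rule uniform_limitI)
    fix e :: real assume "e > 0"
    have "\<forall>\<^sub>F n in sequentially. h n < e" using order_tendstoD(2)[OF h0 \<open>e > 0\<close>] .
    then show "\<forall>\<^sub>F n in sequentially. \<forall>X\<in>K. dist (\<Sum>i\<le>d. c n i * X ^ i) (\<Sum>i\<le>d. l i * X ^ i) < e"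
      by eventually_elim (use bound in \<open>auto intro: le_less_trans\<close>)
  qed
qed

lemma uniform_limit_jensen_hat_bip:
  assumes b: "b > 0" "0 \<le> a" "a < int b" and K: "compact K"
  shows "uniform_limit K (\<lambda>N X. jensen_hat d N (\<lambda>n. real (bip a (int b) n)) saddle (\<lambda>n. 1 / (sqrt 2 * width n)) X)
     (hermite d) sequentially"
proof -
  define L where "L N D i = integral\<^sup>L lborel (scaled_kernel b a D i N)" for N D i
  have lim: "(\<lambda>N. real (d choose i) * Re (L N (d - i) i / L N 0 0)) \<longlonglongrightarrow> real (d choose i) * herm (d - i) 0" for i
  proof -
    have "(\<lambda>N. L N (d - i) i / L N 0 0) \<longlonglongrightarrow> of_real (sqrt (2 * pi) * herm (d - i) 0) / of_real (sqrt (2 * pi) * herm 0 0)"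
      unfolding L_def by (intro tendsto_divide integral_scaled_kernel_tendsto b(1)) simp
    then have "(\<lambda>N. Re (L N (d - i) i / L N 0 0)) \<longlonglongrightarrow> Re (of_real (sqrt (2 * pi) * herm (d - i) 0) / of_real (sqrt (2 * pi) * herm 0 0))"
      by (rule tendsto_Re)
    then show ?thesis by (intro tendsto_mult_left) simp
  qed
  have "uniform_limit K (\<lambda>N X. \<Sum>i\<le>d. (real (d choose i) * Re (L N (d - i) i / L N 0 0)) * X ^ i)
      (\<lambda>X. \<Sum>i\<le>d. (real (d choose i) * herm (d - i) 0) * X ^ i) sequentially"
    by (rule uniform_limit_polynomial[OF lim K])
  moreover have "(\<Sum>i\<le>d. (real (d choose i) * herm (d - i) 0) * X ^ i) = hermite d X" for X
    unfolding hermite_eq_herm by (subst herm_expansion) (simp add: mult_ac)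
  moreover have "\<forall>\<^sub>F N in sequentially. \<forall>X\<in>K. (\<Sum>i\<le>d. (real (d choose i) * Re (L N (d - i) i / L N 0 0)) * X ^ i)
      = jensen_hat d N (\<lambda>n. real (bip a (int b) n)) saddle (\<lambda>n. 1 / (sqrt 2 * width n)) X"
    using eventually_saddle_le[of 1, OF zero_less_one] eventually_ge_at_top[of d]
    by eventually_elim (auto simp: jensen_hat_bip[OF b] L_def)
  ultimately show ?thesis
    by (subst (asm) uniform_limit_cong) auto
qed

text \<open>The substitution \<open>(\<delta> n * X - 1) / exp (A n)\<close> is increasing in
  \<open>X\<close>, so for large \<open>n\<close> it carries the finitely many alternation points of
  the limit, in order, to alternation points of the Jensen polynomial.\<close>

lemma hyperbolic_jensen_eventually:
  assumes lim: "\<And>X. (\<lambda>n. jensen_hat d n \<alpha> A \<delta> X) \<longlonglongrightarrow> hermite d X"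
    and pos: "\<And>n. \<delta> n > 0" "\<And>n. \<alpha> n \<ge> 0"
  shows "\<forall>\<^sub>F n in sequentially. hyperbolic_jensen d n \<alpha>"
proof -
  obtain p :: "nat \<Rightarrow> real" where p: "\<And>i. i < d \<Longrightarrow> p i < p (Suc i)"
    "\<And>i. i \<le> d \<Longrightarrow> (-1) ^ (d + i) * hermite d (p i) > 0"
    using herm_alternates[of d] unfolding hermite_eq_herm by auto
  have "\<forall>\<^sub>F n in sequentially. \<forall>i\<in>{..d}. (-1) ^ (d + i) * jensen_hat d n \<alpha> A \<delta> (p i) > 0"
  proof (intro eventually_ball_finite ballI)
    fix i assume "i \<in> {..d}"
    then have i: "i \<le> d" by simp
    have "(\<lambda>n. (-1) ^ (d + i) * jensen_hat d n \<alpha> A \<delta> (p i)) \<longlonglongrightarrow> (-1) ^ (d + i) * hermite d (p i)"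
      by (intro tendsto_mult_left lim)
    from order_tendstoD(1)[OF this p(2)[OF i]]
    show "\<forall>\<^sub>F n in sequentially. (-1) ^ (d + i) * jensen_hat d n \<alpha> A \<delta> (p i) > 0" .
  qed simp
  then show ?thesis
  proof eventually_elim
    case (elim n)
    show ?case
    proof (rule hyperbolic_jensenI[where p = "\<lambda>i. (\<delta> n * p i - 1) / exp (A n)"])
      show "(\<delta> n * p i - 1) / exp (A n) < (\<delta> n * p (Suc i) - 1) / exp (A n)" if "i < d" for i
        using p(1)[OF that] pos(1)[of n] by (simp add: divide_strict_right_mono)
      fix i assume "i \<le> d"
      have c0: "inverse (\<delta> n ^ d) / \<alpha> n \<ge> 0" using pos(2)[of n] less_imp_le[OF pos(1)[of n]] by simp
      let ?J = "jensen d n \<alpha> ((\<delta> n * p i - 1) / exp (A n))"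
      have "0 < (-1) ^ (d + i) * jensen_hat d n \<alpha> A \<delta> (p i)" using elim \<open>i \<le> d\<close> by simp
      also have "\<dots> = (inverse (\<delta> n ^ d) / \<alpha> n) * ((-1) ^ (d + i) * ?J)" by (simp add: jensen_hat_def)
      finally have "0 < (inverse (\<delta> n ^ d) / \<alpha> n) * ((-1) ^ (d + i) * ?J)" .
      \<comment> \<open>The prefactor is known to be nonnegative; positivity of the product makes it
        nonzero, so the sign passes to the Jensen polynomial.\<close>
      moreover have "0 < y" if "0 < c * y" "0 \<le> c" for c y :: real
        using that by (auto simp: zero_less_mult_iff)
      ultimately show "0 < (-1) ^ (d + i) * ?J" using c0 by blast
    qed
  qed
qed

theorem theorem1p4:
  fixes j a b :: int and \<alpha> :: "nat \<Rightarrow> real"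
  assumes "even j" and "b > 1" and "0 \<le> a" and "a < b"
    and "\<alpha> = (\<lambda>n. real (pbar j (2 * n))) \<or> \<alpha> = (\<lambda>n. real (pbar_mod j a b (2 * n)))"
  shows "\<exists>A \<delta> :: nat \<Rightarrow> real.
           (\<forall>n. A n > 0 \<and> \<delta> n > 0) \<and> \<delta> \<longlonglongrightarrow> 0 \<and>
           (\<forall>d\<ge>1. \<forall>K::real set. compact K \<longrightarrow>
              uniform_limit K (\<lambda>n X. jensen_hat d n \<alpha> A \<delta> X) (hermite d) sequentially) \<and>
           (\<forall>d\<ge>1. \<forall>\<^sub>F n in sequentially. hyperbolic_jensen d n \<alpha>)"
proof -
  obtain a' :: int and b' :: nat where b': "b' > 0" "0 \<le> a'" "a' < int b'"
    and \<alpha>: "\<alpha> = (\<lambda>n. real (pbar_mod j a' (int b') (2 * n)))"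
  proof (cases "\<alpha> = (\<lambda>n. real (pbar j (2 * n)))")
    case True
    then show thesis using that[of 1 0] by (simp add: pbar_eq_pbar_mod)
  next
    case False
    then show thesis using that[of "nat b" a] assms by simp
  qed
  define s where "s = core_size j div 2"
  define \<beta> where "\<beta> n = real (bip a' (int b') n)" for n
  \<comment> \<open>The indices at which saddle point and width of the shifted argument are under
    control; elsewhere both sequences get the value 1, which makes them positive everywhere.\<close>
  define good where "good n \<longleftrightarrow> n \<ge> s \<and> n - s \<ge> 1 \<and> saddle (n - s) \<le> 1" for n
  define A where "A n = (if good n then saddle (n - s) else 1)" for n
  define \<delta> where "\<delta> n = (if good n then 1 / (sqrt 2 * width (n - s)) else 1)" for n
  have \<alpha>\<beta>: "\<alpha> (n + s) = \<beta> n" for n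
    unfolding \<alpha> \<beta>_def s_def using pbar_mod_eq_bip[OF assms(1)] by simp
  have pos: "A n > 0" "\<delta> n > 0" for n
    using saddle(4)[of "n - s"] width_bounds(3)[of "n - s"] by (auto simp: A_def \<delta>_def good_def)
  have good_ev: "\<forall>\<^sub>F n in sequentially. good (n + s)"
    using eventually_saddle_le[of 1, OF zero_less_one] by eventually_elim (simp add: good_def)
  have "(\<lambda>n. \<delta> (n + s)) \<longlonglongrightarrow> 0"
  proof (rule Lim_transform_eventually)
    show "(\<lambda>n. 1 / sqrt 2 * (1 / width n)) \<longlonglongrightarrow> 0"
      by (rule tendsto_mult_right_zero[OF inverse_width_tendsto_0])
    show "\<forall>\<^sub>F n in sequentially. 1 / sqrt 2 * (1 / width n) = \<delta> (n + s)"
      using good_ev by eventually_elim (simp add: \<delta>_def)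
  qed
  then have \<delta>0: "\<delta> \<longlonglongrightarrow> 0" by (rule LIMSEQ_offset)
  have unif: "uniform_limit K (\<lambda>n X. jensen_hat d n \<alpha> A \<delta> X) (hermite d) sequentially" if "compact K" for K d
  proof -
    have shift: "jensen_hat d (n + s) \<alpha> A \<delta> X = jensen_hat d n \<beta> saddle (\<lambda>n. 1 / (sqrt 2 * width n)) X"
      if "good (n + s)" for n X
    proof -
      have "\<alpha> (n + s + k) = \<beta> (n + k)" for k using \<alpha>\<beta>[of "n + k"] by (simp add: ac_simps)
      then show ?thesis using that \<alpha>\<beta>[of n] by (simp add: jensen_hat_def jensen_def A_def \<delta>_def)
    qed
    show ?thesis
    proof (rule uniform_limitI)
      fix e :: real assume "e > 0"
      define P where "P n \<longleftrightarrow> (\<forall>X\<in>K. dist (jensen_hat d n \<alpha> A \<delta> X) (hermite d X) < e)" for n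
      have "\<forall>\<^sub>F n in sequentially. \<forall>X\<in>K. dist (jensen_hat d n \<beta> saddle (\<lambda>n. 1 / (sqrt 2 * width n)) X) (hermite d X) < e"
        using uniform_limit_jensen_hat_bip[OF b' \<open>compact K\<close>, of d, folded \<beta>_def] \<open>e > 0\<close>
        by (rule uniform_limitD)
      with good_ev have "\<forall>\<^sub>F n in sequentially. P (n + s)"
        by eventually_elim (simp add: shift P_def)
      then have "\<forall>\<^sub>F n in sequentially. P n" by (simp only: eventually_sequentially_seg)
      then show "\<forall>\<^sub>F n in sequentially. \<forall>X\<in>K. dist (jensen_hat d n \<alpha> A \<delta> X) (hermite d X) < e"
        by (simp only: P_def)
    qed
  qed
  have hyp: "\<forall>\<^sub>F n in sequentially. hyperbolic_jensen d n \<alpha>" for d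
  proof (rule hyperbolic_jensen_eventually)
    show "(\<lambda>n. jensen_hat d n \<alpha> A \<delta> X) \<longlonglongrightarrow> hermite d X" for X
      using tendsto_uniform_limitI[OF unif[of "{X}" d], of X] by simp
  qed (simp_all add: pos \<alpha>)
  show ?thesis
    by (intro exI[of _ A] exI[of _ \<delta>] conjI allI impI pos \<delta>0 unif hyp)
qed

end
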